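(* Let $G$ be a unimodular Lie group with a left-invariant abelian complex structure $J$. A left-invariant Hermitian metric $g$ on $(G,J)$ is balanced if and only if $k=\mathrm{tr}_gK(g)$ and the Riemannian scalar curvature of $g$ coincide, and in the balanced case $K(g)=\mathrm{Ric}^{1,1}(g)$. Furthermore, the parabolic flow $$\tfrac{d}{dt}\,g_t=-\mathrm{Ric}^{1,1}(g_t)$$ has a long-time solution (i.e. a left-invariant solution defined for all $t\in[0,\infty)$) for every left-invariant initial Hermitian metric on $(G,J)$.
   Context: A left-invariant complex structure $J$ on $G$ with Lie algebra $\mathfrak g$ is abelian if $\mathfrak g^{1,0}\subset\mathfrak g\otimes\mathbb C$ is an abelian Lie algebra, equivalently $[JX,JY]=[X,Y]$ for all $X,Y\in\mathfrak g$. $G$ is unimodular if $\mathrm{tr}\,\mathrm{ad}_X=0$ for all $X\in\mathfrak g$. A Hermitian metric is balanced if its fundamental form is coclosed. $\mathrm{Ric}$ is the Levi-Civita Ricci tensor and $\mathrm{Ric}^{1,1}=\frac12(\mathrm{Ric}(\cdot,\cdot)+\mathrm{Ric}(J\cdot,J\cdot))$. For left-invariant initial data the flow is understood as the ODE on the space of left-invariant Hermitian metrics. The tensor $K$: let $\nabla$ be the Chern connection of $(J,g)$ (the unique connection with $\nabla J=\nabla g=0$ whose torsion $T$ has vanishing $(1,1)$-part) and $\Omega$ its curvature. In a $(1,0)$-frame put $T_{ij\bar k}=g_{a\bar k}T_{ij}^a$ (with $T_{\bar i\bar j k}=\overline{T_{ij\bar k}}$), $S_{i\bar j}=g^{k\bar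 l}\Omega_{k\bar l i\bar j}$, where $\Omega_{k\bar l i\bar j}=g(\nabla_k\nabla_{\bar l}Z_i-\nabla_{\bar l}\nabla_kZ_i-\nabla_{[Z_k,Z_{\bar l}]}Z_i,Z_{\bar j})$, and $Q^1_{i\bar j}=g^{k\bar l}g^{m\bar n}T_{ik\bar n}T_{\bar j\bar l m}$, $Q^2_{i\bar j}=g^{\bar l k}g^{\bar n m}T_{\bar l\bar n i}T_{km\bar j}$, $Q^3_{i\bar j}=g^{\bar l k}g^{\bar n m}T_{ik\bar l}T_{\bar j\bar n m}$, $Q^4_{i\bar j}=\frac12 g^{\bar l k}g^{\bar n m}(T_{mk\bar l}T_{\bar n\bar j i}+T_{\bar n\bar l k}T_{mi\bar j})$. Set $Q=\frac12Q^1-\frac14Q^2-\frac12Q^3+Q^4$ and $K(g)=S-Q$, viewed as a $J$-invariant symmetric 2-tensor. Trace convention: for a symmetric 2-tensor $h$, $\mathrm{tr}_gh=g^{\bar j i}h_{i\bar j}=\sum_i h(Z_i,\bar Z_i)$ in a unitary frame ($g(Z_i,\bar Z_j)=\delta_{ij}$, $g$ extended complex bilinearly). Both $k=\mathrm{tr}_gK$ and the scalar curvature $\mathrm{tr}_g\mathrm{Ric}$ are computed with this trace. *)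

theory Defs
  imports "HOL-Analysis.Analysis"
begin

text \<open>
  A Lie group with left-invariant structure is represented by its Lie algebra: a type of class
  \<open>euclidean_space\<close>, used only as a finite-dimensional real vector space, with a bracket \<open>br\<close>.
  Left-invariant vector fields are elements, left-invariant tensors are multilinear maps, and
  left-invariant functions are constant, so every derivative of a function of the form
  \<open>g(X, Y)\<close> vanishes. The inner product of the type class is never the metric; it enters only
  through the coordinates \<open>x \<bullet> b\<close>, \<open>b \<in> Basis\<close>.
\<close>

definition lie_bracket :: "('a::euclidean_space \<Rightarrow> 'a \<Rightarrow> 'a) \<Rightarrow> bool" where
  "lie_bracket br \<longleftrightarrow> bilinear br \<and> (\<forall>x. br x x = 0) \<and>
     (\<forall>x y z. br x (br y z) + br y (br z x) + br z (br x y) = 0)"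

definition endo_trace :: "('a::euclidean_space \<Rightarrow> 'a) \<Rightarrow> real" where
  "endo_trace f = (\<Sum>b\<in>Basis. f b \<bullet> b)"

definition unimodular :: "('a::euclidean_space \<Rightarrow> 'a \<Rightarrow> 'a) \<Rightarrow> bool" where
  "unimodular br \<longleftrightarrow> (\<forall>x. endo_trace (br x) = 0)"


section \<open>Complexification\<close>

text \<open>The pair \<open>(x, y)\<close> stands for \<open>x + \<i> y\<close>.\<close>

type_synonym 'a cpx = "'a \<times> 'a"

definition cpx_scale :: "complex \<Rightarrow> 'a::real_vector cpx \<Rightarrow> 'a cpx" where
  "cpx_scale c Z = (Re c *\<^sub>R fst Z - Im c *\<^sub>R snd Z, Re c *\<^sub>R snd Z + Im c *\<^sub>R fst Z)"

definition cpx_cnj :: "'a::real_vector cpx \<Rightarrow> 'a cpx" where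
  "cpx_cnj Z = (fst Z, - snd Z)"

text \<open>Complex (bi)linear extensions of real endomorphisms, vector-valued bilinear maps and
  real-valued bilinear forms.\<close>

definition ext_lin :: "('a \<Rightarrow> 'a) \<Rightarrow> 'a cpx \<Rightarrow> 'a cpx" where
  "ext_lin f Z = (f (fst Z), f (snd Z))"

definition ext_bil :: "('a \<Rightarrow> 'a \<Rightarrow> 'a::real_vector) \<Rightarrow> 'a cpx \<Rightarrow> 'a cpx \<Rightarrow> 'a cpx" where
  "ext_bil B Z W =
     (B (fst Z) (fst W) - B (snd Z) (snd W), B (fst Z) (snd W) + B (snd Z) (fst W))"

definition ext_form :: "('a \<Rightarrow> 'a \<Rightarrow> real) \<Rightarrow> 'a cpx \<Rightarrow> 'a cpx \<Rightarrow> complex" where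
  "ext_form h Z W =
     Complex (h (fst Z) (fst W) - h (snd Z) (snd W)) (h (fst Z) (snd W) + h (snd Z) (fst W))"

definition g10 :: "('a::real_vector \<Rightarrow> 'a) \<Rightarrow> 'a cpx set" where
  "g10 J = {Z. ext_lin J Z = cpx_scale \<i> Z}"


section \<open>Complex structures and Hermitian metrics\<close>

definition complex_structure ::
  "('a::euclidean_space \<Rightarrow> 'a \<Rightarrow> 'a) \<Rightarrow> ('a \<Rightarrow> 'a) \<Rightarrow> bool" where
  "complex_structure br J \<longleftrightarrow> linear J \<and> (\<forall>x. J (J x) = - x) \<and>
     (\<forall>Z\<in>g10 J. \<forall>W\<in>g10 J. ext_bil br Z W \<in> g10 J)"

definition abelian_structure ::
  "('a::euclidean_space \<Rightarrow> 'a \<Rightarrow> 'a) \<Rightarrow> ('a \<Rightarrow> 'a) \<Rightarrow> bool" where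
  "abelian_structure br J \<longleftrightarrow> (\<forall>Z\<in>g10 J. \<forall>W\<in>g10 J. ext_bil br Z W = 0)"

definition hermitian_metric ::
  "('a::euclidean_space \<Rightarrow> 'a) \<Rightarrow> ('a \<Rightarrow> 'a \<Rightarrow> real) \<Rightarrow> bool" where
  "hermitian_metric J g \<longleftrightarrow> bilinear g \<and> (\<forall>x y. g x y = g y x) \<and>
     (\<forall>x. x \<noteq> 0 \<longrightarrow> g x x > 0) \<and> (\<forall>x y. g (J x) (J y) = g x y)"

definition fundamental_form ::
  "('a \<Rightarrow> 'a) \<Rightarrow> ('a \<Rightarrow> 'a \<Rightarrow> real) \<Rightarrow> 'a \<Rightarrow> 'a \<Rightarrow> real" where
  "fundamental_form J g x y = g (J x) y"


section \<open>Levi-Civita connection, Ricci tensor, codifferential\<close>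

text \<open>A left-invariant connection is a bilinear map \<open>D\<close>, with \<open>D x y\<close> for \<open>\<nabla>\<^sub>x y\<close>.\<close>

definition levi_civita ::
  "('a::euclidean_space \<Rightarrow> 'a \<Rightarrow> 'a) \<Rightarrow> ('a \<Rightarrow> 'a \<Rightarrow> real) \<Rightarrow> 'a \<Rightarrow> 'a \<Rightarrow> 'a" where
  "levi_civita br g = (THE D. bilinear D \<and>
     (\<forall>x y. D x y - D y x = br x y) \<and>
     (\<forall>x y z. g (D x y) z + g y (D x z) = 0))"

definition curvature ::
  "('a::euclidean_space \<Rightarrow> 'a \<Rightarrow> 'a) \<Rightarrow> ('a \<Rightarrow> 'a \<Rightarrow> 'a) \<Rightarrow> 'a \<Rightarrow> 'a \<Rightarrow> 'a \<Rightarrow> 'a" where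
  "curvature br D x y z = D x (D y z) - D y (D x z) - D (br x y) z"

definition Ric ::
  "('a::euclidean_space \<Rightarrow> 'a \<Rightarrow> 'a) \<Rightarrow> ('a \<Rightarrow> 'a \<Rightarrow> real) \<Rightarrow> 'a \<Rightarrow> 'a \<Rightarrow> real" where
  "Ric br g x y = endo_trace (\<lambda>w. curvature br (levi_civita br g) w x y)"

definition Ric11 ::
  "('a::euclidean_space \<Rightarrow> 'a \<Rightarrow> 'a) \<Rightarrow> ('a \<Rightarrow> 'a) \<Rightarrow> ('a \<Rightarrow> 'a \<Rightarrow> real) \<Rightarrow> 'a \<Rightarrow> 'a \<Rightarrow> real" where
  "Ric11 br J g x y = (Ric br g x y + Ric br g (J x) (J y)) / 2"

text \<open>The metric dual of the linear form \<open>x \<mapsto> x \<bullet> b\<close>, i.e. of the coordinate along \<open>b \<in> Basis\<close>;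
  its components are the entries \<open>g\<^sup>a\<^sup>b\<close> of the inverse metric.\<close>

definition sharp ::
  "('a::euclidean_space \<Rightarrow> 'a \<Rightarrow> real) \<Rightarrow> 'a \<Rightarrow> 'a" where
  "sharp g b = (THE v. \<forall>x. g v x = x \<bullet> b)"

text \<open>The codifferential of a left-invariant 2-form \<open>w\<close> is
  \<open>(d\<^sup>* w)(x) = - g\<^sup>a\<^sup>b (\<nabla>\<^sub>a w)(e\<^sub>b, x)\<close> with \<open>\<nabla>\<close> the Levi-Civita connection; here
  \<open>(\<nabla>\<^sub>u w)(y, x) = - w(\<nabla>\<^sub>u y, x) - w(y, \<nabla>\<^sub>u x)\<close> because \<open>w(y, x)\<close> is constant.\<close>

definition codifferential2 ::
  "('a::euclidean_space \<Rightarrow> 'a \<Rightarrow> 'a) \<Rightarrow> ('a \<Rightarrow> 'a \<Rightarrow> real) \<Rightarrow> ('a \<Rightarrow> 'a \<Rightarrow> real) \<Rightarrow> 'a \<Rightarrow> real" where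
  "codifferential2 br g w x =
     - (\<Sum>b\<in>Basis. - w (levi_civita br g b (sharp g b)) x - w (sharp g b) (levi_civita br g b x))"

definition balanced ::
  "('a::euclidean_space \<Rightarrow> 'a \<Rightarrow> 'a) \<Rightarrow> ('a \<Rightarrow> 'a) \<Rightarrow> ('a \<Rightarrow> 'a \<Rightarrow> real) \<Rightarrow> bool" where
  "balanced br J g \<longleftrightarrow> (\<forall>x. codifferential2 br g (fundamental_form J g) x = 0)"


section \<open>Chern connection\<close>

definition torsion ::
  "('a::euclidean_space \<Rightarrow> 'a \<Rightarrow> 'a) \<Rightarrow> ('a \<Rightarrow> 'a \<Rightarrow> 'a) \<Rightarrow> 'a \<Rightarrow> 'a \<Rightarrow> 'a" where
  "torsion br D x y = D x y - D y x - br x y"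

definition chern ::
  "('a::euclidean_space \<Rightarrow> 'a \<Rightarrow> 'a) \<Rightarrow> ('a \<Rightarrow> 'a) \<Rightarrow> ('a \<Rightarrow> 'a \<Rightarrow> real) \<Rightarrow> 'a \<Rightarrow> 'a \<Rightarrow> 'a" where
  "chern br J g = (THE D. bilinear D \<and>
     (\<forall>x y. D x (J y) = J (D x y)) \<and>
     (\<forall>x y z. g (D x y) z + g y (D x z) = 0) \<and>
     (\<forall>Z\<in>g10 J. \<forall>W\<in>g10 J. ext_bil (torsion br D) Z (cpx_cnj W) = 0))"


section \<open>Components in a (1,0)-frame\<close>

text \<open>A (1,0)-frame is a complex basis of \<open>g10 J\<close>. It exists exactly for index types \<open>'n\<close> with
  \<open>2 * CARD('n) = DIM('a)\<close>.\<close>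

definition frame10 :: "('a::euclidean_space \<Rightarrow> 'a) \<Rightarrow> ('n::finite \<Rightarrow> 'a cpx) \<Rightarrow> bool" where
  "frame10 J Z \<longleftrightarrow> (\<forall>i. Z i \<in> g10 J) \<and>
     (\<forall>W\<in>g10 J. \<exists>!c::'n \<Rightarrow> complex. W = (\<Sum>i\<in>UNIV. cpx_scale (c i) (Z i)))"

text \<open>\<open>hcomp h Z i j\<close> is \<open>h\<close> with indices \<open>i\<close> and \<open>j\<close>-bar.\<close>

definition hcomp ::
  "('a \<Rightarrow> 'a \<Rightarrow> real) \<Rightarrow> ('n \<Rightarrow> 'a::real_vector cpx) \<Rightarrow> 'n \<Rightarrow> 'n \<Rightarrow> complex" where
  "hcomp h Z i j = ext_form h (Z i) (cpx_cnj (Z j))"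

text \<open>\<open>ginv g Z k l\<close> is the inverse metric with upper indices \<open>k\<close> and \<open>l\<close>-bar, which also is
  the one with \<open>l\<close>-bar written first. It satisfies
  \<open>(\<Sum>l. ginv g Z k l * hcomp g Z m l) = (if k = m then 1 else 0)\<close>, whence the transposition.\<close>

definition ginv ::
  "('a \<Rightarrow> 'a \<Rightarrow> real) \<Rightarrow> ('n::finite \<Rightarrow> 'a::real_vector cpx) \<Rightarrow> 'n \<Rightarrow> 'n \<Rightarrow> complex" where
  "ginv g Z k l = matrix_inv ((\<chi> i j. hcomp g Z i j) :: complex ^ 'n ^ 'n) $ l $ k"

definition tr_herm ::
  "('a \<Rightarrow> 'a \<Rightarrow> real) \<Rightarrow> ('n::finite \<Rightarrow> 'a::real_vector cpx) \<Rightarrow> ('n \<Rightarrow> 'n \<Rightarrow> complex) \<Rightarrow> complex" where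
  "tr_herm g Z h = (\<Sum>i\<in>UNIV. \<Sum>j\<in>UNIV. ginv g Z i j * h i j)"

text \<open>\<open>TT br J g Z i j k\<close> is the Chern torsion \<open>g\<^sub>a\<^sub>k T\<^sub>i\<^sub>j\<^sup>a\<close> with lower indices \<open>i\<close>, \<open>j\<close>,
  \<open>k\<close>-bar (\<open>a\<close> contracted, \<open>k\<close> barred in the metric), and \<open>TTb\<close> is its conjugate, with lower
  indices \<open>i\<close>-bar, \<open>j\<close>-bar, \<open>k\<close>.\<close>

definition TT ::
  "('a::euclidean_space \<Rightarrow> 'a \<Rightarrow> 'a) \<Rightarrow> ('a \<Rightarrow> 'a) \<Rightarrow> ('a \<Rightarrow> 'a \<Rightarrow> real) \<Rightarrow> ('n \<Rightarrow> 'a cpx) \<Rightarrow>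
    'n \<Rightarrow> 'n \<Rightarrow> 'n \<Rightarrow> complex" where
  "TT br J g Z i j k =
     ext_form g (ext_bil (torsion br (chern br J g)) (Z i) (Z j)) (cpx_cnj (Z k))"

definition TTb ::
  "('a::euclidean_space \<Rightarrow> 'a \<Rightarrow> 'a) \<Rightarrow> ('a \<Rightarrow> 'a) \<Rightarrow> ('a \<Rightarrow> 'a \<Rightarrow> real) \<Rightarrow> ('n \<Rightarrow> 'a cpx) \<Rightarrow>
    'n \<Rightarrow> 'n \<Rightarrow> 'n \<Rightarrow> complex" where
  "TTb br J g Z i j k = cnj (TT br J g Z i j k)"

text \<open>The curvature component with indices \<open>k\<close>, \<open>l\<close>-bar, \<open>i\<close>, \<open>j\<close>-bar.\<close>

definition chern_curv ::
  "('a::euclidean_space \<Rightarrow> 'a \<Rightarrow> 'a) \<Rightarrow> ('a \<Rightarrow> 'a) \<Rightarrow> ('a \<Rightarrow> 'a \<Rightarrow> real) \<Rightarrow> ('n \<Rightarrow> 'a cpx) \<Rightarrow>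
    'n \<Rightarrow> 'n \<Rightarrow> 'n \<Rightarrow> 'n \<Rightarrow> complex" where
  "chern_curv br J g Z k l i j =
     (let D = ext_bil (chern br J g); Zk = Z k; Zl = cpx_cnj (Z l) in
      ext_form g (D Zk (D Zl (Z i)) - D Zl (D Zk (Z i)) - D (ext_bil br Zk Zl) (Z i))
        (cpx_cnj (Z j)))"

context
  fixes br :: "'a::euclidean_space \<Rightarrow> 'a \<Rightarrow> 'a" and J :: "'a \<Rightarrow> 'a"
    and g :: "'a \<Rightarrow> 'a \<Rightarrow> real" and Z :: "'n::finite \<Rightarrow> 'a cpx"
begin

definition S_tensor :: "'n \<Rightarrow> 'n \<Rightarrow> complex" where
  "S_tensor i j = (\<Sum>k\<in>UNIV. \<Sum>l\<in>UNIV. ginv g Z k l * chern_curv br J g Z k l i j)"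

definition Q1 :: "'n \<Rightarrow> 'n \<Rightarrow> complex" where
  "Q1 i j = (\<Sum>k\<in>UNIV. \<Sum>l\<in>UNIV. \<Sum>m\<in>UNIV. \<Sum>n\<in>UNIV.
     ginv g Z k l * ginv g Z m n * TT br J g Z i k n * TTb br J g Z j l m)"

definition Q2 :: "'n \<Rightarrow> 'n \<Rightarrow> complex" where
  "Q2 i j = (\<Sum>k\<in>UNIV. \<Sum>l\<in>UNIV. \<Sum>m\<in>UNIV. \<Sum>n\<in>UNIV.
     ginv g Z k l * ginv g Z m n * TTb br J g Z l n i * TT br J g Z k m j)"

definition Q3 :: "'n \<Rightarrow> 'n \<Rightarrow> complex" where
  "Q3 i j = (\<Sum>k\<in>UNIV. \<Sum>l\<in>UNIV. \<Sum>m\<in>UNIV. \<Sum>n\<in>UNIV.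
     ginv g Z k l * ginv g Z m n * TT br J g Z i k l * TTb br J g Z j n m)"

definition Q4 :: "'n \<Rightarrow> 'n \<Rightarrow> complex" where
  "Q4 i j = 1/2 * (\<Sum>k\<in>UNIV. \<Sum>l\<in>UNIV. \<Sum>m\<in>UNIV. \<Sum>n\<in>UNIV.
     ginv g Z k l * ginv g Z m n *
       (TT br J g Z m k l * TTb br J g Z n j i + TTb br J g Z n l k * TT br J g Z m i j))"

text \<open>\<open>K_tensor br J g Z i j\<close> is the component with indices \<open>i\<close>, \<open>j\<close>-bar of \<open>K(g)\<close>; these
  components determine \<open>K(g)\<close>, as it is symmetric and \<open>J\<close>-invariant.\<close>

definition K_tensor :: "'n \<Rightarrow> 'n \<Rightarrow> complex" where
  "K_tensor i j = S_tensor i j - (1/2 * Q1 i j - 1/4 * Q2 i j - 1/2 * Q3 i j + Q4 i j)"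

end

end

theory Submission
  imports Defs
begin

text \<open>
  Everything is expressed through one tensor. On the real Lie algebra, with \<open>J\<close> as multiplication
  by \<open>\<i>\<close>, let \<open>\<beta>(x, y)\<close> be the \<open>(1,0)\<close>-part of \<open>[Z\<^sub>x, conj Z\<^sub>y]\<close>, where \<open>Z\<^sub>x = x - \<i> J x\<close>. As
  \<open>(1,0)\<close>-vectors commute, \<open>\<beta>\<close> determines the bracket. It is complex linear in \<open>x\<close> and antilinear
  in \<open>y\<close>, and it has two properties that carry the whole proof: the Jacobi identity gives
  \<open>\<beta>(x, \<beta>(z, y)) = \<beta>(y, \<beta>(z, x))\<close> (\<open>\<beta>_jacobi\<close>), and unimodularity gives \<open>tr \<beta>(\<cdot>, z) = 0\<close>
  (\<open>\<beta>_trace\<close>). Put \<open>lee = \<Sum> \<beta>(e, e)\<close> over a \<open>g\<close>-orthonormal basis; the metric is balanced if and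
  only if \<open>lee = 0\<close> (\<open>balanced_iff\<close>).

  The Chern connection is \<open>- \<beta>(\<cdot>, y)\<close> in the direction of \<open>conj Z\<^sub>y\<close> and the adjoint of \<open>\<beta>(\<cdot>, y)\<close> in
  the direction of \<open>Z\<^sub>y\<close>, so that \<open>S\<close> and the \<open>Q\<^sup>i\<close> are contractions of products of two \<open>\<beta>\<close>. Only
  three of these survive, apart from terms with \<open>lee\<close>: all other contractions contain
  \<open>\<Sum> \<beta>(e, \<beta>(e, x)) = \<beta>(x, lee)\<close> or a trace \<open>tr \<beta>(\<cdot>, z)\<close>, by the Jacobi identity. The same
  identities kill the \<open>(1,1)\<close>-part of the Killing form, so that Milnor's formula for the Ricci tensor
  of a unimodular metric Lie algebra expresses \<open>Ric\<^sup>1\<^sup>,\<^sup>1\<close> by the same three contractions, with the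
  same coefficients (\<open>ricci_herm\<close>). Hence \<open>K = Ric\<^sup>1\<^sup>,\<^sup>1\<close> if \<open>lee = 0\<close>; and in general the traces differ
  by a multiple of \<open>g(lee, lee)\<close> (\<open>K_herm_trace\<close>, \<open>ricci_herm_trace\<close>), which vanishes only in the
  balanced case.

  For the flow, let the initial metric \<open>g\<close> and its orthonormal basis stand still and move the bracket
  instead: put \<open>g\<^sub>t = g(h\<^sub>t \<cdot>, h\<^sub>t \<cdot>)\<close> with \<open>h' = - R h / 2\<close>, where \<open>R\<close> is the Ricci operator of
  \<open>Ric\<^sup>1\<^sup>,\<^sup>1\<close> in the frame moved by \<open>h\<close>. With the inverse \<open>k\<close> of \<open>h\<close> as a second unknown, \<open>k' = k R / 2\<close>,
  this is a polynomial differential equation. The Ricci tensor without its Killing part is, up to a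
  factor, the gradient of the squared norm of the bracket as a function of the metric; therefore this
  norm decreases along the flow (\<open>bracket_norm2_nonincreasing\<close>), \<open>R\<close> stays bounded, and \<open>h\<close> and \<open>k\<close>
  grow at most exponentially. A solution that cannot blow up in finite time exists for all time
  (\<open>ode_global_existence\<close>).
\<close>

section \<open>Ordinary differential equations in Banach spaces\<close>

lemma continuous_on_of_vector_derivative:
  fixes f :: "real \<Rightarrow> 'b::real_normed_vector"
  assumes "\<And>t. t \<in> A \<Longrightarrow> (f has_vector_derivative f' t) (at t within A)"
  shows "continuous_on A f"
  using assms has_vector_derivative_continuous continuous_on_eq_continuous_within by blast

text \<open>A weak form of Gronwall's inequality that only uses the mean value inequality. At the time \<open>p\<close>
  where \<open>exp(-2Cs) |f s|\<close> is largest, with value \<open>u\<close>, the norm of \<open>f'\<close> up to \<open>p\<close> is at most the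
  derivative of \<open>u/2 exp(2Cs)\<close>; so half of \<open>|f p|\<close> is absorbed by the left hand side. With
  \<open>f 0 = 0\<close> it yields uniqueness, otherwise it yields bounds.\<close>
lemma gronwall_norm:
  fixes f :: "real \<Rightarrow> 'b::real_normed_vector"
  assumes deriv: "\<And>t. t \<in> {0..T} \<Longrightarrow> (f has_vector_derivative f' t) (at t within {0..T})"
    and bound: "\<And>t. t \<in> {0..T} \<Longrightarrow> norm (f' t) \<le> C * norm (f t)"
    and C: "0 \<le> C" and t: "t \<in> {0..T}"
  shows "norm (f t) \<le> 2 * norm (f 0) * exp (2 * C * t)"
proof -
  define u where "u s = exp (- 2 * C * s) * norm (f s)" for s
  have contf: "continuous_on {0..T} f"
    using deriv by (rule continuous_on_of_vector_derivative)
  then have "continuous_on {0..T} u"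
    unfolding u_def by (intro continuous_intros)
  moreover have "{0..T} \<noteq> {}" using t by auto
  ultimately obtain p where p: "p \<in> {0..T}" and pmax: "\<And>s. s \<in> {0..T} \<Longrightarrow> u s \<le> u p"
    using continuous_attains_sup[of "{0..T}" u] by auto
  have norm_f: "norm (f s) = exp (2 * C * s) * u s" for s
    by (simp add: u_def flip: mult.assoc exp_add)
  have "u p \<le> 2 * norm (f 0)"
  proof (cases "p = 0")
    case True
    then show ?thesis by (simp add: u_def)
  next
    case False
    define \<phi> where "\<phi> s = u p / 2 * exp (2 * C * s)" for s
    have "norm (f p - f 0) \<le> \<phi> p - \<phi> 0"
    proof (rule differentiable_bound_general)
      show "0 < p" using p False by auto
      show "continuous_on {0..p} f"
        using contf p by (auto elim: continuous_on_subset)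
      show "continuous_on {0..p} \<phi>"
        unfolding \<phi>_def by (intro continuous_intros)
      fix s assume s: "0 < s" "s < p"
      then have "s \<in> interior {0..T}" using p by auto
      then have "at s within {0..T} = at s" by (rule at_within_interior)
      then show "(f has_vector_derivative f' s) (at s)"
        using deriv[of s] s p by simp
      show "(\<phi> has_vector_derivative u p * C * exp (2 * C * s)) (at s)"
        unfolding \<phi>_def has_real_derivative_iff_has_vector_derivative[symmetric]
        by (auto intro!: derivative_eq_intros)
      have sT: "s \<in> {0..T}" using s p by auto
      have "norm (f' s) \<le> C * norm (f s)" using bound sT by blast
      also have "\<dots> \<le> C * (exp (2 * C * s) * u p)"
        unfolding norm_f using pmax[OF sT] C by (intro mult_left_mono) auto
      finally show "norm (f' s) \<le> u p * C * exp (2 * C * s)" by (simp add: mult_ac)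
    qed
    then have "norm (f p) \<le> norm (f 0) + u p / 2 * exp (2 * C * p) - u p / 2"
      using norm_triangle_ineq2[of "f p" "f 0"] by (simp add: \<phi>_def)
    then have "exp (2 * C * p) * u p \<le> norm (f 0) + u p / 2 * exp (2 * C * p)"
      unfolding norm_f[of p] using u_def[of p] by (smt (verit) divide_nonneg_nonneg exp_ge_zero norm_ge_zero mult_nonneg_nonneg)
    then have "u p * exp (2 * C * p) \<le> 2 * norm (f 0)" by (simp add: field_simps)
    moreover have "u p * 1 \<le> u p * exp (2 * C * p)"
      using C p by (intro mult_left_mono) (auto simp: u_def)
    ultimately show ?thesis by simp
  qed
  then have "u t \<le> 2 * norm (f 0)" using pmax[OF t] by linarith
  then have "exp (2 * C * t) * u t \<le> exp (2 * C * t) * (2 * norm (f 0))"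
    by (intro mult_left_mono) auto
  then show ?thesis unfolding norm_f[of t] by (simp add: mult_ac)
qed

text \<open>Substituting \<open>x s = exp(2Ls) u s\<close> turns the integral equation into a fixed point equation for
  a contraction with constant \<open>1/2\<close> on the whole half line at once. It acts on bounded continuous
  functions because \<open>F\<close> is bounded.\<close>
lemma bounded_lipschitz_ode:
  fixes F :: "'b::banach \<Rightarrow> 'b"
  assumes lip0: "L0-lipschitz_on UNIV F" and bdd: "\<And>x. norm (F x) \<le> M"
  shows "\<exists>x. x 0 = x0 \<and> (\<forall>t\<ge>0. (x has_vector_derivative F (x t)) (at t within {0..}))"
proof -
  define L where "L = L0 + 1"
  have L: "L > 0" and lip: "L-lipschitz_on UNIV F"
    using lip0 lipschitz_on_nonneg[OF lip0] lipschitz_on_le[OF lip0, of L] by (auto simp: L_def)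
  have M: "M \<ge> 0" using bdd[of 0] norm_ge_zero[of "F 0"] by linarith
  have contF: "continuous_on UNIV F" using lip by (rule lipschitz_on_continuous_on)
  define h :: "(real \<Rightarrow>\<^sub>C 'b) \<Rightarrow> real \<Rightarrow> 'b"
    where "h u s = F (exp (2 * L * s) *\<^sub>R apply_bcontfun u s)" for u s
  have conth: "continuous_on A (h u)" for A u
    unfolding h_def
    by (rule continuous_on_compose2[OF contF]) (auto intro!: continuous_intros continuous_on_apply_bcontfun)
  have inth: "h u integrable_on {0..t}" for u t
    by (rule integrable_continuous_real[OF conth])
  define I where "I u t = x0 + integral {0..t} (h u)" for u t
  \<comment> \<open>Bounded continuous functions live on the whole line, so \<open>\<Psi> u\<close> is constant on negative times.\<close>
  define \<Psi> where "\<Psi> u t = exp (- 2 * L * max 0 t) *\<^sub>R I u (max 0 t)" for u t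
  have I_deriv: "(I u has_vector_derivative h u t) (at t within {0..T})"
    if "0 \<le> t" "t \<le> T" for u t T
    unfolding I_def using integral_has_vector_derivative[OF conth[of "{0..T}" u], of t] that
    by (auto intro!: derivative_eq_intros)
  have I_deriv': "(I u has_vector_derivative h u t) (at t within {0..})" if "0 \<le> t" for u t
  proof -
    have "at t within {0..} = at t within {0..t + 1}"
      by (rule at_within_nhd[of _ "{..<t + 1}"]) auto
    then show ?thesis using I_deriv[of t "t + 1" u] that by simp
  qed
  have contI: "continuous_on {0..} (I u)" for u
    by (rule continuous_on_of_vector_derivative[where f' = "h u"]) (auto intro: I_deriv')
  have "\<Psi> u \<in> bcontfun" for u
  proof -
    have "continuous_on UNIV (\<Psi> u)"
      unfolding \<Psi>_def
      by (intro continuous_on_scaleR continuous_on_compose2[OF contI, of _ "\<lambda>t. max 0 t"])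
        (auto intro!: continuous_intros simp: le_max_iff_disj)
    moreover have "norm (\<Psi> u t) \<le> norm x0 + M / (2 * L)" for t
    proof -
      define s where "s = max 0 t"
      have s: "s \<ge> 0" by (simp add: s_def)
      have "norm (integral {0..s} (h u)) \<le> M * (s - 0)"
        using bdd s by (intro integral_bound[OF _ conth]) (auto simp: h_def)
      then have "norm (I u s) \<le> norm x0 + M * s"
        unfolding I_def using norm_triangle_ineq[of x0 "integral {0..s} (h u)"] by simp
      also have "\<dots> \<le> (norm x0 + M / (2 * L)) * (1 + 2 * L * s)"
        using L M s by (simp add: field_simps)
      also have "\<dots> \<le> (norm x0 + M / (2 * L)) * exp (2 * L * s)"
        using L M exp_ge_add_one_self[of "2 * L * s"] by (intro mult_left_mono) auto
      finally have "exp (- 2 * L * s) * norm (I u s)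
          \<le> exp (- 2 * L * s) * ((norm x0 + M / (2 * L)) * exp (2 * L * s))"
        by (intro mult_left_mono) auto
      also have "\<dots> = norm x0 + M / (2 * L)"
        by (simp add: mult.left_commute flip: exp_add)
      finally show ?thesis by (simp add: \<Psi>_def s_def)
    qed
    ultimately show ?thesis by (auto simp: bcontfun_def bounded_iff)
  qed
  then have apply_\<Psi>: "apply_bcontfun (Bcontfun (\<Psi> u)) = \<Psi> u" for u
    by (simp add: Bcontfun_inverse)
  have contraction: "dist (Bcontfun (\<Psi> u)) (Bcontfun (\<Psi> v)) \<le> 1/2 * dist u v" for u v
  proof (rule dist_bound)
    fix t :: real
    define s where "s = max 0 t"
    have s: "s \<ge> 0" by (simp add: s_def)
    define \<phi> where "\<phi> r = dist u v / 2 * exp (2 * L * r)" for r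
    have "norm ((I u s - I v s) - (I u 0 - I v 0)) \<le> \<phi> s - \<phi> 0"
    proof (cases "s = 0")
      case False
      show ?thesis
      proof (rule differentiable_bound_general[of 0 s "\<lambda>r. I u r - I v r"])
        show "0 < s" using s False by auto
        show "continuous_on {0..s} (\<lambda>r. I u r - I v r)"
          by (intro continuous_intros continuous_on_subset[OF contI]) auto
        show "continuous_on {0..s} \<phi>" unfolding \<phi>_def by (intro continuous_intros)
        fix r assume r: "0 < r" "r < s"
        then have "r \<in> interior {0..}" by (simp add: interior_Ici[of "-1"])
        then have "at r within {0..} = at r" by (rule at_within_interior)
        then have "(I w has_vector_derivative h w r) (at r)" for w
          using I_deriv'[of r w] r by simp
        then show "((\<lambda>r. I u r - I v r) has_vector_derivative h u r - h v r) (at r)"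
          by (intro has_vector_derivative_diff)
        show "(\<phi> has_vector_derivative dist u v * L * exp (2 * L * r)) (at r)"
          unfolding \<phi>_def has_real_derivative_iff_has_vector_derivative[symmetric]
          by (auto intro!: derivative_eq_intros)
        have "norm (h u r - h v r) \<le> L * norm (exp (2 * L * r) *\<^sub>R (apply_bcontfun u r - apply_bcontfun v r))"
          using lipschitz_onD[OF lip, of "exp (2 * L * r) *\<^sub>R apply_bcontfun u r" "exp (2 * L * r) *\<^sub>R apply_bcontfun v r"]
          by (simp add: h_def dist_norm scaleR_diff_right)
        also have "\<dots> = L * (exp (2 * L * r) * dist (apply_bcontfun u r) (apply_bcontfun v r))"
          by (simp add: dist_norm)
        also have "\<dots> \<le> L * (exp (2 * L * r) * dist u v)"
          using L by (intro mult_left_mono dist_bounded) auto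
        finally show "norm (h u r - h v r) \<le> dist u v * L * exp (2 * L * r)"
          by (simp add: mult_ac)
      qed
    qed (auto simp: \<phi>_def)
    also have "\<phi> s - \<phi> 0 \<le> dist u v / 2 * exp (2 * L * s)"
      by (simp add: \<phi>_def)
    finally have "norm (I u s - I v s) \<le> dist u v / 2 * exp (2 * L * s)"
      by (simp add: I_def)
    then have "exp (- 2 * L * s) * norm (I u s - I v s)
        \<le> exp (- 2 * L * s) * (dist u v / 2 * exp (2 * L * s))"
      by (intro mult_left_mono) auto
    also have "\<dots> = 1/2 * dist u v"
      by (simp add: mult.left_commute flip: exp_add)
    finally show "dist (apply_bcontfun (Bcontfun (\<Psi> u)) t) (apply_bcontfun (Bcontfun (\<Psi> v)) t)
        \<le> 1/2 * dist u v"
      by (simp add: apply_\<Psi> \<Psi>_def s_def dist_norm flip: scaleR_diff_right)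
  qed
  have "\<exists>!u. Bcontfun (\<Psi> u) = u"
    by (rule banach_fix_type[of "1/2"]) (auto intro: contraction[simplified])
  then obtain u where u: "Bcontfun (\<Psi> u) = u" by auto
  have fixed: "I u t = exp (2 * L * t) *\<^sub>R apply_bcontfun u t" if "t \<ge> 0" for t
  proof -
    have "apply_bcontfun u t = \<Psi> u t" using apply_\<Psi>[of u] u by simp
    then show ?thesis using that by (simp add: \<Psi>_def flip: exp_add)
  qed
  have "I u 0 = x0" by (simp add: I_def)
  moreover have "(I u has_vector_derivative F (I u t)) (at t within {0..})" if "t \<ge> 0" for t
    using I_deriv'[OF that, of u] fixed[OF that] by (simp add: h_def)
  ultimately show ?thesis by blast
qed

text \<open>In finite or infinite dimension, polynomial vector fields have this property; that, and not
  local Lipschitz continuity, is what the truncation below needs.\<close>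
definition lipschitz_on_balls :: "('b::real_normed_vector \<Rightarrow> 'c::real_normed_vector) \<Rightarrow> bool" where
  "lipschitz_on_balls F \<longleftrightarrow> (\<forall>r. \<exists>L. L-lipschitz_on (cball 0 r) F)"

text \<open>The truncation is \<open>F\<close> after the radial retraction onto the ball of radius \<open>r\<close>, which is
  2-Lipschitz in every normed space.\<close>
lemma truncated_field:
  fixes F :: "'b::real_normed_vector \<Rightarrow> 'b"
  assumes lip: "lipschitz_on_balls F" and r: "r > 0"
  obtains G L M where "L-lipschitz_on UNIV G" "\<And>x. norm (G x) \<le> M"
    "\<And>x. norm x \<le> r \<Longrightarrow> G x = F x"
proof -
  define s where "s x = r / max r (norm x)" for x :: 'b
  define P where "P x = s x *\<^sub>R x" for x
  have s: "0 \<le> s x" "s x \<le> 1" "s x * norm x \<le> r" for x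
    using r by (auto simp: s_def divide_simps max_def)
  have P_r: "norm (P x) \<le> r" for x using s[of x] by (simp add: P_def)
  have P_id: "P x = x" if "norm x \<le> r" for x using that r by (simp add: P_def s_def max_def)
  have P_lip: "norm (P x - P y) \<le> 2 * norm (x - y)" for x y
  proof -
    have "\<bar>s x - s y\<bar> * norm y = s x * (norm y / max r (norm y)) * \<bar>max r (norm y) - max r (norm x)\<bar>"
      using r by (simp add: s_def divide_simps abs_mult max_def)
        (auto simp: abs_if algebra_simps)
    also have "\<dots> \<le> 1 * 1 * norm (x - y)"
    proof (intro mult_mono)
      have "\<bar>max r (norm y) - max r (norm x)\<bar> \<le> \<bar>norm y - norm x\<bar>" by (auto simp: max_def)
      then show "\<bar>max r (norm y) - max r (norm x)\<bar> \<le> norm (x - y)"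
        using norm_triangle_ineq3[of y x] by (simp add: norm_minus_commute)
    qed (use s r in \<open>auto simp: divide_simps\<close>)
    finally have 1: "norm ((s x - s y) *\<^sub>R y) \<le> norm (x - y)" by simp
    have 2: "norm (s x *\<^sub>R (x - y)) \<le> norm (x - y)"
      using s[of x] by (simp add: mult_left_le_one_le)
    have "P x - P y = s x *\<^sub>R (x - y) + (s x - s y) *\<^sub>R y" by (simp add: P_def algebra_simps)
    then show ?thesis using norm_triangle_ineq[of "s x *\<^sub>R (x - y)" "(s x - s y) *\<^sub>R y"] 1 2 by simp
  qed
  obtain L where L: "L-lipschitz_on (cball 0 r) F" using lip by (auto simp: lipschitz_on_balls_def)
  have L0: "L \<ge> 0" using L by (rule lipschitz_on_nonneg)
  show ?thesis
  proof
    show "(L * 2)-lipschitz_on UNIV (F \<circ> P)"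
    proof (rule lipschitz_onI)
      fix x y
      have "dist (F (P x)) (F (P y)) \<le> L * dist (P x) (P y)"
        using lipschitz_onD[OF L, of "P x" "P y"] P_r by simp
      also have "\<dots> \<le> L * (2 * dist x y)"
        using L0 P_lip[of x y] by (intro mult_left_mono) (auto simp: dist_norm)
      finally show "dist ((F \<circ> P) x) ((F \<circ> P) y) \<le> L * 2 * dist x y" by simp
    qed (use L0 in simp)
    show "norm ((F \<circ> P) x) \<le> norm (F 0) + L * r" for x
    proof -
      have "norm (F (P x) - F 0) \<le> L * norm (P x)"
        using lipschitz_onD[OF L, of "P x" 0] P_r[of x] r by (simp add: dist_norm)
      also have "\<dots> \<le> L * r" using L0 P_r by (intro mult_left_mono) auto
      finally show ?thesis using norm_triangle_ineq2[of "F (P x)" "F 0"] by simp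
    qed
    show "(F \<circ> P) x = F x" if "norm x \<le> r" for x using P_id[OF that] by simp
  qed
qed

text \<open>Up to time \<open>n\<close> one solves a truncated equation whose radius exceeds the a priori bound. Until
  its first exit from the ball the solution solves the original equation, hence obeys the bound, hence
  does not exit. The solutions for different \<open>n\<close> agree by uniqueness.\<close>
theorem ode_global_existence:
  fixes F :: "'b::banach \<Rightarrow> 'b"
  assumes lip: "lipschitz_on_balls F"
    and apriori: "\<And>T. T \<ge> 0 \<Longrightarrow> \<exists>R. \<forall>S x. 0 \<le> S \<and> S \<le> T \<and> x 0 = x0 \<and>
        (\<forall>t\<in>{0..S}. (x has_vector_derivative F (x t)) (at t within {0..S})) \<longrightarrow>
        (\<forall>t\<in>{0..S}. norm (x t) \<le> R)"
  shows "\<exists>x. x 0 = x0 \<and> (\<forall>t\<ge>0. (x has_vector_derivative F (x t)) (at t within {0..}))"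
proof -
  define sol where "sol S x \<longleftrightarrow> x 0 = x0 \<and>
    (\<forall>t\<in>{0..S}. (x has_vector_derivative F (x t)) (at t within {0..S}))" for S x
  have apriori': "\<exists>R. \<forall>S x. 0 \<le> S \<and> S \<le> T \<and> sol S x \<longrightarrow> (\<forall>t\<in>{0..S}. norm (x t) \<le> R)"
    if "T \<ge> 0" for T
    unfolding sol_def using apriori[OF that] by simp
  have sol_mono: "sol S' x" if "sol S x" "S' \<le> S" for S S' x
    unfolding sol_def
  proof (intro conjI ballI)
    fix t assume "t \<in> {0..S'}"
    then have "(x has_vector_derivative F (x t)) (at t within {0..S})"
      using that by (simp add: sol_def)
    then show "(x has_vector_derivative F (x t)) (at t within {0..S'})"
      by (rule has_vector_derivative_within_subset) (use that in auto)
  qed (use that in \<open>simp add: sol_def\<close>)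
  have unique: "x t = y t" if x: "sol S x" and y: "sol S y" and t: "t \<in> {0..S}" for S x y t
  proof -
    obtain R where R: "\<And>z s. sol S z \<Longrightarrow> s \<in> {0..S} \<Longrightarrow> norm (z s) \<le> R"
      using apriori'[of S] t by (meson atLeastAtMost_iff order.refl order.trans)
    obtain L where L: "L-lipschitz_on (cball 0 R) F" using lip by (auto simp: lipschitz_on_balls_def)
    have "norm (x t - y t) \<le> 2 * norm (x 0 - y 0) * exp (2 * L * t)"
    proof (rule gronwall_norm[where f = "\<lambda>s. x s - y s" and f' = "\<lambda>s. F (x s) - F (y s)"])
      fix s assume s: "s \<in> {0..S}"
      show "((\<lambda>s. x s - y s) has_vector_derivative F (x s) - F (y s)) (at s within {0..S})"
        using x y s by (auto simp: sol_def intro!: has_vector_derivative_diff)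
      show "norm (F (x s) - F (y s)) \<le> L * norm (x s - y s)"
        using lipschitz_onD[OF L, of "x s" "y s"] R[OF x s] R[OF y s] by (simp add: dist_norm)
    qed (use t lipschitz_on_nonneg[OF L] in auto)
    then show ?thesis using x y by (simp add: sol_def)
  qed
  have "\<exists>x. sol (real n) x" for n
  proof -
    obtain R0 where "\<forall>S x. 0 \<le> S \<and> S \<le> real n \<and> sol S x \<longrightarrow> (\<forall>t\<in>{0..S}. norm (x t) \<le> R0)"
      using apriori'[of "real n"] by auto
    then have R0: "norm (x t) \<le> R0" if "0 \<le> S" "S \<le> real n" "sol S x" "t \<in> {0..S}" for S x t
      using that by blast
    define R where "R = max R0 0 + 1"
    have R: "R > 0" "R0 < R" by (auto simp: R_def)
    obtain G L M where G: "L-lipschitz_on UNIV G" "\<And>x. norm (G x) \<le> M"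
        and GF: "\<And>x. norm x \<le> R \<Longrightarrow> G x = F x"
      by (rule truncated_field[OF lip R(1)]) (rule that; assumption)
    obtain x where x0: "x 0 = x0"
        and x: "\<And>t. t \<ge> 0 \<Longrightarrow> (x has_vector_derivative G (x t)) (at t within {0..})"
      using bounded_lipschitz_ode[OF G, of x0] by metis
    have contx: "continuous_on {0..real n} (\<lambda>t. norm (x t))"
    proof -
      have "continuous_on {0..} x"
        by (rule continuous_on_of_vector_derivative[where f' = "\<lambda>t. G (x t)"]) (simp add: x)
      then show ?thesis
        by (intro continuous_on_norm) (auto elim: continuous_on_subset)
    qed
    have solx: "sol S x" if "\<And>t. t \<in> {0..S} \<Longrightarrow> norm (x t) \<le> R" for S
      unfolding sol_def
    proof (intro conjI ballI)
      fix t assume t: "t \<in> {0..S}"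
      then have "(x has_vector_derivative F (x t)) (at t within {0..})"
        using x[of t] GF[OF that[OF t]] by simp
      then show "(x has_vector_derivative F (x t)) (at t within {0..S})"
        by (rule has_vector_derivative_within_subset) auto
    qed (rule x0)
    have x0R: "norm (x 0) \<le> R0"
    proof -
      have "at 0 within {0::real} = bot" by (simp add: at_within_eq_bot_iff)
      then have "sol 0 x"
        using x0 by (simp add: sol_def has_vector_derivative_def has_derivative_def
            bounded_linear_scaleR_left)
      then show ?thesis using R0[of 0 x 0] by simp
    qed
    \<comment> \<open>The infimum \<open>p\<close> of the bad times is the first time at which the norm reaches \<open>R\<close>.\<close>
    have small: "norm (x t) \<le> R" if t: "t \<in> {0..real n}" for t
    proof (rule ccontr)
      assume "\<not> norm (x t) \<le> R"
      define Bad where "Bad = {s \<in> {0..real n}. norm (x s) \<ge> R}"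
      have "t \<in> Bad" using t \<open>\<not> norm (x t) \<le> R\<close> by (auto simp: Bad_def)
      have "closed ({0..real n} \<inter> (\<lambda>t. norm (x t)) -` {R..})"
        by (rule continuous_closed_preimage[OF contx]) auto
      moreover have "Bad = {0..real n} \<inter> (\<lambda>t. norm (x t)) -` {R..}" by (auto simp: Bad_def)
      ultimately have cl: "closed Bad" by simp
      define p where "p = Inf Bad"
      have bb: "bdd_below Bad" by (rule bdd_belowI[of _ 0]) (auto simp: Bad_def)
      have p: "p \<in> Bad" unfolding p_def
        using closed_contains_Inf[OF _ bb cl] \<open>t \<in> Bad\<close> by auto
      have le: "norm (x s) \<le> R" if "s \<in> {0..p}" for s
      proof (cases "s = p")
        case False
        then have "s \<notin> Bad" using that cInf_lower[OF _ bb, of s] by (auto simp: p_def)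
        then show ?thesis using that p by (auto simp: Bad_def)
      next
        case True
        show ?thesis
        proof (rule ccontr)
          assume "\<not> norm (x s) \<le> R"
          then have big: "norm (x p) > R" using True by simp
          have "norm (x 0) \<le> R" using x0R R by simp
          moreover have "continuous_on {0..p} (\<lambda>t. norm (x t))"
            using contx p by (auto simp: Bad_def elim: continuous_on_subset)
          ultimately obtain q where q: "0 \<le> q" "q \<le> p" "norm (x q) = R"
            using IVT'[of "\<lambda>t. norm (x t)" 0 R p] big p by (auto simp: Bad_def)
          then have "q \<in> Bad" using p by (auto simp: Bad_def)
          then have "p \<le> q" using cInf_lower[OF _ bb, of q] by (simp add: p_def)
          then show False using q big by auto
        qed
      qed
      have "norm (x p) \<le> R0"
        using R0[of p x p] solx[OF le] p by (auto simp: Bad_def)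
      then show False using p R by (auto simp: Bad_def)
    qed
    have "sol (real n) x" by (rule solx) (rule small)
    then show ?thesis by blast
  qed
  then obtain y where y: "\<And>n. sol (real n) (y n)" by metis
  have agree: "y m t = y n t" if "t \<ge> 0" "t \<le> real m" "m \<le> n" for m n t
    using unique[OF y[of m] sol_mono[OF y[of n]], of t] that by auto
  \<comment> \<open>Around \<open>t\<close> the glued function is \<open>y n\<close> for every sufficiently large \<open>n\<close>; the successor below
    makes \<open>t\<close> an interior point of the interval.\<close>
  define x where "x t = y (nat \<lceil>t\<rceil>) t" for t
  have "x 0 = x0" using y[of 0] by (simp add: x_def sol_def)
  moreover have "(x has_vector_derivative F (x t)) (at t within {0..})" if t: "t \<ge> 0" for t
  proof -
    define n where "n = nat \<lceil>t\<rceil> + 1"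
    have tn: "t < real n" unfolding n_def by linarith
    have xy: "x s = y n s" if "s \<in> {0..real n}" for s
      unfolding x_def
    proof (rule agree)
      show "s \<le> real (nat \<lceil>s\<rceil>)" by linarith
      show "nat \<lceil>s\<rceil> \<le> n" using that by (simp add: nat_le_iff ceiling_le_iff)
    qed (use that in auto)
    have "at t within {0..} = at t within {0..real n}"
      by (rule at_within_nhd[of _ "{..<real n}"]) (use tn in auto)
    moreover have "(y n has_vector_derivative F (y n t)) (at t within {0..real n})"
      using y[of n] t tn by (simp add: sol_def)
    then have "(x has_vector_derivative F (y n t)) (at t within {0..real n})"
      by (rule has_vector_derivative_transform[rotated 2]) (use t tn xy in auto)
    ultimately show ?thesis using xy[of t] t tn by simp
  qed
  ultimately show ?thesis by blast
qed

lemma lipschitz_on_balls_bounded: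
  fixes f :: "'b::real_normed_vector \<Rightarrow> 'c::real_normed_vector"
  assumes "lipschitz_on_balls f"
  obtains C where "C \<ge> 0" "\<And>x. norm x \<le> r \<Longrightarrow> norm (f x) \<le> C"
proof -
  obtain L where L: "L-lipschitz_on (cball 0 (max r 0)) f"
    using assms by (auto simp: lipschitz_on_balls_def)
  have L0: "L \<ge> 0" using L by (rule lipschitz_on_nonneg)
  show ?thesis
  proof
    show "0 \<le> norm (f 0) + L * max r 0" using L0 by simp
    fix x :: 'b assume x: "norm x \<le> r"
    have "norm (f x - f 0) \<le> L * norm x"
      using lipschitz_onD[OF L, of x 0] x by (simp add: dist_norm)
    also have "\<dots> \<le> L * max r 0" using L0 x by (intro mult_left_mono) auto
    finally show "norm (f x) \<le> norm (f 0) + L * max r 0"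
      using norm_triangle_ineq2[of "f x" "f 0"] by simp
  qed
qed

lemma lipschitz_on_balls_const [intro]: "lipschitz_on_balls (\<lambda>x. c)"
  unfolding lipschitz_on_balls_def by (auto intro: lipschitz_intros)

lemma lipschitz_on_balls_linear [intro]:
  assumes "bounded_linear f" shows "lipschitz_on_balls f"
  unfolding lipschitz_on_balls_def
  using bounded_linear.lipschitz_boundE[OF assms] by metis

lemma lipschitz_on_balls_add [intro]:
  assumes "lipschitz_on_balls f" "lipschitz_on_balls h"
  shows "lipschitz_on_balls (\<lambda>x. f x + h x)"
  unfolding lipschitz_on_balls_def
proof
  fix r
  obtain L L' where "L-lipschitz_on (cball 0 r) f" "L'-lipschitz_on (cball 0 r) h"
    using assms unfolding lipschitz_on_balls_def by metis
  then show "\<exists>L. L-lipschitz_on (cball 0 r) (\<lambda>x. f x + h x)"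
    using lipschitz_on_add by blast
qed

lemma lipschitz_on_balls_sum [intro]:
  assumes "\<And>i. i \<in> A \<Longrightarrow> lipschitz_on_balls (f i)"
  shows "lipschitz_on_balls (\<lambda>x. \<Sum>i\<in>A. f i x)"
  using assms by (induction A rule: infinite_finite_induct) auto

lemma lipschitz_on_balls_bilinear:
  fixes f :: "'x::real_normed_vector \<Rightarrow> 'b::real_normed_vector"
    and h :: "'x \<Rightarrow> 'c::real_normed_vector" and B :: "'b \<Rightarrow> 'c \<Rightarrow> 'd::real_normed_vector"
  assumes B: "bounded_bilinear B" and f: "lipschitz_on_balls f" and h: "lipschitz_on_balls h"
  shows "lipschitz_on_balls (\<lambda>x. B (f x) (h x))"
  unfolding lipschitz_on_balls_def
proof
  fix r
  interpret bounded_bilinear B by fact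
  obtain K where K: "K > 0" "\<And>a b. norm (B a b) \<le> norm a * norm b * K"
    using pos_bounded by blast
  obtain Lf Lh where L: "Lf-lipschitz_on (cball 0 r) f" "Lh-lipschitz_on (cball 0 r) h"
    using f h unfolding lipschitz_on_balls_def by metis
  obtain Cf where Cf: "Cf \<ge> 0" "\<And>x. norm x \<le> r \<Longrightarrow> norm (f x) \<le> Cf"
    using lipschitz_on_balls_bounded[OF f] by blast
  obtain Ch where Ch: "Ch \<ge> 0" "\<And>x. norm x \<le> r \<Longrightarrow> norm (h x) \<le> Ch"
    using lipschitz_on_balls_bounded[OF h] by blast
  note L0 = L[THEN lipschitz_on_nonneg]
  have "((Lf * Ch + Cf * Lh) * K)-lipschitz_on (cball 0 r) (\<lambda>x. B (f x) (h x))"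
  proof (rule lipschitz_onI)
    fix x y :: 'x assume xy: "x \<in> cball 0 r" "y \<in> cball 0 r"
    have fd: "norm (f x - f y) \<le> Lf * dist x y" and hd: "norm (h x - h y) \<le> Lh * dist x y"
      using L[THEN lipschitz_onD, OF xy] by (auto simp: dist_norm)
    have "B (f x) (h x) - B (f y) (h y) = B (f x - f y) (h x) + B (f y) (h x - h y)"
      by (simp add: diff_left diff_right)
    also have "norm \<dots> \<le> norm (f x - f y) * norm (h x) * K + norm (f y) * norm (h x - h y) * K"
      by (intro order_trans[OF norm_triangle_ineq] add_mono K(2))
    also have "\<dots> \<le> (Lf * dist x y) * Ch * K + Cf * (Lh * dist x y) * K"
    proof -
      have "norm (f x - f y) * norm (h x) \<le> (Lf * dist x y) * Ch"
        using fd Ch(2)[of x] xy L0 by (intro mult_mono) auto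
      moreover have "norm (f y) * norm (h x - h y) \<le> Cf * (Lh * dist x y)"
        using hd Cf(2)[of y] Cf(1) xy by (intro mult_mono) auto
      ultimately show ?thesis
        using K(1) by (intro add_mono mult_right_mono) auto
    qed
    finally show "dist (B (f x) (h x)) (B (f y) (h y)) \<le> (Lf * Ch + Cf * Lh) * K * dist x y"
      by (simp add: dist_norm algebra_simps)
  qed (use L0 K Cf Ch in simp)
  then show "\<exists>L. L-lipschitz_on (cball 0 r) (\<lambda>x. B (f x) (h x))" by blast
qed

lemma lipschitz_on_balls_linear_comp:
  assumes "bounded_linear T" "lipschitz_on_balls f"
  shows "lipschitz_on_balls (\<lambda>x. T (f x))"
  using lipschitz_on_balls_bilinear[OF
      bounded_bilinear.comp1[OF bounded_bilinear_scaleR[THEN bounded_bilinear.flip] assms(1)]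
      assms(2) lipschitz_on_balls_const[of 1]]
  by simp

lemma lipschitz_on_balls_Pair:
  assumes "lipschitz_on_balls f" "lipschitz_on_balls h"
  shows "lipschitz_on_balls (\<lambda>x. (f x, h x))"
proof -
  have "lipschitz_on_balls (\<lambda>x. (f x, 0) + (0, h x))"
    using assms
    by (intro lipschitz_on_balls_add lipschitz_on_balls_linear_comp[of "\<lambda>y. (y, 0)"]
        lipschitz_on_balls_linear_comp[of "\<lambda>y. (0, y)"])
      (auto intro!: bounded_linear_intros)
  then show ?thesis by simp
qed

section \<open>Orthonormal frames of a left-invariant metric\<close>

lemma bilinear_simps:
  assumes "bilinear B"
  shows "B (x + y) z = B x z + B y z" "B z (x + y) = B z x + B z y"
    "B (c *\<^sub>R x) z = c *\<^sub>R B x z" "B z (c *\<^sub>R x) = c *\<^sub>R B z x"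
    "B (- x) z = - B x z" "B z (- x) = - B z x"
    "B (x - y) z = B x z - B y z" "B z (x - y) = B z x - B z y"
    "B 0 z = 0" "B z 0 = 0"
    "B (sum f A) z = (\<Sum>i\<in>A. B (f i) z)" "B z (sum f A) = (\<Sum>i\<in>A. B z (f i))"
proof -
  have lin: "linear (\<lambda>x. B x z)" "linear (B z)" for z
    using assms by (auto simp: bilinear_def)
  show "B (sum f A) z = (\<Sum>i\<in>A. B (f i) z)" "B z (sum f A) = (\<Sum>i\<in>A. B z (f i))"
    using linear_sum[OF lin(1)] linear_sum[OF lin(2)] by auto
qed (use assms in \<open>auto simp: bilinear_ladd bilinear_radd bilinear_lmul bilinear_rmul
      bilinear_lneg bilinear_rneg bilinear_lsub bilinear_rsub bilinear_lzero bilinear_rzero\<close>)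

lemma linear_map_simps:
  assumes "linear J"
  shows "J (x + y) = J x + J y" "J (c *\<^sub>R x) = c *\<^sub>R J x" "J (- x) = - J x"
    "J (x - y) = J x - J y" "J 0 = 0" "J (sum f A) = (\<Sum>i\<in>A. J (f i))"
  using assms by (auto simp: linear_add linear_scale linear_neg linear_diff linear_0 linear_sum)

lemma bilinear_of_linear:
  assumes "\<And>y. linear (\<lambda>x. B x y)" "\<And>x. linear (B x)" shows "bilinear B"
  using assms by (auto simp: bilinear_def)

text \<open>The coordinate basis merely serves as an index set of the right cardinality for the frame.\<close>
locale orthonormal_frame =
  fixes g :: "'a::euclidean_space \<Rightarrow> 'a \<Rightarrow> real" and e :: "'a \<Rightarrow> 'a"
  assumes bilinear_g: "bilinear g" and g_sym: "g x y = g y x"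
    and orthonormal: "b \<in> Basis \<Longrightarrow> c \<in> Basis \<Longrightarrow> g (e b) (e c) = (if b = c then 1 else 0)"
begin

lemmas g_simps = bilinear_simps[OF bilinear_g, unfolded real_scaleR_def]

text \<open>The linear map that sends the coordinate basis to the frame is injective because the frame
  is orthonormal, and hence surjective.\<close>
lemma frame_expansion: "(\<Sum>b\<in>Basis. g v (e b) *\<^sub>R e b) = v"
proof -
  define T where "T x = (\<Sum>b\<in>Basis. (x \<bullet> b) *\<^sub>R e b)" for x
  have linT: "linear T"
    by (auto intro!: linearI simp: T_def inner_add_left algebra_simps sum.distrib scaleR_sum_right)
  have coord: "g (T x) (e c) = x \<bullet> c" if "c \<in> Basis" for x c
    using that by (simp add: T_def g_simps orthonormal if_distrib cong: if_cong)
  have "inj T"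
  proof (rule injI)
    fix x y assume "T x = T y"
    then show "x = y" using coord by (metis euclidean_eqI)
  qed
  then have "surj T" using linear_injective_imp_surjective[OF linT] by blast
  then obtain x where "v = T x" by auto
  moreover have "(\<Sum>b\<in>Basis. g (T x) (e b) *\<^sub>R e b) = T x"
    unfolding T_def[of x, symmetric] by (subst T_def[of x]) (simp add: coord)
  ultimately show ?thesis by simp
qed

lemma contract_linear:
  assumes "linear L"
  shows "(\<Sum>b\<in>Basis. g v (e b) *\<^sub>R L (e b)) = L v" "(\<Sum>b\<in>Basis. g (e b) v *\<^sub>R L (e b)) = L v"
proof -
  have "L v = L (\<Sum>b\<in>Basis. g v (e b) *\<^sub>R e b)" by (simp add: frame_expansion)
  also have "\<dots> = (\<Sum>b\<in>Basis. g v (e b) *\<^sub>R L (e b))"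
    using assms by (simp add: linear_sum linear_scale)
  finally show "(\<Sum>b\<in>Basis. g v (e b) *\<^sub>R L (e b)) = L v" by simp
  then show "(\<Sum>b\<in>Basis. g (e b) v *\<^sub>R L (e b)) = L v" by (simp add: g_sym)
qed

lemma contract_real:
  fixes L :: "'a \<Rightarrow> real"
  assumes "linear L"
  shows "(\<Sum>b\<in>Basis. g v (e b) * L (e b)) = L v" "(\<Sum>b\<in>Basis. g (e b) v * L (e b)) = L v"
  using contract_linear[OF assms, of v] by simp_all

lemma linear_g: "linear (\<lambda>x. g x y)" "linear (g x)"
  using bilinear_g by (auto simp: bilinear_def)

lemma parseval: "(\<Sum>b\<in>Basis. g u (e b) * g v (e b)) = g u v"
  using contract_real(1)[OF linear_g(2), of u v] by (simp add: g_sym)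

lemma g_eqI_frame:
  assumes "\<And>b. b \<in> Basis \<Longrightarrow> g x (e b) = g y (e b)" shows "x = y"
proof -
  have "(\<Sum>b\<in>Basis. g x (e b) *\<^sub>R e b) = (\<Sum>b\<in>Basis. g y (e b) *\<^sub>R e b)"
    by (intro sum.cong refl) (simp add: assms)
  then show ?thesis by (simp add: frame_expansion)
qed

lemma g_eqI: "(\<And>z. g x z = g y z) \<Longrightarrow> x = y"
  by (rule g_eqI_frame)

lemma g_nonneg: "g x x \<ge> 0"
  using parseval[of x x] by (metis sum_nonneg zero_le_square)

lemma g_pos: "x \<noteq> 0 \<Longrightarrow> g x x > 0"
proof (rule ccontr)
  assume x: "x \<noteq> 0" and "\<not> g x x > 0"
  then have "(\<Sum>b\<in>Basis. g x (e b) * g x (e b)) = 0"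
    using g_nonneg[of x] parseval[of x x] by simp
  then have "g x (e b) = 0" if "b \<in> Basis" for b
    using that by (subst (asm) sum_nonneg_eq_0_iff) auto
  then have "x = 0" by (intro g_eqI_frame) (simp add: g_simps)
  then show False using x by simp
qed

text \<open>The inner sum is the metric dual of the coordinate along \<open>b\<close> (\<open>sharp_frame\<close>): contracting with
  the inverse metric in coordinates is summing over an orthonormal frame.\<close>
lemma frame_sum_bilinear:
  assumes f: "bilinear f" shows "(\<Sum>b\<in>Basis. f b (\<Sum>c\<in>Basis. (e c \<bullet> b) *\<^sub>R e c)) = (\<Sum>c\<in>Basis. f (e c) (e c))"
proof -
  have "(\<Sum>b\<in>Basis. f b (\<Sum>c\<in>Basis. (e c \<bullet> b) *\<^sub>R e c))
      = (\<Sum>b\<in>Basis. \<Sum>c\<in>Basis. (e c \<bullet> b) *\<^sub>R f b (e c))"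
    by (simp add: bilinear_simps[OF f])
  also have "\<dots> = (\<Sum>c\<in>Basis. f (\<Sum>b\<in>Basis. (e c \<bullet> b) *\<^sub>R b) (e c))"
    by (subst sum.swap) (simp add: bilinear_simps[OF f])
  finally show ?thesis by (simp add: euclidean_representation)
qed

lemma endo_trace_frame:
  assumes "linear f" shows "endo_trace f = (\<Sum>c\<in>Basis. g (f (e c)) (e c))"
proof -
  have "bilinear (\<lambda>x y. g (f x) y)"
    using assms by (intro bilinear_of_linear linearI) (auto simp: g_simps linear_map_simps)
  from frame_sum_bilinear[OF this]
  have "(\<Sum>c\<in>Basis. g (f (e c)) (e c))
      = (\<Sum>b\<in>Basis. g (f b) (\<Sum>c\<in>Basis. (e c \<bullet> b) *\<^sub>R e c))" by simp
  also have "\<dots> = (\<Sum>b\<in>Basis. (\<Sum>c\<in>Basis. g (f b) (e c) *\<^sub>R e c) \<bullet> b)"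
    by (simp add: g_simps inner_sum_left mult.commute)
  finally show ?thesis by (simp add: endo_trace_def frame_expansion)
qed

lemma sharp_frame: "b \<in> Basis \<Longrightarrow> sharp g b = (\<Sum>c\<in>Basis. (e c \<bullet> b) *\<^sub>R e c)"
  unfolding sharp_def
proof (rule the_equality)
  have ex: "g (\<Sum>c\<in>Basis. (e c \<bullet> b) *\<^sub>R e c) x = x \<bullet> b" for x
  proof -
    have "g (\<Sum>c\<in>Basis. (e c \<bullet> b) *\<^sub>R e c) x = (\<Sum>c\<in>Basis. g (e c) x *\<^sub>R e c) \<bullet> b"
      by (simp add: g_simps inner_sum_left mult.commute)
    also have "(\<Sum>c\<in>Basis. g (e c) x *\<^sub>R e c) = x" using contract_linear(2)[of "\<lambda>x. x" x]
      by (simp add: linear_id[unfolded id_def])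
    finally show ?thesis .
  qed
  then show "\<forall>x. g (\<Sum>c\<in>Basis. (e c \<bullet> b) *\<^sub>R e c) x = x \<bullet> b" by simp
  show "v = (\<Sum>c\<in>Basis. (e c \<bullet> b) *\<^sub>R e c)" if "\<forall>x. g v x = x \<bullet> b" for v
    by (rule g_eqI) (simp add: that ex)
qed

end

text \<open>Gram--Schmidt, along the coordinate basis.\<close>
lemma orthonormal_frame_exists:
  fixes g :: "'a::euclidean_space \<Rightarrow> 'a \<Rightarrow> real"
  assumes bil: "bilinear g" and sym: "\<And>x y. g x y = g y x" and pos: "\<And>x. x \<noteq> 0 \<Longrightarrow> g x x > 0"
  shows "\<exists>e. orthonormal_frame g e"
proof -
  note gs = bilinear_simps[OF bil, unfolded real_scaleR_def]
  have "\<exists>e. e ` S \<subseteq> span S \<and> (\<forall>b\<in>S. \<forall>c\<in>S. g (e b) (e c) = (if b = c then 1 else 0))"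
    if "finite S" "S \<subseteq> Basis" for S :: "'a set"
    using that
  proof (induction S rule: finite_induct)
    case (insert b S)
    then obtain e where span: "e ` S \<subseteq> span S"
        and orth: "\<And>b c. b \<in> S \<Longrightarrow> c \<in> S \<Longrightarrow> g (e b) (e c) = (if b = c then 1 else 0)" by auto
    define v where "v = b - (\<Sum>c\<in>S. g b (e c) *\<^sub>R e c)"
    have "b \<notin> span S"
    proof -
      have "independent (insert b S)"
        using independent_mono[OF independent_Basis] insert by blast
      then show ?thesis using insert by (simp add: independent_insert)
    qed
    moreover have "(\<Sum>c\<in>S. g b (e c) *\<^sub>R e c) \<in> span S"
      using span by (intro span_sum span_mul) auto
    ultimately have "v \<noteq> 0" by (auto simp: v_def)
    then have vv: "g v v > 0" by (rule pos)
    have ve: "g v (e c) = 0" if "c \<in> S" for c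
      using that insert by (simp add: v_def gs orth if_distrib cong: if_cong)
    then have ve': "g (e c) v = 0" if "c \<in> S" for c
      using that sym by metis
    define e' where "e' = e(b := v /\<^sub>R sqrt (g v v))"
    have "g (v /\<^sub>R sqrt (g v v)) (v /\<^sub>R sqrt (g v v)) = 1"
      using vv by (simp add: gs field_simps)
    then have "\<forall>c\<in>insert b S. \<forall>d\<in>insert b S. g (e' c) (e' d) = (if c = d then 1 else 0)"
      using insert orth ve ve' by (auto simp: e'_def gs)
    moreover have "e' ` insert b S \<subseteq> span (insert b S)"
    proof -
      have "span S \<subseteq> span (insert b S)" by (intro span_mono) auto
      then have "v \<in> span (insert b S)"
        using \<open>(\<Sum>c\<in>S. g b (e c) *\<^sub>R e c) \<in> span S\<close> unfolding v_def
        by (intro span_diff) (auto intro: span_base)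
      then show ?thesis
        using span \<open>span S \<subseteq> _\<close> by (auto simp: e'_def intro: span_mul)
    qed
    ultimately show ?case by blast
  qed auto
  from this[OF finite_Basis subset_refl] obtain e :: "'a \<Rightarrow> 'a"
    where "\<forall>b\<in>Basis. \<forall>c\<in>Basis. g (e b) (e c) = (if b = c then 1 else 0)" by blast
  then have "orthonormal_frame g e" using bil sym by (auto simp: orthonormal_frame_def)
  then show ?thesis by blast
qed

section \<open>Ricci curvature of a unimodular metric Lie algebra\<close>

locale unimodular_metric = orthonormal_frame g e
  for g :: "'a::euclidean_space \<Rightarrow> 'a \<Rightarrow> real" and e +
  fixes br :: "'a \<Rightarrow> 'a \<Rightarrow> 'a"
  assumes lie_bracket: "lie_bracket br" and unimodular: "unimodular br"
begin

lemma bilinear_br: "bilinear br" using lie_bracket by (simp add: lie_bracket_def)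

lemmas br_simps = bilinear_simps[OF bilinear_br]

lemma br_self [simp]: "br x x = 0" using lie_bracket by (simp add: lie_bracket_def)

lemma br_antisym: "br x y = - br y x"
proof -
  have "br (x + y) (x + y) = br x y + br y x" by (simp add: br_simps del: br_self) simp
  then show ?thesis by (simp add: eq_neg_iff_add_eq_0)
qed

lemma jacobi: "br x (br y z) + br y (br z x) + br z (br x y) = 0"
  using lie_bracket by (simp add: lie_bracket_def)

lemma trace_ad: "(\<Sum>a\<in>Basis. g (br x (e a)) (e a)) = 0" "(\<Sum>a\<in>Basis. g (br (e a) x) (e a)) = 0"
proof -
  have "linear (br x)" using bilinear_br by (simp add: bilinear_def)
  then show *: "(\<Sum>a\<in>Basis. g (br x (e a)) (e a)) = 0"
    using endo_trace_frame[of "br x"] unimodular by (simp add: unimodular_def)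
  have "g (br (e a) x) (e a) = - g (br x (e a)) (e a)" for a
    by (subst br_antisym) (simp add: g_simps)
  then show "(\<Sum>a\<in>Basis. g (br (e a) x) (e a)) = 0" using * by (simp add: sum_negf)
qed

definition koszul :: "'a \<Rightarrow> 'a \<Rightarrow> 'a \<Rightarrow> real" where
  "koszul x y z = (g (br x y) z - g (br y z) x + g (br z x) y) / 2"

abbreviation LC :: "'a \<Rightarrow> 'a \<Rightarrow> 'a" where "LC \<equiv> levi_civita br g"

lemma levi_civita_char:
  "bilinear LC" "LC x y - LC y x = br x y" "g (LC x y) z = koszul x y z"
proof -
  define D where "D x y = (\<Sum>a\<in>Basis. koszul x y (e a) *\<^sub>R e a)" for x y
  have koszul_lin: "koszul (x + x') y z = koszul x y z + koszul x' y z"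
    "koszul x (y + y') z = koszul x y z + koszul x y' z"
    "koszul (c *\<^sub>R x) y z = c * koszul x y z" "koszul x (c *\<^sub>R y) z = c * koszul x y z"
    for x x' y y' z c
    by (simp_all add: koszul_def br_simps g_simps field_simps)
  have "linear (koszul x y)" for x y
    by (intro linearI) (simp_all add: koszul_def br_simps g_simps field_simps)
  then have D: "g (D x y) z = koszul x y z" for x y z
    using contract_real(2)[of "koszul x y" z] by (simp add: D_def g_simps mult.commute)
  have bilD: "bilinear D"
    by (intro bilinear_of_linear linearI g_eqI) (simp_all add: D g_simps koszul_lin)
  have torD: "D x y - D y x = br x y" for x y
  proof (rule g_eqI)
    fix z show "g (D x y - D y x) z = g (br x y) z"
      using br_antisym[of y x] br_antisym[of x z] br_antisym[of y z]
      by (simp add: g_simps D koszul_def field_simps)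
  qed
  have metD: "g (D x y) z + g y (D x z) = 0" for x y z
    using br_antisym[of y x] br_antisym[of x z] br_antisym[of z y]
    by (simp add: g_sym[of y] D koszul_def g_simps field_simps)
  have uniq: "E = D" if "bilinear E" and tor: "\<And>x y. E x y - E y x = br x y"
    and met: "\<And>x y z. g (E x y) z + g y (E x z) = 0" for E
  proof (intro ext)
    fix x y show "E x y = D x y"
    proof (rule g_eqI)
      fix z
      have "g (br x y) z = g (E x y) z - g (E y x) z" "g (br y z) x = g (E y z) x - g (E z y) x"
        "g (br z x) y = g (E z x) y - g (E x z) y"
        by (simp_all add: g_simps flip: tor)
      then show "g (E x y) z = g (D x y) z"
        using met[of x y z] met[of y z x] met[of z x y]
          g_sym[of y "E x z"] g_sym[of z "E y x"] g_sym[of x "E z y"]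
        by (simp add: D koszul_def field_simps)
    qed
  qed
  have "LC = D"
    unfolding levi_civita_def
    by (rule the_equality) (use bilD torD metD in blast, use uniq in blast)
  then show "bilinear LC" "LC x y - LC y x = br x y" "g (LC x y) z = koszul x y z"
    using bilD torD D by auto
qed

lemmas LC_simps = bilinear_simps[OF levi_civita_char(1)]

lemma LC_metric: "g (LC x y) z = - g y (LC x z)"
  using br_antisym[of y x] br_antisym[of x z] br_antisym[of z y]
  by (simp add: g_sym[of y] levi_civita_char(3) koszul_def g_simps field_simps)

text \<open>For a general metric Lie algebra this vector is dual to \<open>x \<mapsto> tr ad x\<close>.\<close>
lemma LC_frame_sum: "(\<Sum>a\<in>Basis. LC (e a) (e a)) = 0"
proof (rule g_eqI)
  fix z
  have "g (\<Sum>a\<in>Basis. LC (e a) (e a)) z = (\<Sum>a\<in>Basis. g (br z (e a)) (e a))"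
    using br_antisym[of "e _" z]
    by (simp add: g_simps levi_civita_char(3) koszul_def)
  then show "g (\<Sum>a\<in>Basis. LC (e a) (e a)) z = g 0 z" by (simp add: trace_ad g_simps)
qed

definition killing :: "'a \<Rightarrow> 'a \<Rightarrow> real" where
  "killing x y = (\<Sum>a\<in>Basis. g (br x (br y (e a))) (e a))"

definition ric_D :: "'a \<Rightarrow> 'a \<Rightarrow> real" where
  "ric_D x y = (\<Sum>a\<in>Basis. g (br x (e a)) (br y (e a)))"

definition ric_P :: "'a \<Rightarrow> 'a \<Rightarrow> real" where
  "ric_P x y = (\<Sum>a\<in>Basis. \<Sum>b\<in>Basis. g (br (e a) (e b)) x * g (br (e a) (e b)) y)"

text \<open>Because \<open>LC_frame_sum\<close> removes the first term of the curvature, \<open>Ric x y\<close> is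
  \<open>\<Sum> g(\<nabla>\<^sub>a y, \<nabla>\<^sub>x a) - g(\<nabla>\<^bsub>[a, x]\<^esub> y, a)\<close>. By Koszul's formula both sums contain \<open>q\<close>, which
  is neither a norm nor a trace, with the same coefficient, and it cancels.\<close>
lemma Ric_formula:
  "Ric br g x y = - killing y x / 2 - ric_D x y / 2 + ric_P x y / 4"
proof -
  let ?c = "\<lambda>x y z. g (br x y) z"
  have lin: "linear (\<lambda>w. curvature br LC w x y)"
    by (intro linearI) (simp_all add: curvature_def LC_simps br_simps algebra_simps)
  have 1: "(\<Sum>a\<in>Basis. g (LC (e a) (LC x y)) (e a)) = 0"
  proof -
    have "(\<Sum>a\<in>Basis. g (LC (e a) (LC x y)) (e a)) = - g (LC x y) (\<Sum>a\<in>Basis. LC (e a) (e a))"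
      by (simp add: LC_metric[of _ "LC x y"] g_simps sum_negf)
    then show ?thesis by (simp add: LC_frame_sum g_simps)
  qed
  define q where "q = (\<Sum>a\<in>Basis. \<Sum>b\<in>Basis. ?c (e a) (e b) y * ?c x (e a) (e b))"
  have 2: "(\<Sum>a\<in>Basis. g (LC (e a) y) (LC x (e a))) = ric_P x y / 4 - q / 2"
  proof -
    \<comment> \<open>In \<open>\<nabla>\<^sub>a y\<close> the part \<open>s\<close> is symmetric in the frame indices, while \<open>r\<close>, the matrix of \<open>\<nabla>\<^sub>x\<close>, is
      antisymmetric; only the antisymmetric part \<open>p\<close> contributes.\<close>
    define s where "s a b = - ?c y (e a) (e b) - ?c y (e b) (e a)" for a b
    define p where "p a b = ?c (e b) (e a) y" for a b
    define r where "r a b = ?c x (e a) (e b) - ?c x (e b) (e a) - ?c (e a) (e b) x" for a b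
    have sr: "s a b = s b a" "r a b = - r b a" for a b
      using br_antisym[of "e a" "e b"] by (auto simp: s_def r_def g_simps)
    have "(\<Sum>a\<in>Basis. \<Sum>b\<in>Basis. s a b * r a b) = (\<Sum>a\<in>Basis. \<Sum>b\<in>Basis. s b a * r b a)"
      by (rule sum.swap)
    also have "\<dots> = - (\<Sum>a\<in>Basis. \<Sum>b\<in>Basis. s a b * r a b)"
      unfolding sum_negf[symmetric]
      by (intro sum.cong refl) (use sr in \<open>metis mult_minus_right\<close>)
    finally have sr0: "(\<Sum>a\<in>Basis. \<Sum>b\<in>Basis. s a b * r a b) = 0" by simp
    have q': "(\<Sum>a\<in>Basis. \<Sum>b\<in>Basis. ?c (e b) (e a) y * ?c x (e b) (e a)) = q"
      unfolding q_def by (rule sum.swap)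
    have q'': "(\<Sum>a\<in>Basis. \<Sum>b\<in>Basis. ?c (e b) (e a) y * ?c x (e a) (e b)) = - q"
      unfolding q_def sum_negf[symmetric]
      by (intro sum.cong refl) (subst br_antisym, simp add: g_simps)
    have P': "(\<Sum>a\<in>Basis. \<Sum>b\<in>Basis. ?c (e b) (e a) y * ?c (e a) (e b) x) = - ric_P x y"
      unfolding ric_P_def sum_negf[symmetric]
      by (intro sum.cong refl) (subst br_antisym, simp add: g_simps)
    have "(\<Sum>a\<in>Basis. g (LC (e a) y) (LC x (e a)))
        = (\<Sum>a\<in>Basis. \<Sum>b\<in>Basis. g (LC (e a) y) (e b) * g (LC x (e a)) (e b))"
      by (simp add: parseval)
    also have "\<dots> = (\<Sum>a\<in>Basis. \<Sum>b\<in>Basis. (s a b * r a b + p a b * r a b) / 4)"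
    proof (intro sum.cong refl)
      fix a b
      have "g (LC (e a) y) (e b) = (s a b + p a b) / 2"
        using br_antisym[of "e a" y] br_antisym[of "e b" "e a"]
        by (simp add: levi_civita_char(3) koszul_def s_def p_def g_simps)
      moreover have "g (LC x (e a)) (e b) = r a b / 2"
        using br_antisym[of "e b" x]
        by (simp add: levi_civita_char(3) koszul_def r_def g_simps)
      ultimately show "g (LC (e a) y) (e b) * g (LC x (e a)) (e b) = (s a b * r a b + p a b * r a b) / 4"
        by (simp only:) (simp add: field_simps)
    qed
    also have "\<dots> = (\<Sum>a\<in>Basis. \<Sum>b\<in>Basis. p a b * r a b) / 4"
      using sr0 by (simp add: sum.distrib flip: sum_divide_distrib)
    also have "(\<Sum>a\<in>Basis. \<Sum>b\<in>Basis. p a b * r a b) = - q - q + ric_P x y"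
      using q' q'' P' unfolding p_def r_def
      by (simp add: algebra_simps sum.distrib sum_subtractf)
    finally show ?thesis by (simp add: field_simps)
  qed
  have 3: "(\<Sum>a\<in>Basis. g (LC (br (e a) x) y) (e a)) = killing y x / 2 + ric_D x y / 2 - q / 2"
  proof -
    have "(\<Sum>a\<in>Basis. g (LC (br (e a) x) y) (e a))
        = (\<Sum>a\<in>Basis. (g (br y (br x (e a))) (e a) + g (br x (e a)) (br y (e a))
            - g (br (e a) (br x (e a))) y) / 2)"
    proof (intro sum.cong refl)
      fix a
      have "br (e a) x = - br x (e a)" "br (br x (e a)) y = - br y (br x (e a))"
        by (rule br_antisym)+
      then show "g (LC (br (e a) x) y) (e a) = (g (br y (br x (e a))) (e a)
          + g (br x (e a)) (br y (e a)) - g (br (e a) (br x (e a))) y) / 2"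
        by (simp add: levi_civita_char(3) koszul_def g_simps br_simps g_sym[of "br y (e a)"])
    qed
    also have "\<dots> = killing y x / 2 + ric_D x y / 2
        - (\<Sum>a\<in>Basis. g (br (e a) (br x (e a))) y) / 2"
      by (simp add: killing_def ric_D_def sum.distrib sum_subtractf add_divide_distrib
          diff_divide_distrib flip: sum_divide_distrib)
    also have "(\<Sum>a\<in>Basis. g (br (e a) (br x (e a))) y) = q"
      unfolding q_def
    proof (intro sum.cong refl)
      fix a
      have "linear (\<lambda>v. g (br (e a) v) y)"
        by (intro linearI) (simp_all add: br_simps g_simps)
      from contract_real(1)[OF this, of "br x (e a)"]
      show "g (br (e a) (br x (e a))) y = (\<Sum>b\<in>Basis. ?c (e a) (e b) y * ?c x (e a) (e b))"
        by (simp add: mult.commute)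
    qed
    finally show ?thesis .
  qed
  have "Ric br g x y = (\<Sum>a\<in>Basis. g (curvature br LC (e a) x y) (e a))"
    unfolding Ric_def by (rule endo_trace_frame[OF lin])
  also have "\<dots> = (\<Sum>a\<in>Basis. g (LC (e a) (LC x y)) (e a) + g (LC (e a) y) (LC x (e a))
      - g (LC (br (e a) x) y) (e a))"
    by (simp add: curvature_def g_simps LC_metric[of x "LC (e _) y"])
  also have "\<dots> = - killing y x / 2 - ric_D x y / 2 + ric_P x y / 4"
    using 1 2 3 by (simp add: sum.distrib sum_subtractf)
  finally show ?thesis .
qed

end

section \<open>Abelian complex structures\<close>

text \<open>This identifies the Lie algebra, with \<open>J\<close> as multiplication by \<open>\<i>\<close>, with its space of
  \<open>(1,0)\<close>-vectors. It allows complex calculations to take place on the real Lie algebra.\<close>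
definition g10_vector :: "('a::real_vector \<Rightarrow> 'a) \<Rightarrow> 'a \<Rightarrow> 'a cpx" where
  "g10_vector J x = (x, - J x)"

locale abelian_hermitian = unimodular_metric g e br
  for g :: "'a::euclidean_space \<Rightarrow> 'a \<Rightarrow> real" and e and br +
  fixes J :: "'a \<Rightarrow> 'a"
  assumes linear_J: "linear J" and JJ [simp]: "J (J x) = - x"
    and g_JJ [simp]: "g (J x) (J y) = g x y" and br_JJ [simp]: "br (J x) (J y) = br x y"
begin

lemmas J_simps = linear_map_simps[OF linear_J]

lemma g_J: "g x (J y) = - g (J x) y"
  using g_JJ[of x "J y"] by (simp add: g_simps)

lemma br_J: "br x (J y) = - br (J x) y"
  using br_JJ[of x "J y"] by (simp add: br_simps)

text \<open>The vectors \<open>J (e a)\<close> form an orthonormal frame, too.\<close>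
lemma frame_sum_J:
  assumes f: "bilinear f"
  shows "(\<Sum>a\<in>Basis. f (J (e a)) (J (e a))) = (\<Sum>a\<in>Basis. f (e a) (e a))"
proof -
  have "(\<Sum>a\<in>Basis. f (J (e a)) (J (e a)))
      = (\<Sum>a\<in>Basis. \<Sum>b\<in>Basis. g (J (e a)) (e b) *\<^sub>R f (e b) (J (e a)))"
  proof (intro sum.cong refl)
    fix a
    have "linear (\<lambda>v. f v (J (e a)))" using f by (simp add: bilinear_def)
    from contract_linear(1)[OF this, of "J (e a)"]
    show "f (J (e a)) (J (e a)) = (\<Sum>b\<in>Basis. g (J (e a)) (e b) *\<^sub>R f (e b) (J (e a)))" by simp
  qed
  also have "\<dots> = (\<Sum>b\<in>Basis. \<Sum>a\<in>Basis. g (J (e a)) (e b) *\<^sub>R f (e b) (J (e a)))"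
    by (rule sum.swap)
  also have "\<dots> = (\<Sum>b\<in>Basis. f (e b) (e b))"
  proof (intro sum.cong refl)
    fix b
    have "linear (\<lambda>v. f (e b) (J v))"
      using f linear_J linear_compose[of J "f (e b)"] by (simp add: bilinear_def o_def)
    from contract_linear(2)[OF this, of "J (e b)"]
    have "(\<Sum>a\<in>Basis. g (e a) (J (e b)) *\<^sub>R f (e b) (J (e a))) = - f (e b) (e b)"
      by (simp add: bilinear_simps[OF f])
    then show "(\<Sum>a\<in>Basis. g (J (e a)) (e b) *\<^sub>R f (e b) (J (e a))) = f (e b) (e b)"
      by (simp add: g_J sum_negf)
  qed
  finally show ?thesis .
qed

text \<open>Half of the Hermitian product of the \<open>(1,0)\<close>-vectors of \<open>x\<close> and \<open>y\<close> (\<open>ext_form_g\<close>).\<close>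
definition H :: "'a \<Rightarrow> 'a \<Rightarrow> complex" where
  "H x y = Complex (g x y) (g x (J y))"

lemma H_J [simp]: "H (J x) y = \<i> * H x y" "H x (J y) = - (\<i> * H x y)"
  by (auto simp: H_def complex_eq_iff g_simps) (simp add: g_J)

lemma bilinear_H: "bilinear H"
  by (intro bilinear_of_linear linearI) (auto simp: H_def complex_eq_iff g_simps J_simps)

lemmas H_simps = bilinear_simps[OF bilinear_H]

lemma cnj_H: "cnj (H x y) = H y x"
  using g_sym[of x y] g_sym[of "J x" y] by (auto simp: H_def complex_eq_iff g_J g_simps)

lemma H_self: "H x x = of_real (g x x)"
proof -
  have "g x (J x) = 0" using g_J[of x x] g_sym[of x "J x"] by simp
  then show ?thesis by (simp add: H_def complex_eq_iff)
qed

definition clinear :: "('a \<Rightarrow> complex) \<Rightarrow> bool" where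
  "clinear L \<longleftrightarrow> linear L \<and> (\<forall>x. L (J x) = \<i> * L x)"

definition antilinear :: "('a \<Rightarrow> complex) \<Rightarrow> bool" where
  "antilinear L \<longleftrightarrow> linear L \<and> (\<forall>x. L (J x) = - (\<i> * L x))"

definition sesquilinear :: "('a \<Rightarrow> 'a \<Rightarrow> complex) \<Rightarrow> bool" where
  "sesquilinear X \<longleftrightarrow> (\<forall>y. clinear (\<lambda>x. X x y)) \<and> (\<forall>x. antilinear (X x))"

text \<open>In the complex vector space given by \<open>J\<close>, the real orthonormal frame has twice as many vectors
  as a unitary frame, but it satisfies Parseval's identity up to the factor 2. So it does the service
  of a unitary frame in all contractions.\<close>
lemma H_contract:
  shows "clinear L \<Longrightarrow> (\<Sum>a\<in>Basis. H v (e a) * L (e a)) = 2 * L v"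
    and "antilinear L \<Longrightarrow> (\<Sum>a\<in>Basis. H (e a) v * L (e a)) = 2 * L v"
proof -
  have H: "H v w = of_real (g v w) - \<i> * of_real (g (J v) w)" for v w
    by (simp add: H_def complex_eq_iff g_J)
  have *: "(\<Sum>a\<in>Basis. H v (e a) * L (e a)) = L v - \<i> * L (J v)" if "linear L" for L v
    using contract_linear(1)[OF that, of v] contract_linear(1)[OF that, of "J v"]
    by (simp add: H scaleR_conv_of_real left_diff_distrib sum_subtractf mult.assoc
        flip: sum_distrib_left)
  show "(\<Sum>a\<in>Basis. H v (e a) * L (e a)) = 2 * L v" if "clinear L"
    using that *[of L v] by (simp add: clinear_def)
  have H': "H w v = of_real (g v w) + \<i> * of_real (g (J v) w)" for v w
    by (simp add: H_def complex_eq_iff g_sym)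
  have *: "(\<Sum>a\<in>Basis. H (e a) v * L (e a)) = L v + \<i> * L (J v)" if "linear L" for L v
    using contract_linear(1)[OF that, of v] contract_linear(1)[OF that, of "J v"]
    by (simp add: H' scaleR_conv_of_real distrib_right sum.distrib mult.assoc
        flip: sum_distrib_left)
  show "(\<Sum>a\<in>Basis. H (e a) v * L (e a)) = 2 * L v" if "antilinear L"
    using that *[of L v] by (simp add: antilinear_def)
qed

text \<open>The \<open>(1,0)\<close>-part of the bracket of a \<open>(1,0)\<close>-vector with a \<open>(0,1)\<close>-vector, see \<open>ext_br_10_01\<close>.\<close>
definition \<beta> :: "'a \<Rightarrow> 'a \<Rightarrow> 'a" where "\<beta> x y = br x y + J (br x (J y))"

lemma bilinear_\<beta>: "bilinear \<beta>"
  by (intro bilinear_of_linear linearI) (auto simp: \<beta>_def br_simps J_simps algebra_simps)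

lemmas \<beta>_simps = bilinear_simps[OF bilinear_\<beta>]

lemma \<beta>_J [simp]: "\<beta> (J x) y = J (\<beta> x y)" "\<beta> x (J y) = - J (\<beta> x y)"
  by (auto simp: \<beta>_def J_simps br_simps) (simp add: br_J J_simps)

lemma br_\<beta>: "br x y = (1/2) *\<^sub>R (\<beta> x y - \<beta> y x)"
proof -
  have "br y (J x) = br x (J y)" using br_antisym[of y "J x"] by (simp add: br_J)
  then have "\<beta> x y - \<beta> y x = br x y + br x y"
    using br_antisym[of y x] by (simp add: \<beta>_def)
  then show ?thesis by (simp flip: scaleR_2)
qed

text \<open>The \<open>(1,0)\<close>-part of the Jacobi identity for two commuting \<open>(1,0)\<close>-vectors and a
  \<open>(0,1)\<close>-vector. In real terms, the symmetric expressions in \<open>x\<close> and \<open>y\<close> that appear differ from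
  each other by brackets with \<open>[x, y] - [J x, J y]\<close> and with \<open>[J x, y] + [x, J y]\<close>, which vanish.\<close>
lemma \<beta>_jacobi: "\<beta> x (\<beta> z y) = \<beta> y (\<beta> z x)"
proof -
  have expand: "\<beta> x (\<beta> z y) = (br x (br z y) - br (J x) (br z (J y)))
      - J (br (J x) (br z y) + br x (br z (J y)))" for x y
    using br_J[of x "br z y"] br_J[of x "J (br z (J y))"]
    by (simp add: \<beta>_def[of x] \<beta>_def[of z] br_simps J_simps algebra_simps)
      (simp add: br_J J_simps br_simps)
  have jac: "br x (br z y) - br y (br z x) = br z (br x y)" for x y
    using jacobi[of x z y] br_antisym[of y x] br_antisym[of x z]
    by (simp add: br_simps algebra_simps add_eq_0_iff)
  have 1: "br x (br z y) - br (J x) (br z (J y)) = br y (br z x) - br (J y) (br z (J x))"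
    using jac[of x y] jac[of "J x" "J y"] by (simp add: algebra_simps)
  have 2: "br (J x) (br z y) + br x (br z (J y)) = br (J y) (br z x) + br y (br z (J x))"
    using jac[of "J x" y] jac[of x "J y"] br_J[of x y] by (simp add: br_simps algebra_simps)
  show ?thesis unfolding expand[of x y] expand[of y x] 1 2 ..
qed

lemma \<beta>_trace: "(\<Sum>a\<in>Basis. g (\<beta> (e a) z) (e a)) = 0"
proof -
  have bil: "bilinear (\<lambda>x y. g (br x z) y)"
    by (intro bilinear_of_linear linearI) (auto simp: g_simps br_simps)
  have "g (\<beta> (e a) z) (e a) = g (br (e a) z) (e a) + g (br (J (e a)) z) (J (e a))" for a
    by (simp add: \<beta>_def g_simps g_J br_J J_simps)
  then show ?thesis
    using frame_sum_J[OF bil] by (simp add: sum.distrib trace_ad)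
qed

lemma \<beta>_trace_H: "(\<Sum>a\<in>Basis. H (\<beta> (e a) z) (e a)) = 0" "(\<Sum>a\<in>Basis. H (e a) (\<beta> (e a) z)) = 0"
proof -
  show *: "(\<Sum>a\<in>Basis. H (\<beta> (e a) z) (e a)) = 0"
    using \<beta>_trace[of z] \<beta>_trace[of "J z"]
    by (simp add: H_def complex_eq_iff Re_sum Im_sum g_J g_simps sum_negf)
  have "(\<Sum>a\<in>Basis. H (e a) (\<beta> (e a) z)) = cnj (\<Sum>a\<in>Basis. H (\<beta> (e a) z) (e a))"
    by (simp add: cnj_sum cnj_H)
  then show "(\<Sum>a\<in>Basis. H (e a) (\<beta> (e a) z)) = 0" using * by simp
qed

text \<open>Up to a constant factor, the metric dual of the Lee form, which is the real part of the trace
  of the Chern torsion (see \<open>torsion_trace\<close>).\<close>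
definition lee :: 'a where "lee = (\<Sum>a\<in>Basis. \<beta> (e a) (e a))"

text \<open>In Koszul's formula for the codifferential the traces of \<open>J ad x\<close> and of \<open>ad x J\<close> cancel, which
  leaves the sum of the brackets \<open>[J e, e]\<close>.\<close>
lemma balanced_iff: "balanced br J g \<longleftrightarrow> lee = 0"
proof -
  have lee: "lee = J (\<Sum>a\<in>Basis. br (e a) (J (e a)))"
    by (simp add: lee_def \<beta>_def J_simps)
  have "codifferential2 br g (fundamental_form J g) x
      = g (\<Sum>a\<in>Basis. br (J (e a)) (e a)) x / 2" for x
  proof -
    let ?w = "fundamental_form J g"
    let ?f = "\<lambda>u v. - ?w (LC u v) x - ?w v (LC u x)"
    have bil: "bilinear ?f"
      by (intro bilinear_of_linear linearI)
        (auto simp: fundamental_form_def LC_simps J_simps g_simps algebra_simps)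
    have "codifferential2 br g ?w x = - (\<Sum>b\<in>Basis. ?f b (sharp g b))"
      by (simp add: codifferential2_def)
    also have "\<dots> = - (\<Sum>a\<in>Basis. ?f (e a) (e a))"
      using frame_sum_bilinear[OF bil] by (simp add: sharp_frame)
    also have "\<dots> = ?w (\<Sum>a\<in>Basis. LC (e a) (e a)) x + (\<Sum>a\<in>Basis. ?w (e a) (LC (e a) x))"
      by (simp add: fundamental_form_def J_simps g_simps sum.distrib sum_subtractf sum_negf)
    also have "\<dots> = (\<Sum>a\<in>Basis. g (LC (e a) x) (J (e a)))"
      by (simp add: LC_frame_sum fundamental_form_def J_simps g_simps g_sym)
    also have "\<dots> = (\<Sum>a\<in>Basis. (g (br (e a) x) (J (e a)) - g (br x (J (e a))) (e a)
        + g (br (J (e a)) (e a)) x) / 2)"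
      by (simp add: levi_civita_char(3) koszul_def)
    also have "\<dots> = (\<Sum>a\<in>Basis. g (br (J (e a)) (e a)) x) / 2"
    proof -
      have "bilinear (\<lambda>u v. g (br x (J u)) v)"
        by (intro bilinear_of_linear linearI) (auto simp: g_simps br_simps J_simps)
      from frame_sum_J[OF this]
      have "(\<Sum>a\<in>Basis. g (br (e a) x) (J (e a))) = (\<Sum>a\<in>Basis. g (br x (J (e a))) (e a))"
        using br_antisym[of _ x] by (simp add: br_simps g_simps)
      then show ?thesis
        by (simp add: sum.distrib sum_subtractf flip: sum_divide_distrib)
    qed
    finally show ?thesis by (simp add: g_simps)
  qed
  then have "balanced br J g \<longleftrightarrow> (\<Sum>a\<in>Basis. br (J (e a)) (e a)) = 0"
    unfolding balanced_def by (metis g_eqI g_simps(9) divide_eq_0_iff zero_neq_numeral)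
  also have "(\<Sum>a\<in>Basis. br (J (e a)) (e a)) = J lee"
    by (simp add: lee br_J sum_negf)
  also have "J lee = 0 \<longleftrightarrow> lee = 0"
    using J_simps JJ by (metis neg_equal_0_iff_equal)
  finally show ?thesis .
qed

section \<open>The Chern connection\<close>

text \<open>The adjoint of \<open>\<beta>(\<cdot>, x)\<close>, applied to \<open>y\<close>.\<close>
definition \<delta> :: "'a \<Rightarrow> 'a \<Rightarrow> 'a" where
  "\<delta> x y = (\<Sum>a\<in>Basis. g y (\<beta> (e a) x) *\<^sub>R e a)"

lemma g_\<delta>: "g (\<delta> x y) z = g y (\<beta> z x)"
proof -
  have "linear (\<lambda>z. g y (\<beta> z x))"
    by (intro linearI) (auto simp: g_simps \<beta>_simps)
  from contract_real(2)[OF this, of z] show ?thesis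
    by (simp add: \<delta>_def g_simps mult.commute)
qed

lemma bilinear_\<delta>: "bilinear \<delta>"
  by (intro bilinear_of_linear linearI g_eqI) (auto simp: g_\<delta> g_simps \<beta>_simps algebra_simps)

lemmas \<delta>_simps = bilinear_simps[OF bilinear_\<delta>]

lemma \<delta>_J [simp]: "\<delta> (J x) y = J (\<delta> x y)" "\<delta> x (J y) = J (\<delta> x y)"
proof -
  have *: "g (J u) v = - g u (J v)" for u v by (simp add: g_J)
  show "\<delta> (J x) y = J (\<delta> x y)" "\<delta> x (J y) = J (\<delta> x y)"
    by (rule g_eqI; simp add: g_\<delta> * g_simps)+
qed

lemma H_\<delta>: "H (\<delta> x y) z = H y (\<beta> z x)"
  by (simp add: H_def g_\<delta>)

lemma g10_vector_simps:
  "g10_vector J (x + y) = g10_vector J x + g10_vector J y"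
  "g10_vector J (- x) = - g10_vector J x"
  "g10_vector J (x - y) = g10_vector J x - g10_vector J y"
  by (auto simp: g10_vector_def J_simps)

lemma g10_iff: "Z \<in> g10 J \<longleftrightarrow> Z = g10_vector J (fst Z)"
proof -
  have "J a = - b \<and> J b = a \<longleftrightarrow> b = - J a" for a b :: 'a
    using J_simps by auto
  then show ?thesis
    by (cases Z) (auto simp: g10_def ext_lin_def cpx_scale_def g10_vector_def)
qed

lemma g10_vector_in [simp]: "g10_vector J x \<in> g10 J"
  by (simp add: g10_iff) (simp add: g10_vector_def)

text \<open>The derivative in the direction \<open>y\<close> is half the sum of those in the directions of the
  \<open>(1,0)\<close>-vector and the \<open>(0,1)\<close>-vector of \<open>y\<close> (\<open>chern_g10\<close>).\<close>
definition chern_connection :: "'a \<Rightarrow> 'a \<Rightarrow> 'a" where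
  "chern_connection y x = (1/2) *\<^sub>R (\<delta> y x - \<beta> x y)"

text \<open>Vanishing of the mixed torsion prescribes \<open>D y x + J (D (J y) x)\<close>, the derivative in
  \<open>(0,1)\<close>-directions; compatibility with the metric then prescribes \<open>D y x - J (D (J y) x)\<close>, the one
  in \<open>(1,0)\<close>-directions, as minus the adjoint of the former.\<close>
lemma chern_eq: "chern br J g = chern_connection"
  unfolding chern_def
proof (rule the_equality)
  let ?D = chern_connection
  have mixed: "(\<forall>Z\<in>g10 J. \<forall>W\<in>g10 J. ext_bil (torsion br D) Z (cpx_cnj W) = 0) \<longleftrightarrow>
      (\<forall>x y. D y x + J (D (J y) x) = - \<beta> x y)"
    if bil: "bilinear D" and DJ: "\<And>x y. D x (J y) = J (D x y)" for D
  proof -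
    note D = bilinear_simps[OF bil]
    have "(\<forall>Z\<in>g10 J. \<forall>W\<in>g10 J. ext_bil (torsion br D) Z (cpx_cnj W) = 0) \<longleftrightarrow>
        (\<forall>x y. ext_bil (torsion br D) (g10_vector J x) (cpx_cnj (g10_vector J y)) = 0)"
      by (metis g10_iff g10_vector_in)
    also have "\<dots> \<longleftrightarrow> (\<forall>x y. D y x + J (D (J y) x) = - \<beta> x y)"
    proof -
      \<comment> \<open>The two components of the mixed torsion are the antisymmetric and, up to \<open>J\<close>, the symmetric
        part of \<open>q + \<beta>\<close>.\<close>
      define q where "q x y = D y x + J (D (J y) x)" for x y
      have e: "ext_bil (torsion br D) (g10_vector J x) (cpx_cnj (g10_vector J y))
          = (q y x - q x y - 2 *\<^sub>R br x y, J (q y x + q x y) - 2 *\<^sub>R br x (J y))" for x y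
        by (simp add: ext_bil_def torsion_def g10_vector_def cpx_cnj_def q_def D br_simps J_simps DJ
            br_J scaleR_2)
      have "ext_bil (torsion br D) (g10_vector J x) (cpx_cnj (g10_vector J y)) = 0 \<longleftrightarrow>
          q x y = - \<beta> x y \<and> q y x = - \<beta> y x" for x y
      proof -
        have b: "\<beta> x y - \<beta> y x = 2 *\<^sub>R br x y" by (simp add: br_\<beta>[of x y])
        have c: "\<beta> x y + \<beta> y x = 2 *\<^sub>R J (br x (J y))"
        proof -
          have "br y (J x) = br x (J y)" using br_antisym[of y "J x"] by (simp add: br_J)
          then show ?thesis using br_antisym[of y x] by (simp add: \<beta>_def scaleR_2)
        qed
        have "ext_bil (torsion br D) (g10_vector J x) (cpx_cnj (g10_vector J y)) = 0 \<longleftrightarrow>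
            q y x - q x y = 2 *\<^sub>R br x y \<and> J (q y x + q x y) = 2 *\<^sub>R br x (J y)"
          by (simp add: e zero_prod_def)
        also have "J (q y x + q x y) = 2 *\<^sub>R br x (J y) \<longleftrightarrow> q y x + q x y = - (2 *\<^sub>R J (br x (J y)))"
          by (metis JJ J_simps(2,3) minus_minus)
        also have "(q y x - q x y = 2 *\<^sub>R br x y \<and> q y x + q x y = - (2 *\<^sub>R J (br x (J y)))) \<longleftrightarrow>
            q x y = - \<beta> x y \<and> q y x = - \<beta> y x"
        proof
          assume a: "q y x - q x y = 2 *\<^sub>R br x y \<and> q y x + q x y = - (2 *\<^sub>R J (br x (J y)))"
          then have "q y x - q x y = \<beta> x y - \<beta> y x" "q y x + q x y = - (\<beta> x y + \<beta> y x)"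
            by (simp_all only: b c)
          note sums = this
          have "2 *\<^sub>R q x y = (q y x + q x y) - (q y x - q x y)" by (simp add: scaleR_2)
          also have "\<dots> = 2 *\<^sub>R (- \<beta> x y)" unfolding sums by (simp add: scaleR_2)
          finally have qx: "2 *\<^sub>R q x y = 2 *\<^sub>R (- \<beta> x y)" .
          have "2 *\<^sub>R q y x = (q y x + q x y) + (q y x - q x y)" by (simp add: scaleR_2)
          also have "\<dots> = 2 *\<^sub>R (- \<beta> y x)" unfolding sums by (simp add: scaleR_2)
          finally have qy: "2 *\<^sub>R q y x = 2 *\<^sub>R (- \<beta> y x)" .
          show "q x y = - \<beta> x y \<and> q y x = - \<beta> y x"
            using scaleR_left_imp_eq[OF _ qx] scaleR_left_imp_eq[OF _ qy] by simp
        next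
          assume "q x y = - \<beta> x y \<and> q y x = - \<beta> y x"
          then show "q y x - q x y = 2 *\<^sub>R br x y \<and> q y x + q x y = - (2 *\<^sub>R J (br x (J y)))"
            unfolding b[symmetric] c[symmetric] by simp
        qed
        finally show ?thesis .
      qed
      then show ?thesis by (auto simp: q_def)
    qed
    finally show ?thesis .
  qed
  have bil: "bilinear ?D"
    by (intro bilinear_of_linear linearI)
      (auto simp: chern_connection_def \<delta>_simps \<beta>_simps algebra_simps)
  have DJ: "?D x (J y) = J (?D x y)" for x y
    by (simp add: chern_connection_def J_simps)
  have met: "g (?D x y) z + g y (?D x z) = 0" for x y z
    using g_\<delta>[of x z y] g_sym[of y "\<delta> x z"] g_sym[of z "\<beta> y x"]
    by (simp add: chern_connection_def g_simps g_\<delta> field_simps)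
  have "?D y x + J (?D (J y) x) = - \<beta> x y" for x y
    by (simp add: chern_connection_def J_simps algebra_simps flip: scaleR_add_left)
  then show "bilinear ?D \<and> (\<forall>x y. ?D x (J y) = J (?D x y)) \<and>
     (\<forall>x y z. g (?D x y) z + g y (?D x z) = 0) \<and>
     (\<forall>Z\<in>g10 J. \<forall>W\<in>g10 J. ext_bil (torsion br ?D) Z (cpx_cnj W) = 0)"
    using mixed[OF bil DJ] bil DJ met by auto
  fix D assume D: "bilinear D \<and> (\<forall>x y. D x (J y) = J (D x y)) \<and>
     (\<forall>x y z. g (D x y) z + g y (D x z) = 0) \<and>
     (\<forall>Z\<in>g10 J. \<forall>W\<in>g10 J. ext_bil (torsion br D) Z (cpx_cnj W) = 0)"
  then have q: "D y x + J (D (J y) x) = - \<beta> x y" for x y using mixed[of D] by auto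
  have "D y x - J (D (J y) x) = \<delta> y x" for x y
  proof (rule g_eqI)
    fix z
    have m: "g (D u v) w = - g v (D u w)" for u v w
      using D by (metis add_eq_0_iff2)
    have DJ': "D u (J v) = J (D u v)" for u v using D by simp
    have "g (D y x - J (D (J y) x)) z = - g x (D y z + J (D (J y) z))"
      using m[of y x z] m[of "J y" x "J z"] g_J[of "D (J y) x" z] by (simp add: g_simps DJ')
    then show "g (D y x - J (D (J y) x)) z = g (\<delta> y x) z"
      by (simp add: q g_\<delta> g_simps)
  qed
  note holo = this
  have "D y x + D y x = \<delta> y x - \<beta> x y" for x y
  proof -
    have "D y x + D y x = (D y x - J (D (J y) x)) + (D y x + J (D (J y) x))" by simp
    then show ?thesis unfolding holo q by simp
  qed
  then have "D y x = ?D y x" for x y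
    unfolding chern_connection_def by (metis scaleR_half_double)
  then show "D = ?D" by (intro ext)
qed

lemma chern_g10:
  shows ext_chern_10: "ext_bil (chern br J g) (g10_vector J x) (g10_vector J y) = g10_vector J (\<delta> x y)"
    and ext_chern_01: "ext_bil (chern br J g) (cpx_cnj (g10_vector J y)) (g10_vector J x)
      = g10_vector J (- \<beta> x y)"
proof -
  have half: "(1/2) *\<^sub>R (v + v) = v" for v :: 'a by (simp flip: scaleR_2)
  show "ext_bil (chern br J g) (g10_vector J x) (g10_vector J y) = g10_vector J (\<delta> x y)"
    unfolding chern_eq
    using half[of "\<delta> x y"] half[of "J (\<delta> x y)"]
    by (simp add: ext_bil_def g10_vector_def chern_connection_def \<delta>_simps \<beta>_simps J_simps
        algebra_simps)
  show "ext_bil (chern br J g) (cpx_cnj (g10_vector J y)) (g10_vector J x) = g10_vector J (- \<beta> x y)"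
    unfolding chern_eq
    using half[of "\<beta> x y"] half[of "J (\<beta> x y)"]
    by (simp add: ext_bil_def g10_vector_def cpx_cnj_def chern_connection_def \<delta>_simps \<beta>_simps J_simps
        algebra_simps)
qed

lemma ext_br_10_01:
  "ext_bil br (g10_vector J x) (cpx_cnj (g10_vector J y))
    = g10_vector J (\<beta> x y) - cpx_cnj (g10_vector J (\<beta> y x))"
proof -
  have "br y (J x) = br x (J y)" using br_antisym[of y "J x"] by (simp add: br_J)
  then show ?thesis
    using br_antisym[of y x]
    by (simp add: ext_bil_def g10_vector_def cpx_cnj_def \<beta>_def br_simps J_simps) (simp add: br_J)
qed

lemma ext_br_10_10: "ext_bil br (g10_vector J x) (g10_vector J y) = 0"
  by (simp add: ext_bil_def g10_vector_def br_simps br_J J_simps zero_prod_def)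

lemma ext_form_g10:
  assumes "bilinear h"
  shows "ext_form h (g10_vector J x) (cpx_cnj (g10_vector J y))
    = Complex (h x y + h (J x) (J y)) (h x (J y) - h (J x) y)"
  by (simp add: ext_form_def g10_vector_def cpx_cnj_def bilinear_simps[OF assms])

lemma ext_form_g: "ext_form g (g10_vector J x) (cpx_cnj (g10_vector J y)) = 2 * H x y"
  by (simp add: ext_form_g10[OF bilinear_g] H_def complex_eq_iff g_J g_simps)

text \<open>Half of the Chern torsion, with the last index lowered and barred (\<open>TT_eq\<close>).\<close>
definition tor :: "'a \<Rightarrow> 'a \<Rightarrow> 'a \<Rightarrow> complex" where
  "tor x y z = H y (\<beta> z x) - H x (\<beta> z y)"

definition curv :: "'a \<Rightarrow> 'a \<Rightarrow> 'a \<Rightarrow> 'a" where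
  "curv k l x = - \<delta> k (\<beta> x l) + \<beta> (\<delta> k x) l - \<delta> (\<beta> k l) x - \<beta> x (\<beta> l k)"

end

section \<open>Contractions in a frame of type \<open>(1,0)\<close>\<close>

locale abelian_hermitian_frame = abelian_hermitian g e br J
  for g :: "'a::euclidean_space \<Rightarrow> 'a \<Rightarrow> real" and e and br and J +
  fixes Z :: "'n::finite \<Rightarrow> 'a cpx"
  assumes frame: "frame10 J Z"
begin

definition zeta :: "'n \<Rightarrow> 'a" where "zeta i = fst (Z i)"

lemma Z_eq: "Z i = g10_vector J (zeta i)"
  using frame by (simp add: frame10_def g10_iff zeta_def)

lemma TT_eq: "TT br J g Z i j k = 2 * tor (zeta i) (zeta j) (zeta k)"
proof -
  have "ext_bil (torsion br (chern br J g)) (Z i) (Z j)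
      = ext_bil (chern br J g) (Z i) (Z j) - ext_bil (chern br J g) (Z j) (Z i) - ext_bil br (Z i) (Z j)"
    by (simp add: ext_bil_def torsion_def)
  then have "ext_bil (torsion br (chern br J g)) (Z i) (Z j)
      = g10_vector J (\<delta> (zeta i) (zeta j) - \<delta> (zeta j) (zeta i))"
    by (simp add: Z_eq ext_chern_10 ext_br_10_10 g10_vector_simps)
  then show ?thesis
    by (simp add: TT_def Z_eq ext_form_g tor_def H_simps H_\<delta>)
qed

lemma chern_curv_eq: "chern_curv br J g Z k l i j = 2 * H (curv (zeta k) (zeta l) (zeta i)) (zeta j)"
proof -
  have bil: "bilinear (chern br J g)"
    unfolding chern_eq
    by (intro bilinear_of_linear linearI)
      (auto simp: chern_connection_def \<delta>_simps \<beta>_simps algebra_simps)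
  have "ext_bil (chern br J g) (U - V) W = ext_bil (chern br J g) U W - ext_bil (chern br J g) V W"
    for U V W by (simp add: ext_bil_def bilinear_simps[OF bil])
  then show ?thesis
    by (simp add: chern_curv_def Let_def Z_eq ext_chern_10 ext_chern_01 ext_br_10_01 \<beta>_simps \<delta>_simps
        ext_form_g curv_def flip: g10_vector_simps)
      (simp add: algebra_simps)
qed

lemma hcomp_g: "hcomp g Z i j = 2 * H (zeta i) (zeta j)"
  by (simp add: hcomp_def Z_eq ext_form_g)

text \<open>A complex linear combination of the frame, with \<open>J\<close> in the place of \<open>\<i>\<close>.\<close>
definition comb :: "('n \<Rightarrow> complex) \<Rightarrow> 'a" where
  "comb c = (\<Sum>i\<in>UNIV. Re (c i) *\<^sub>R zeta i + Im (c i) *\<^sub>R J (zeta i))"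

lemma comb_ex1: "\<exists>!c. x = comb c"
proof -
  have "(\<Sum>i\<in>UNIV. cpx_scale (c i) (Z i)) = g10_vector J (comb c)" for c
    by (simp add: comb_def Z_eq cpx_scale_def g10_vector_def J_simps sum_prod scaleR_sum_right
        sum_negf sum.distrib sum_subtractf algebra_simps prod_eq_iff fst_sum snd_sum)
  moreover have "g10_vector J x = g10_vector J y \<longleftrightarrow> x = y" for x y
    by (auto simp: g10_vector_def)
  ultimately show ?thesis
    using frame by (simp add: frame10_def) (metis g10_vector_in)
qed

lemma clinear_comb: "clinear L \<Longrightarrow> L (comb c) = (\<Sum>i\<in>UNIV. c i * L (zeta i))"
  by (auto simp: comb_def clinear_def linear_map_simps intro!: sum.cong)
    (simp add: complex_eq_iff)

lemma antilinear_comb: "antilinear L \<Longrightarrow> L (comb c) = (\<Sum>i\<in>UNIV. cnj (c i) * L (zeta i))"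
  by (auto simp: comb_def antilinear_def linear_map_simps intro!: sum.cong)
    (simp add: complex_eq_iff)

lemma clinear_H: "clinear (\<lambda>x. H x y)" and antilinear_H: "antilinear (H x)"
  by (auto simp: clinear_def antilinear_def H_simps intro!: linearI)

text \<open>The Gram matrix is invertible: a vector in its kernel is the conjugate of the coefficients of a
  combination orthogonal to the frame, hence to itself. The factor 2 is that between \<open>H\<close> and the
  metric on \<open>(1,0)\<close>-vectors.\<close>
lemma ginv_inverse:
  "(\<Sum>l\<in>UNIV. ginv g Z k l * (2 * H (zeta m) (zeta l))) = (if k = m then 1 else 0)"
proof -
  define A where "A = ((\<chi> i j. hcomp g Z i j) :: complex ^ 'n ^ 'n)"
  have "v = 0" if "A *v v = 0" for v
  proof -
    define y where "y = comb (\<lambda>l. cnj (v $ l))"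
    have Hy: "H (zeta m) y = 0" for m
    proof -
      have "(A *v v) $ m = (\<Sum>l\<in>UNIV. 2 * H (zeta m) (zeta l) * v $ l)"
        by (simp add: matrix_vector_mult_def A_def hcomp_g)
      also have "\<dots> = 2 * H (zeta m) y"
        by (simp add: y_def antilinear_comb[OF antilinear_H] sum_distrib_left mult_ac)
      finally show ?thesis using that by simp
    qed
    have "H y y = 0"
      using clinear_comb[OF clinear_H, of "\<lambda>l. cnj (v $ l)" y] Hy by (simp add: y_def[symmetric])
    then have "y = 0" using g_pos[of y] by (force simp: H_self)
    moreover have "comb (\<lambda>l. 0) = 0" by (simp add: comb_def)
    ultimately have "(\<lambda>l. cnj (v $ l)) = (\<lambda>l. 0)" using comb_ex1 unfolding y_def by metis
    then show ?thesis by (auto simp: vec_eq_iff fun_eq_iff)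
  qed
  then have "invertible A"
    by (simp add: invertible_left_inverse matrix_left_invertible_ker)
  then have "A ** matrix_inv A = mat 1"
    unfolding invertible_def matrix_inv_def by (rule someI2_ex) simp
  then have "(A ** matrix_inv A) $ m $ k = (mat 1 :: complex ^ 'n ^ 'n) $ m $ k" by simp
  then show ?thesis
    by (simp add: matrix_matrix_mult_def mat_def A_def hcomp_g ginv_def mult.commute eq_commute[of k])
qed

lemma frame_representation:
  assumes "clinear L"
  shows "L x = (\<Sum>k\<in>UNIV. \<Sum>l\<in>UNIV. ginv g Z k l * (2 * H x (zeta l)) * L (zeta k))"
proof -
  obtain c where x: "x = comb c" using comb_ex1 by metis
  have "(\<Sum>l\<in>UNIV. ginv g Z k l * (2 * H x (zeta l))) = c k" for k
  proof -
    have "(\<Sum>l\<in>UNIV. ginv g Z k l * (2 * H x (zeta l)))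
        = (\<Sum>l\<in>UNIV. \<Sum>m\<in>UNIV. c m * (ginv g Z k l * (2 * H (zeta m) (zeta l))))"
      by (simp add: x clinear_comb[OF clinear_H] sum_distrib_left mult_ac)
    also have "\<dots> = (\<Sum>m\<in>UNIV. c m * (\<Sum>l\<in>UNIV. ginv g Z k l * (2 * H (zeta m) (zeta l))))"
      by (subst sum.swap) (simp add: sum_distrib_left)
    also have "\<dots> = c k" by (simp add: ginv_inverse if_distrib cong: if_cong)
    finally show ?thesis .
  qed
  then have "(\<Sum>k\<in>UNIV. \<Sum>l\<in>UNIV. ginv g Z k l * (2 * H x (zeta l)) * L (zeta k)) = (\<Sum>k\<in>UNIV. c k * L (zeta k))"
    by (simp flip: sum_distrib_right)
  then show ?thesis by (simp add: x clinear_comb[OF assms])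
qed

text \<open>One factor 2 in the denominator comes from \<open>H_contract\<close> and the other one from \<open>hcomp_g\<close>. This
  lemma eliminates the given frame and the inverse matrix from all that follows.\<close>
lemma contract_frame:
  assumes X: "sesquilinear X"
  shows "(\<Sum>k\<in>UNIV. \<Sum>l\<in>UNIV. ginv g Z k l * X (zeta k) (zeta l)) = (\<Sum>a\<in>Basis. X (e a) (e a)) / 4"
proof -
  have "(\<Sum>a\<in>Basis. X (e a) (e a)) = (\<Sum>a\<in>Basis. \<Sum>k\<in>UNIV. \<Sum>l\<in>UNIV.
      2 * ginv g Z k l * (H (e a) (zeta l) * X (zeta k) (e a)))"
  proof (rule sum.cong[OF refl])
    fix a
    have "clinear (\<lambda>x. X x (e a))" using X by (simp add: sesquilinear_def)
    from frame_representation[OF this, of "e a"]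
    show "X (e a) (e a) = (\<Sum>k\<in>UNIV. \<Sum>l\<in>UNIV. 2 * ginv g Z k l * (H (e a) (zeta l) * X (zeta k) (e a)))"
      by (simp add: mult_ac)
  qed
  also have "\<dots> = (\<Sum>k\<in>UNIV. \<Sum>l\<in>UNIV. 2 * ginv g Z k l * (\<Sum>a\<in>Basis. H (e a) (zeta l) * X (zeta k) (e a)))"
    by (subst sum.swap, rule sum.cong[OF refl], subst sum.swap) (simp add: sum_distrib_left)
  also have "\<dots> = (\<Sum>k\<in>UNIV. \<Sum>l\<in>UNIV. 2 * ginv g Z k l * (2 * X (zeta k) (zeta l)))"
    using X by (intro sum.cong refl) (simp add: H_contract(2) sesquilinear_def)
  also have "\<dots> = 4 * (\<Sum>k\<in>UNIV. \<Sum>l\<in>UNIV. ginv g Z k l * X (zeta k) (zeta l))"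
    by (simp add: sum_distrib_left mult_ac)
  finally show ?thesis by simp
qed

end

context abelian_hermitian
begin

section \<open>Quadratic contractions of torsion and curvature\<close>

text \<open>If \<open>B\<^sub>y = \<beta>(\<cdot>, y)\<close>, then, up to factors 2, these are \<open>tr B\<^sub>x\<^sup>* B\<^sub>y\<close> and the forms of
  the operators \<open>\<Sum> B\<^sub>k\<^sup>* B\<^sub>k\<close> and \<open>\<Sum> B\<^sub>k B\<^sub>k\<^sup>*\<close> over a unitary frame.\<close>
definition right_gram :: "'a \<Rightarrow> 'a \<Rightarrow> complex" where
  "right_gram x y = (\<Sum>b\<in>Basis. H (\<beta> (e b) y) (\<beta> (e b) x))"

definition left_gram :: "'a \<Rightarrow> 'a \<Rightarrow> complex" where
  "left_gram x y = (\<Sum>b\<in>Basis. H (\<beta> x (e b)) (\<beta> y (e b)))"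

definition image_gram :: "'a \<Rightarrow> 'a \<Rightarrow> complex" where
  "image_gram x y = (\<Sum>a\<in>Basis. \<Sum>b\<in>Basis. H x (\<beta> (e a) (e b)) * H (\<beta> (e a) (e b)) y)"

lemma clinearI:
  assumes "\<And>x y. L (x + y) = L x + L y" "\<And>c x. L (c *\<^sub>R x) = c *\<^sub>R L x" "\<And>x. L (J x) = \<i> * L x"
  shows "clinear L"
  using assms by (auto simp: clinear_def intro!: linearI)

lemma antilinearI:
  assumes "\<And>x y. L (x + y) = L x + L y" "\<And>c x. L (c *\<^sub>R x) = c *\<^sub>R L x" "\<And>x. L (J x) = - (\<i> * L x)"
  shows "antilinear L"
  using assms by (auto simp: antilinear_def intro!: linearI)

lemma sesquilinearI:
  assumes "\<And>x y z. X (x + y) z = X x z + X y z" "\<And>c x z. X (c *\<^sub>R x) z = c *\<^sub>R X x z"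
    "\<And>x z. X (J x) z = \<i> * X x z"
    "\<And>x y z. X z (x + y) = X z x + X z y" "\<And>c x z. X z (c *\<^sub>R x) = c *\<^sub>R X z x"
    "\<And>x z. X z (J x) = - (\<i> * X z x)"
  shows "sesquilinear X"
  using assms by (auto simp: sesquilinear_def intro!: clinearI antilinearI)

lemma sesquilinear_simps:
  assumes "sesquilinear X"
  shows "X (x + y) w = X x w + X y w" "X w (x + y) = X w x + X w y"
    "X (c *\<^sub>R x) w = c *\<^sub>R X x w" "X w (c *\<^sub>R x) = c *\<^sub>R X w x"
    "X (J x) w = \<i> * X x w" "X w (J x) = - (\<i> * X w x)"
proof -
  have lin: "linear (\<lambda>x. X x w)" "linear (X w)"
    using assms by (auto simp: sesquilinear_def clinear_def antilinear_def)
  show "X (x + y) w = X x w + X y w" "X w (x + y) = X w x + X w y"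
    "X (c *\<^sub>R x) w = c *\<^sub>R X x w" "X w (c *\<^sub>R x) = c *\<^sub>R X w x"
    using linear_add[OF lin(1)] linear_add[OF lin(2)] linear_scale[OF lin(1)] linear_scale[OF lin(2)]
    by auto
qed (use assms in \<open>auto simp: sesquilinear_def clinear_def antilinear_def\<close>)

lemma lee_jacobi: "(\<Sum>b\<in>Basis. \<beta> (e b) (\<beta> (e b) x)) = \<beta> x lee"
  by (simp add: lee_def \<beta>_simps \<beta>_jacobi[of "e _" "e _" x])

lemma tor_simps:
  "tor (x + x') y w = tor x y w + tor x' y w" "tor x (y + y') w = tor x y w + tor x y' w"
  "tor x y (w + w') = tor x y w + tor x y w'"
  "tor (c *\<^sub>R x) y w = c *\<^sub>R tor x y w" "tor x (c *\<^sub>R y) w = c *\<^sub>R tor x y w"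
  "tor x y (c *\<^sub>R w) = c *\<^sub>R tor x y w"
  "tor (J x) y w = \<i> * tor x y w" "tor x (J y) w = \<i> * tor x y w"
  "tor x y (J w) = - (\<i> * tor x y w)"
  by (auto simp: tor_def H_simps \<beta>_simps J_simps algebra_simps)

lemma curv_simps:
  "curv (k + k') l x = curv k l x + curv k' l x" "curv k (l + l') x = curv k l x + curv k l' x"
  "curv k l (x + x') = curv k l x + curv k l x'"
  "curv (c *\<^sub>R k) l x = c *\<^sub>R curv k l x" "curv k (c *\<^sub>R l) x = c *\<^sub>R curv k l x"
  "curv k l (c *\<^sub>R x) = c *\<^sub>R curv k l x"
  "curv (J k) l x = J (curv k l x)" "curv k (J l) x = - J (curv k l x)"
  "curv k l (J x) = J (curv k l x)"
  by (auto simp: curv_def \<delta>_simps \<beta>_simps J_simps algebra_simps)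

text \<open>This is the contraction in \<open>Q\<^sup>1\<close>. Expanding gives four products. The outer ones are Gram forms;
  in each of the mixed ones, \<open>H_contract\<close> produces \<open>\<beta>(b, \<beta>(b, x))\<close>, which \<open>lee_jacobi\<close> sums.\<close>
lemma torsion_square_1:
  "(\<Sum>a\<in>Basis. \<Sum>b\<in>Basis. tor x (e a) (e b) * cnj (tor y (e a) (e b)))
    = 2 * right_gram x y - 2 * H (\<beta> x lee) y - 2 * H x (\<beta> y lee) + image_gram x y"
proof -
  have tor_prod: "tor x a b * cnj (tor y a b) = H a (\<beta> b x) * H (\<beta> b y) a - H a (\<beta> b x) * H (\<beta> b a) y
      - H x (\<beta> b a) * H (\<beta> b y) a + H x (\<beta> b a) * H (\<beta> b a) y" for a b
    by (simp add: tor_def cnj_H algebra_simps)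
  have 1: "(\<Sum>a\<in>Basis. H (e a) (\<beta> b x) * H (\<beta> b y) (e a)) = 2 * H (\<beta> b y) (\<beta> b x)" for b
    by (intro H_contract(2) antilinearI) (auto simp: H_simps)
  have 2: "(\<Sum>a\<in>Basis. H (e a) (\<beta> b x) * H (\<beta> b (e a)) y) = 2 * H (\<beta> b (\<beta> b x)) y" for b
    by (intro H_contract(2) antilinearI) (auto simp: H_simps \<beta>_simps)
  have 3: "(\<Sum>a\<in>Basis. H x (\<beta> b (e a)) * H (\<beta> b y) (e a)) = 2 * H x (\<beta> b (\<beta> b y))" for b
    using H_contract(1)[of "\<lambda>a. H x (\<beta> b a)" "\<beta> b y"]
    by (simp add: mult.commute clinearI H_simps \<beta>_simps)
  have "(\<Sum>a\<in>Basis. \<Sum>b\<in>Basis. tor x (e a) (e b) * cnj (tor y (e a) (e b)))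
      = (\<Sum>b\<in>Basis. \<Sum>a\<in>Basis. tor x (e a) (e b) * cnj (tor y (e a) (e b)))"
    by (rule sum.swap)
  also have "\<dots> = (\<Sum>b\<in>Basis. 2 * H (\<beta> (e b) y) (\<beta> (e b) x) - 2 * H (\<beta> (e b) (\<beta> (e b) x)) y
      - 2 * H x (\<beta> (e b) (\<beta> (e b) y))
      + (\<Sum>a\<in>Basis. H x (\<beta> (e b) (e a)) * H (\<beta> (e b) (e a)) y))"
    by (simp add: tor_prod sum.distrib sum_subtractf 1 2 3)
  also have "\<dots> = 2 * right_gram x y - 2 * H (\<Sum>b\<in>Basis. \<beta> (e b) (\<beta> (e b) x)) y
      - 2 * H x (\<Sum>b\<in>Basis. \<beta> (e b) (\<beta> (e b) y)) + image_gram x y"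
    by (simp add: right_gram_def image_gram_def sum.distrib sum_subtractf H_simps sum_distrib_left)
  finally show ?thesis by (simp add: lee_jacobi)
qed

text \<open>This is the contraction in \<open>Q\<^sup>2\<close>. Here the mixed products give \<open>\<beta>(x, \<beta>(y, a)) = \<beta>(a, \<beta>(y, x))\<close>,
  whose trace over \<open>a\<close> vanishes by unimodularity.\<close>
lemma torsion_square_2:
  "(\<Sum>a\<in>Basis. \<Sum>b\<in>Basis. cnj (tor (e a) (e b) x) * tor (e a) (e b) y) = 4 * left_gram x y"
proof -
  have tor_prod: "cnj (tor a b x) * tor a b y = H b (\<beta> y a) * H (\<beta> x a) b - H b (\<beta> y a) * H (\<beta> x b) a
      - H a (\<beta> y b) * H (\<beta> x a) b + H a (\<beta> y b) * H (\<beta> x b) a" for a b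
    by (simp add: tor_def cnj_H algebra_simps)
  have 1: "(\<Sum>b\<in>Basis. H (e b) (\<beta> y a) * H (\<beta> x a) (e b)) = 2 * H (\<beta> x a) (\<beta> y a)" for a
    by (intro H_contract(2) antilinearI) (auto simp: H_simps)
  have 2: "(\<Sum>b\<in>Basis. H (e b) (\<beta> y a) * H (\<beta> x (e b)) a) = 2 * H (\<beta> a (\<beta> y x)) a" for a
  proof -
    have "(\<Sum>b\<in>Basis. H (e b) (\<beta> y a) * H (\<beta> x (e b)) a) = 2 * H (\<beta> x (\<beta> y a)) a"
      by (intro H_contract(2) antilinearI) (auto simp: H_simps \<beta>_simps)
    then show ?thesis by (simp add: \<beta>_jacobi[of x])
  qed
  have s1: "(\<Sum>a\<in>Basis. \<Sum>b\<in>Basis. H (e b) (\<beta> y (e a)) * H (\<beta> x (e a)) (e b)) = 2 * left_gram x y"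
    by (simp add: 1 left_gram_def sum_distrib_left)
  have s2: "(\<Sum>a\<in>Basis. \<Sum>b\<in>Basis. H (e b) (\<beta> y (e a)) * H (\<beta> x (e b)) (e a)) = 0"
    by (simp add: 2 \<beta>_trace_H flip: sum_distrib_left)
  have s1': "(\<Sum>a\<in>Basis. \<Sum>b\<in>Basis. H (e a) (\<beta> y (e b)) * H (\<beta> x (e b)) (e a)) = 2 * left_gram x y"
    using s1 by (subst sum.swap) simp
  have s2': "(\<Sum>a\<in>Basis. \<Sum>b\<in>Basis. H (e a) (\<beta> y (e b)) * H (\<beta> x (e a)) (e b)) = 0"
    using s2 by (subst sum.swap) simp
  show ?thesis
    by (simp add: tor_prod sum.distrib sum_subtractf s1 s2 s1' s2')
qed

lemma torsion_trace: "(\<Sum>a\<in>Basis. tor x (e a) (e a)) = - H x lee"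
  by (simp add: tor_def lee_def H_simps sum_subtractf \<beta>_trace_H)

text \<open>This is the contraction in \<open>Q\<^sup>4\<close>, and \<open>torsion_trace\<close> provides the one in \<open>Q\<^sup>3\<close>.\<close>
lemma torsion_mixed:
  "(\<Sum>a\<in>Basis. \<Sum>b\<in>Basis. tor (e b) (e a) (e a) * cnj (tor (e b) y x)
      + cnj (tor (e b) (e a) (e a)) * tor (e b) x y)
    = - 2 * (cnj (tor lee y x) + tor lee x y)"
proof -
  have "(\<Sum>a\<in>Basis. \<Sum>b\<in>Basis. tor (e b) (e a) (e a) * cnj (tor (e b) y x)
      + cnj (tor (e b) (e a) (e a)) * tor (e b) x y)
    = (\<Sum>b\<in>Basis. (\<Sum>a\<in>Basis. tor (e b) (e a) (e a)) * cnj (tor (e b) y x)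
      + cnj (\<Sum>a\<in>Basis. tor (e b) (e a) (e a)) * tor (e b) x y)"
    by (subst sum.swap) (simp add: sum.distrib sum_distrib_right cnj_sum)
  also have "\<dots> = - (\<Sum>b\<in>Basis. H (e b) lee * cnj (tor (e b) y x)) - (\<Sum>b\<in>Basis. H lee (e b) * tor (e b) x y)"
    by (simp add: torsion_trace cnj_H sum.distrib sum_negf sum_subtractf)
  also have "(\<Sum>b\<in>Basis. H (e b) lee * cnj (tor (e b) y x)) = 2 * cnj (tor lee y x)"
    by (intro H_contract(2) antilinearI) (auto simp: tor_simps)
  also have "(\<Sum>b\<in>Basis. H lee (e b) * tor (e b) x y) = 2 * tor lee x y"
    by (intro H_contract(1) clinearI) (auto simp: tor_simps)
  finally show ?thesis by simp
qed

lemma curv_trace: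
  "(\<Sum>a\<in>Basis. H (curv (e a) (e a) x) y)
    = - left_gram x y + image_gram x y / 2 - H x (\<beta> y lee) - H (\<beta> x lee) y"
proof -
  have "(\<Sum>a\<in>Basis. H (\<beta> (\<delta> (e a) x) (e a)) y) = image_gram x y / 2"
  proof -
    have "2 * H (\<beta> (\<delta> a x) a) y = (\<Sum>b\<in>Basis. H x (\<beta> (e b) a) * H (\<beta> (e b) a) y)" for a
      using H_contract(1)[of "\<lambda>u. H (\<beta> u a) y" "\<delta> a x"]
      by (simp add: clinearI H_simps \<beta>_simps H_\<delta>)
    then have "2 * (\<Sum>a\<in>Basis. H (\<beta> (\<delta> (e a) x) (e a)) y)
        = (\<Sum>a\<in>Basis. \<Sum>b\<in>Basis. H x (\<beta> (e b) (e a)) * H (\<beta> (e b) (e a)) y)"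
      by (simp add: sum_distrib_left)
    also have "\<dots> = image_gram x y" unfolding image_gram_def by (rule sum.swap)
    finally show ?thesis by (simp add: mult.commute)
  qed
  then show ?thesis
    by (simp add: curv_def H_simps H_\<delta> sum.distrib sum_subtractf sum_negf left_gram_def lee_def \<beta>_simps)
qed

text \<open>The tensor \<open>K\<close> as a Hermitian form on the real Lie algebra (\<open>K_tensor_eq\<close>). The numerical factors
  in \<open>K_herm_formula\<close> combine those of \<open>contract_frame\<close>, \<open>TT_eq\<close> and \<open>chern_curv_eq\<close> with those of
  \<open>Q\<close>.\<close>
definition K_herm :: "'a \<Rightarrow> 'a \<Rightarrow> complex" where
  "K_herm x y = - (1/4) * left_gram x y - (1/4) * right_gram x y + (1/8) * image_gram x y - (1/4) * H x (\<beta> y lee)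
    - (1/4) * H (\<beta> x lee) y + (1/8) * H x lee * H lee y + (1/4) * (cnj (tor lee y x) + tor lee x y)"

lemma K_herm_formula:
  "K_herm x y = (\<Sum>a\<in>Basis. H (curv (e a) (e a) x) y) / 2
    - ((\<Sum>a\<in>Basis. \<Sum>b\<in>Basis. tor x (e a) (e b) * cnj (tor y (e a) (e b))) / 8
      - (\<Sum>a\<in>Basis. \<Sum>b\<in>Basis. cnj (tor (e a) (e b) x) * tor (e a) (e b) y) / 16
      - (\<Sum>a\<in>Basis. tor x (e a) (e a)) * cnj (\<Sum>b\<in>Basis. tor y (e b) (e b)) / 8
      + (\<Sum>a\<in>Basis. \<Sum>b\<in>Basis. tor (e b) (e a) (e a) * cnj (tor (e b) y x)
          + cnj (tor (e b) (e a) (e a)) * tor (e b) x y) / 8)"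
  by (simp only: curv_trace torsion_square_1 torsion_square_2 torsion_trace torsion_mixed K_herm_def)
    (simp add: cnj_H field_simps)

lemma sesquilinear_left_gram: "sesquilinear left_gram" and sesquilinear_right_gram: "sesquilinear right_gram"
  and sesquilinear_image_gram: "sesquilinear image_gram"
  by (rule sesquilinearI; simp add: left_gram_def right_gram_def image_gram_def H_simps \<beta>_simps algebra_simps sum.distrib
      scaleR_sum_right sum_distrib_left sum_negf)+

lemma sesquilinear_K_herm: "sesquilinear K_herm"
proof (rule sesquilinearI)
  note simps = H_simps \<beta>_simps J_simps tor_simps algebra_simps
  note s = sesquilinear_left_gram sesquilinear_right_gram sesquilinear_image_gram
  note add = s[THEN sesquilinear_simps(1)] s[THEN sesquilinear_simps(2)] s[THEN sesquilinear_simps(3)]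
    s[THEN sesquilinear_simps(4)] s[THEN sesquilinear_simps(5)] s[THEN sesquilinear_simps(6)]
  fix x y w c
  show "K_herm (x + y) w = K_herm x w + K_herm y w" "K_herm (c *\<^sub>R x) w = c *\<^sub>R K_herm x w" "K_herm (J x) w = \<i> * K_herm x w"
    "K_herm w (x + y) = K_herm w x + K_herm w y" "K_herm w (c *\<^sub>R x) = c *\<^sub>R K_herm w x" "K_herm w (J x) = - (\<i> * K_herm w x)"
    by (simp_all add: K_herm_def add simps)
qed


section \<open>The (1,1)-part of the Ricci tensor\<close>

text \<open>Since \<open>ad (J x) = - ad x J\<close>, the left hand side is the trace of \<open>ad x\<close> after \<open>\<beta>(y, \<cdot>)\<close>. The part
  of \<open>ad x\<close> that is complex linear leaves an antilinear map, without trace; the other part leaves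
  \<open>\<beta>(x, \<beta>(y, \<cdot>)) = \<beta>(\<cdot>, \<beta>(y, x))\<close>, without trace by unimodularity.\<close>
lemma killing_11: "killing x y + killing (J x) (J y) = 0"
proof -
  have "killing (J x) (J y) = (\<Sum>a\<in>Basis. g (br x (J (br y (J (e a))))) (e a))"
    by (simp add: killing_def br_J br_simps g_simps)
  then have "killing x y + killing (J x) (J y) = (\<Sum>a\<in>Basis. g (br x (\<beta> y (e a))) (e a))"
    by (simp add: killing_def \<beta>_def br_simps g_simps sum.distrib)
  also have "\<dots> = ((\<Sum>a\<in>Basis. g (\<beta> x (\<beta> y (e a))) (e a)) - (\<Sum>a\<in>Basis. g (\<beta> (\<beta> y (e a)) x) (e a))) / 2"
    by (simp add: br_\<beta> g_simps sum_subtractf diff_divide_distrib sum_divide_distrib)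
  also have "(\<Sum>a\<in>Basis. g (\<beta> x (\<beta> y (e a))) (e a)) = 0"
    by (simp add: \<beta>_jacobi[of x] \<beta>_trace)
  also have "(\<Sum>a\<in>Basis. g (\<beta> (\<beta> y (e a)) x) (e a)) = 0"
  proof -
    have "bilinear (\<lambda>u v. g (\<beta> (\<beta> y u) x) v)"
      by (intro bilinear_of_linear linearI) (auto simp: g_simps \<beta>_simps)
    from frame_sum_J[OF this] show ?thesis
      by (simp add: \<beta>_simps g_simps sum_negf)
  qed
  finally show ?thesis by simp
qed

text \<open>In \<open>ric_D\<close> and in the \<open>J\<close>-invariant part of \<open>ric_P\<close>, the products of two \<open>\<beta>\<close> with arguments in
  opposite order change their sign when \<open>J\<close> is applied to the frame, and so they sum to zero.\<close>
lemma ric_D_eq: "ric_D x y = Re (left_gram x y + right_gram x y) / 4"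
proof -
  have cross: "(\<Sum>a\<in>Basis. g (\<beta> x (e a)) (\<beta> (e a) y)) = 0" for x y
  proof -
    have "bilinear (\<lambda>u v. g (\<beta> x u) (\<beta> v y))"
      by (intro bilinear_of_linear linearI) (auto simp: g_simps \<beta>_simps)
    from frame_sum_J[OF this] show ?thesis
      by (simp add: \<beta>_simps g_simps sum_negf)
  qed
  have "g (br x a) (br y a) = (g (\<beta> x a) (\<beta> y a) + g (\<beta> a x) (\<beta> a y)
      - g (\<beta> x a) (\<beta> a y) - g (\<beta> y a) (\<beta> a x)) / 4" for a
    using g_sym[of "\<beta> a x" "\<beta> y a"] by (simp add: br_\<beta> g_simps field_simps)
  then have "ric_D x y = (\<Sum>a\<in>Basis. (g (\<beta> x (e a)) (\<beta> y (e a)) + g (\<beta> (e a) x) (\<beta> (e a) y)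
      - g (\<beta> x (e a)) (\<beta> (e a) y) - g (\<beta> y (e a)) (\<beta> (e a) x)) / 4)"
    by (simp only: ric_D_def)
  then have "ric_D x y = ((\<Sum>a\<in>Basis. g (\<beta> x (e a)) (\<beta> y (e a)))
      + (\<Sum>a\<in>Basis. g (\<beta> (e a) x) (\<beta> (e a) y))) / 4"
    by (simp add: sum.distrib sum_subtractf cross flip: sum_divide_distrib)
  then show ?thesis
    by (simp add: left_gram_def right_gram_def H_def Re_sum g_sym[of "\<beta> (e _) y"])
qed

lemma ric_P_eq: "ric_P x y + ric_P (J x) (J y) = Re (image_gram x y) / 2"
proof -
  let ?\<Sigma> = "\<lambda>f. (\<Sum>a\<in>Basis. \<Sum>b\<in>Basis. f (e a) (e b)) :: real"
  have shift: "?\<Sigma> (\<lambda>a b. f (J a) (J a) b) = ?\<Sigma> (\<lambda>a b. f a a b)"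
    if "\<And>b. bilinear (\<lambda>u v. f u v b)" for f :: "'a \<Rightarrow> 'a \<Rightarrow> 'a \<Rightarrow> real"
  proof -
    have "bilinear (\<lambda>u v. \<Sum>b\<in>Basis. f u v (e b))"
      using that by (intro bilinear_of_linear linearI)
        (auto simp: bilinear_simps[OF that] sum.distrib sum_distrib_left)
    from frame_sum_J[OF this] show ?thesis .
  qed
  have gJ: "g (J u) (J v) = g u v" "g u (J v) = - g (J u) v" for u v by (simp_all add: g_J g_simps)
  let ?q = "?\<Sigma> (\<lambda>a b. g (\<beta> a b) x * g (\<beta> a b) y)"
  have 1: "?\<Sigma> (\<lambda>a b. g (\<beta> a b) (J x) * g (\<beta> a b) (J y)) = ?q"
    using shift[of "\<lambda>u v b. g (\<beta> u b) x * g (\<beta> v b) y"]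
    by (simp add: gJ(2) bilinear_def linearI g_simps \<beta>_simps distrib_left distrib_right mult_ac)
  have 2: "?\<Sigma> (\<lambda>a b. g (\<beta> a b) (J x) * g (\<beta> b a) (J y)) = - ?\<Sigma> (\<lambda>a b. g (\<beta> a b) x * g (\<beta> b a) y)"
    for x y
    using shift[of "\<lambda>u v b. g (\<beta> u b) x * g (\<beta> b v) y"]
    by (simp add: gJ(2) bilinear_def linearI g_simps \<beta>_simps distrib_left distrib_right mult_ac sum_negf)
  have prod: "g (br a b) x * g (br a b) y = (g (\<beta> a b) x * g (\<beta> a b) y + g (\<beta> b a) x * g (\<beta> b a) y
      - g (\<beta> a b) x * g (\<beta> b a) y - g (\<beta> a b) y * g (\<beta> b a) x) / 4" for a b x y
    by (simp add: br_\<beta> g_simps field_simps)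
  have P: "ric_P x y = (2 * ?\<Sigma> (\<lambda>a b. g (\<beta> a b) x * g (\<beta> a b) y)
      - ?\<Sigma> (\<lambda>a b. g (\<beta> a b) x * g (\<beta> b a) y) - ?\<Sigma> (\<lambda>a b. g (\<beta> a b) y * g (\<beta> b a) x)) / 4" for x y
  proof -
    have "?\<Sigma> (\<lambda>a b. g (\<beta> b a) x * g (\<beta> b a) y) = ?\<Sigma> (\<lambda>a b. g (\<beta> a b) x * g (\<beta> a b) y)"
      by (rule sum.swap)
    then show ?thesis unfolding ric_P_def
      by (simp add: prod sum.distrib sum_subtractf flip: sum_divide_distrib)
  qed
  have "Re (image_gram x y) = 2 * ?q"
  proof -
    have "Re (H x v * H v y) = g v x * g v y + g v (J x) * g v (J y)" for v
      using g_sym[of x v] g_sym[of x "J v"] by (simp add: H_def g_J)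
    then have "Re (image_gram x y) = ?q + ?\<Sigma> (\<lambda>a b. g (\<beta> a b) (J x) * g (\<beta> a b) (J y))"
      by (simp add: image_gram_def Re_sum sum.distrib)
    then show ?thesis unfolding 1 by simp
  qed
  then show ?thesis unfolding P 1 2 by (simp add: field_simps)
qed

lemma Ric11_eq: "Ric11 br J g x y = Re (- (1/8) * left_gram x y - (1/8) * right_gram x y + (1/16) * image_gram x y)"
proof -
  note G = sesquilinear_simps[OF sesquilinear_left_gram] and E = sesquilinear_simps[OF sesquilinear_right_gram]
  have "ric_D (J x) (J y) = ric_D x y" by (simp add: ric_D_eq G E)
  moreover have "killing y x + killing (J y) (J x) = 0" by (rule killing_11)
  ultimately show ?thesis
    using ric_P_eq[of x y] by (simp add: Ric11_def Ric_formula ric_D_eq field_simps)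
qed

lemma bilinear_Ric: "bilinear (Ric br g)"
  by (intro bilinear_of_linear linearI)
    (auto simp: Ric_formula killing_def ric_D_def ric_P_def br_simps g_simps sum.distrib
      sum_distrib_left sum_negf algebra_simps diff_divide_distrib add_divide_distrib)

text \<open>By \<open>ext_form_Ric\<close>, the Ricci tensor on \<open>(1,0)\<close>- and \<open>(0,1)\<close>-vectors; mixed components only see
  the \<open>(1,1)\<close>-part.\<close>
definition ricci_herm :: "'a \<Rightarrow> 'a \<Rightarrow> complex" where
  "ricci_herm x y = - (1/4) * left_gram x y - (1/4) * right_gram x y + (1/8) * image_gram x y"

lemma sesquilinear_ricci_herm: "sesquilinear ricci_herm"
  by (rule sesquilinearI)
    (simp_all add: ricci_herm_def sesquilinear_simps[OF sesquilinear_left_gram] sesquilinear_simps[OF sesquilinear_right_gram]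
      sesquilinear_simps[OF sesquilinear_image_gram] algebra_simps)

lemma Ric11_ricci_herm: "Ric11 br J g x y = Re (ricci_herm x y) / 2"
  by (simp add: Ric11_eq ricci_herm_def)

lemma ext_form_Ric:
  "ext_form (Ric br g) (g10_vector J x) (cpx_cnj (g10_vector J y)) = ricci_herm x y" (is ?Ric)
  "ext_form (Ric11 br J g) (g10_vector J x) (cpx_cnj (g10_vector J y)) = ricci_herm x y" (is ?Ric11)
proof -
  note R = sesquilinear_simps[OF sesquilinear_ricci_herm] and b = bilinear_simps[OF bilinear_Ric]
  have "bilinear (Ric11 br J g)"
    by (intro bilinear_of_linear linearI) (auto simp: Ric11_ricci_herm R add_divide_distrib)
  then show ?Ric11
    by (simp add: ext_form_g10 Ric11_ricci_herm R complex_eq_iff)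
  have "Ric br g x y + Ric br g (J x) (J y) = Re (ricci_herm x y)" for x y
    using Ric11_ricci_herm[of x y] by (simp add: Ric11_def)
  from this[of x y] this[of x "J y"] show ?Ric
    by (simp add: ext_form_g10[OF bilinear_Ric] R complex_eq_iff b)
qed

definition beta_norm2 :: real where
  "beta_norm2 = (\<Sum>a\<in>Basis. \<Sum>b\<in>Basis. g (\<beta> (e a) (e b)) (\<beta> (e a) (e b)))"

lemma frame_traces:
  "(\<Sum>a\<in>Basis. left_gram (e a) (e a)) = of_real beta_norm2" "(\<Sum>a\<in>Basis. right_gram (e a) (e a)) = of_real beta_norm2"
  "(\<Sum>a\<in>Basis. image_gram (e a) (e a)) = 2 * of_real beta_norm2"
proof -
  show "(\<Sum>a\<in>Basis. left_gram (e a) (e a)) = of_real beta_norm2" by (simp add: left_gram_def beta_norm2_def H_self)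
  show "(\<Sum>a\<in>Basis. right_gram (e a) (e a)) = of_real beta_norm2"
    unfolding right_gram_def by (subst sum.swap) (simp add: beta_norm2_def H_self)
  have *: "(\<Sum>c\<in>Basis. H (e c) v * H v (e c)) = 2 * of_real (g v v)" for v
    using H_contract(2)[of "H v" v] by (simp add: antilinearI H_simps H_self)
  have "(\<Sum>c\<in>Basis. image_gram (e c) (e c))
      = (\<Sum>a\<in>Basis. \<Sum>b\<in>Basis. \<Sum>c\<in>Basis. H (e c) (\<beta> (e a) (e b)) * H (\<beta> (e a) (e b)) (e c))"
    unfolding image_gram_def by (subst sum.swap, rule sum.cong[OF refl], rule sum.swap)
  then show "(\<Sum>a\<in>Basis. image_gram (e a) (e a)) = 2 * of_real beta_norm2"
    by (simp add: * beta_norm2_def sum_distrib_left)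
qed

lemma ricci_herm_trace: "(\<Sum>a\<in>Basis. ricci_herm (e a) (e a)) = - of_real beta_norm2 / 4"
  by (simp add: ricci_herm_def sum.distrib sum_subtractf sum_negf frame_traces flip: sum_divide_distrib)

text \<open>The terms linear in \<open>\<beta>(\<cdot>, lee)\<close> have no trace. The term from \<open>Q\<^sup>3\<close> contributes \<open>+ 1/4\<close> and the
  one from \<open>Q\<^sup>4\<close> contributes \<open>- 1/2\<close> times \<open>g(lee, lee)\<close>; as these do not cancel, the trace detects
  \<open>lee\<close>.\<close>
lemma K_herm_trace: "(\<Sum>a\<in>Basis. K_herm (e a) (e a)) = - of_real beta_norm2 / 4 - of_real (g lee lee) / 4"
proof -
  have tor: "(\<Sum>a\<in>Basis. tor lee (e a) (e a)) = - of_real (g lee lee)"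
    by (simp add: torsion_trace H_self)
  then have tor': "(\<Sum>a\<in>Basis. cnj (tor lee (e a) (e a))) = - of_real (g lee lee)"
    by (metis cnj_sum complex_cnj_complex_of_real complex_cnj_minus)
  have H2: "(\<Sum>c\<in>Basis. H (e c) lee * H lee (e c)) = 2 * of_real (g lee lee)"
    using H_contract(2)[of "H lee" lee] by (simp add: antilinearI H_simps H_self)
  have K_herm: "K_herm x y = ricci_herm x y - (1/4) * H x (\<beta> y lee) - (1/4) * H (\<beta> x lee) y
      + (1/8) * (H x lee * H lee y) + (1/4) * cnj (tor lee y x) + (1/4) * tor lee x y" for x y
    by (simp add: K_herm_def ricci_herm_def field_simps)
  show ?thesis
    unfolding K_herm
    by (simp only: sum.distrib sum_subtractf ricci_herm_trace \<beta>_trace_H H2 tor tor' flip: sum_distrib_left)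
      simp
qed

lemma K_herm_balanced: "lee = 0 \<Longrightarrow> K_herm x y = ricci_herm x y"
  using tor_simps(4)[of 0] by (simp add: K_herm_def ricci_herm_def H_simps \<beta>_simps tor_def)

end

context abelian_hermitian_frame
begin

section \<open>Comparison of \<open>K\<close> with the Ricci tensor\<close>

lemma K_tensor_eq: "K_tensor br J g Z i j = K_herm (zeta i) (zeta j)"
proof -
  have S: "S_tensor br J g Z i j = (\<Sum>a\<in>Basis. H (curv (e a) (e a) (zeta i)) (zeta j)) / 2"
  proof -
    have "sesquilinear (\<lambda>k l. H (curv k l (zeta i)) (zeta j))"
      by (intro sesquilinearI) (auto simp: curv_simps H_simps)
    from contract_frame[OF this] show ?thesis
      by (simp add: S_tensor_def chern_curv_eq mult.left_commute mult.commute[of 4]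
          flip: sum_distrib_left)
  qed
  have inner: "(\<Sum>m\<in>UNIV. \<Sum>n\<in>UNIV. c * ginv g Z m n * X (zeta m) (zeta n))
      = c * (\<Sum>b\<in>Basis. X (e b) (e b)) / 4" if "sesquilinear X" for c X
    using contract_frame[OF that] by (simp add: mult.assoc flip: sum_distrib_left)
  have Q1: "Q1 br J g Z i j
      = (\<Sum>a\<in>Basis. \<Sum>b\<in>Basis. tor (zeta i) (e a) (e b) * cnj (tor (zeta j) (e a) (e b))) / 4"
  proof -
    have s: "sesquilinear (\<lambda>m n. tor (zeta i) u n * cnj (tor (zeta j) v m))" for u v
      by (intro sesquilinearI) (auto simp: tor_simps algebra_simps)
    have s': "sesquilinear (\<lambda>k l. \<Sum>b\<in>Basis. tor (zeta i) k (e b) * cnj (tor (zeta j) l (e b)))"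
      by (intro sesquilinearI)
        (auto simp: tor_simps algebra_simps sum.distrib scaleR_sum_right sum_distrib_left sum_negf)
    have "Q1 br J g Z i j = 4 * (\<Sum>k\<in>UNIV. \<Sum>l\<in>UNIV. \<Sum>m\<in>UNIV. \<Sum>n\<in>UNIV.
        ginv g Z k l * ginv g Z m n * (tor (zeta i) (zeta k) (zeta n) * cnj (tor (zeta j) (zeta l) (zeta m))))"
      by (simp add: Q1_def TT_eq TTb_def sum_distrib_left mult_ac)
    then show ?thesis by (simp add: inner[OF s] contract_frame[OF s'] flip: sum_divide_distrib)
  qed
  have Q2: "Q2 br J g Z i j
      = (\<Sum>a\<in>Basis. \<Sum>b\<in>Basis. cnj (tor (e a) (e b) (zeta i)) * tor (e a) (e b) (zeta j)) / 4"
  proof -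
    have s: "sesquilinear (\<lambda>m n. cnj (tor v n (zeta i)) * tor u m (zeta j))" for u v
      by (intro sesquilinearI) (auto simp: tor_simps algebra_simps)
    have s': "sesquilinear (\<lambda>k l. \<Sum>b\<in>Basis. cnj (tor l (e b) (zeta i)) * tor k (e b) (zeta j))"
      by (intro sesquilinearI)
        (auto simp: tor_simps algebra_simps sum.distrib scaleR_sum_right sum_distrib_left sum_negf)
    have "Q2 br J g Z i j = 4 * (\<Sum>k\<in>UNIV. \<Sum>l\<in>UNIV. \<Sum>m\<in>UNIV. \<Sum>n\<in>UNIV.
        ginv g Z k l * ginv g Z m n * (cnj (tor (zeta l) (zeta n) (zeta i)) * tor (zeta k) (zeta m) (zeta j)))"
      by (simp add: Q2_def TT_eq TTb_def sum_distrib_left mult_ac)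
    then show ?thesis by (simp add: inner[OF s] contract_frame[OF s'] flip: sum_divide_distrib)
  qed
  have Q3: "Q3 br J g Z i j
      = (\<Sum>a\<in>Basis. tor (zeta i) (e a) (e a)) * cnj (\<Sum>b\<in>Basis. tor (zeta j) (e b) (e b)) / 4"
  proof -
    have s: "sesquilinear (\<lambda>m n. tor (zeta i) u v * cnj (tor (zeta j) n m))" for u v
      by (intro sesquilinearI) (auto simp: tor_simps algebra_simps)
    have s': "sesquilinear (\<lambda>k l. \<Sum>b\<in>Basis. tor (zeta i) k l * cnj (tor (zeta j) (e b) (e b)))"
      by (intro sesquilinearI)
        (auto simp: tor_simps algebra_simps sum.distrib scaleR_sum_right sum_distrib_left sum_negf)
    have "Q3 br J g Z i j = 4 * (\<Sum>k\<in>UNIV. \<Sum>l\<in>UNIV. \<Sum>m\<in>UNIV. \<Sum>n\<in>UNIV.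
        ginv g Z k l * ginv g Z m n * (tor (zeta i) (zeta k) (zeta l) * cnj (tor (zeta j) (zeta n) (zeta m))))"
      by (simp add: Q3_def TT_eq TTb_def sum_distrib_left mult_ac)
    then show ?thesis
      by (simp add: inner[OF s] contract_frame[OF s'] sum_product cnj_sum flip: sum_divide_distrib)
  qed
  have Q4: "Q4 br J g Z i j
      = (\<Sum>a\<in>Basis. \<Sum>b\<in>Basis. tor (e b) (e a) (e a) * cnj (tor (e b) (zeta j) (zeta i))
          + cnj (tor (e b) (e a) (e a)) * tor (e b) (zeta i) (zeta j)) / 8"
  proof -
    have s: "sesquilinear (\<lambda>m n. tor m u v * cnj (tor n (zeta j) (zeta i)) + cnj (tor n v u) * tor m (zeta i) (zeta j))"
      for u v
      by (intro sesquilinearI) (auto simp: tor_simps algebra_simps)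
    have s': "sesquilinear (\<lambda>k l. \<Sum>b\<in>Basis. tor (e b) k l * cnj (tor (e b) (zeta j) (zeta i))
        + cnj (tor (e b) l k) * tor (e b) (zeta i) (zeta j))"
      by (intro sesquilinearI)
        (auto simp: tor_simps algebra_simps sum.distrib scaleR_sum_right sum_distrib_left sum_negf sum_subtractf)
    have "Q4 br J g Z i j = 2 * (\<Sum>k\<in>UNIV. \<Sum>l\<in>UNIV. \<Sum>m\<in>UNIV. \<Sum>n\<in>UNIV.
        ginv g Z k l * ginv g Z m n * (tor (zeta m) (zeta k) (zeta l) * cnj (tor (zeta n) (zeta j) (zeta i))
          + cnj (tor (zeta n) (zeta l) (zeta k)) * tor (zeta m) (zeta i) (zeta j)))"
      by (simp add: Q4_def TT_eq TTb_def sum_distrib_left algebra_simps)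
    then show ?thesis by (simp add: inner[OF s] contract_frame[OF s'] flip: sum_divide_distrib)
  qed
  show ?thesis
    unfolding K_tensor_def S Q1 Q2 Q3 Q4 K_herm_formula by simp
qed

lemma tr_herm_eq:
  assumes "sesquilinear X" "\<And>i j. h i j = X (zeta i) (zeta j)"
  shows "tr_herm g Z h = (\<Sum>a\<in>Basis. X (e a) (e a)) / 4"
  unfolding tr_herm_def using contract_frame[OF assms(1)] by (simp add: assms(2))

lemma hcomp_Ric:
  "hcomp (Ric br g) Z i j = ricci_herm (zeta i) (zeta j)" "hcomp (Ric11 br J g) Z i j = ricci_herm (zeta i) (zeta j)"
  by (simp_all add: hcomp_def Z_eq ext_form_Ric)

theorem balanced_iff_trace:
  "balanced br J g \<longleftrightarrow> tr_herm g Z (K_tensor br J g Z) = tr_herm g Z (hcomp (Ric br g) Z)"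
proof -
  have "tr_herm g Z (K_tensor br J g Z) = tr_herm g Z (hcomp (Ric br g) Z) \<longleftrightarrow>
      (\<Sum>a\<in>Basis. K_herm (e a) (e a)) = (\<Sum>a\<in>Basis. ricci_herm (e a) (e a))"
    by (simp add: tr_herm_eq[OF sesquilinear_K_herm K_tensor_eq] tr_herm_eq[OF sesquilinear_ricci_herm hcomp_Ric(1)])
  also have "\<dots> \<longleftrightarrow> g lee lee = 0" by (simp add: K_herm_trace ricci_herm_trace)
  also have "\<dots> \<longleftrightarrow> lee = 0" by (metis g_pos g_simps(9) less_irrefl)
  finally show ?thesis by (simp add: balanced_iff)
qed

theorem balanced_K_tensor_eq_Ric11:
  "balanced br J g \<Longrightarrow> K_tensor br J g Z i j = hcomp (Ric11 br J g) Z i j"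
  by (simp add: balanced_iff K_tensor_eq hcomp_Ric K_herm_balanced)

end

context abelian_hermitian
begin

section \<open>The flow by the (1,1)-part of the Ricci tensor\<close>

text \<open>From here on the metric \<open>g\<close> and its frame are fixed, and a variable bracket \<open>\<mu>\<close> takes the place
  of a variable metric. The form \<open>moment\<close> is the Ricci tensor of \<open>\<mu>\<close> without its Killing part. It is
  a multiple of the moment map for the action of the general linear group on brackets, which is why
  it governs the variation of the norm of \<open>\<mu>\<close>.\<close>
definition flow_D :: "('a \<Rightarrow> 'a \<Rightarrow> 'a) \<Rightarrow> 'a \<Rightarrow> 'a \<Rightarrow> real" where
  "flow_D \<mu> x y = (\<Sum>a\<in>Basis. g (\<mu> x (e a)) (\<mu> y (e a)))"

definition flow_P :: "('a \<Rightarrow> 'a \<Rightarrow> 'a) \<Rightarrow> 'a \<Rightarrow> 'a \<Rightarrow> real" where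
  "flow_P \<mu> x y = (\<Sum>a\<in>Basis. \<Sum>b\<in>Basis. g (\<mu> (e a) (e b)) x * g (\<mu> (e a) (e b)) y)"

definition moment :: "('a \<Rightarrow> 'a \<Rightarrow> 'a) \<Rightarrow> 'a \<Rightarrow> 'a \<Rightarrow> real" where
  "moment \<mu> x y = flow_P \<mu> x y / 4 - flow_D \<mu> x y / 2"

definition moment11 :: "('a \<Rightarrow> 'a \<Rightarrow> 'a) \<Rightarrow> 'a \<Rightarrow> 'a \<Rightarrow> real" where
  "moment11 \<mu> x y = (moment \<mu> x y + moment \<mu> (J x) (J y)) / 2"

definition bracket_norm2 :: "('a \<Rightarrow> 'a \<Rightarrow> 'a) \<Rightarrow> real" where
  "bracket_norm2 \<mu> = (\<Sum>a\<in>Basis. \<Sum>b\<in>Basis. g (\<mu> (e a) (e b)) (\<mu> (e a) (e b)))"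

definition pairing :: "('a \<Rightarrow> 'a \<Rightarrow> real) \<Rightarrow> ('a \<Rightarrow> 'a \<Rightarrow> real) \<Rightarrow> real" where
  "pairing X Y = (\<Sum>c\<in>Basis. \<Sum>b\<in>Basis. X (e c) (e b) * Y (e c) (e b))"

lemma pairing_J:
  assumes X: "bilinear X" and Y: "bilinear Y"
  shows "pairing (\<lambda>x y. X (J x) (J y)) (\<lambda>x y. Y (J x) (J y)) = pairing X Y"
proof -
  note s = bilinear_simps[OF X] bilinear_simps[OF Y]
  have 1: "(\<Sum>b\<in>Basis. X u (J (e b)) * Y v (J (e b))) = (\<Sum>b\<in>Basis. X u (e b) * Y v (e b))" for u v
  proof -
    have "bilinear (\<lambda>p q. X u p * Y v q)"
      by (intro bilinear_of_linear linearI) (auto simp: s algebra_simps)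
    from frame_sum_J[OF this] show ?thesis .
  qed
  have "bilinear (\<lambda>p q. \<Sum>b\<in>Basis. X p (e b) * Y q (e b))"
    by (intro bilinear_of_linear linearI) (auto simp: s algebra_simps sum.distrib sum_distrib_left)
  from frame_sum_J[OF this] show ?thesis
    by (simp add: pairing_def 1)
qed

lemma pairing_add: "pairing X (\<lambda>x y. (Y x y + Y' x y) / 2) = (pairing X Y + pairing X Y') / 2"
  by (simp add: pairing_def sum.distrib algebra_simps add_divide_distrib sum_divide_distrib)

lemma bilinear_expansion:
  assumes "bilinear B"
  shows "(\<Sum>c\<in>Basis. \<Sum>b\<in>Basis. B (e c) (e b) * (g u (e c) * g v (e b))) = (B u v :: real)"
proof -
  have lin: "linear (B x)" "linear (\<lambda>x. B x y)" for x y using assms by (auto simp: bilinear_def)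
  have "(\<Sum>b\<in>Basis. B (e c) (e b) * (g u (e c) * g v (e b))) = g u (e c) * B (e c) v" for c
    using contract_real(1)[OF lin(1)[of "e c"], of v]
    by (simp add: mult_ac sum_distrib_left) (simp add: mult_ac flip: sum_distrib_left)
  then show ?thesis using contract_real(1)[OF lin(2)[of v], of u] by simp
qed

lemma bilinear_flow:
  assumes "bilinear \<mu>"
  shows "bilinear (flow_D \<mu>)" "bilinear (flow_P \<mu>)" "bilinear (moment \<mu>)" "bilinear (moment11 \<mu>)"
proof -
  note s = bilinear_simps[OF assms] g_simps
  show D: "bilinear (flow_D \<mu>)" and P: "bilinear (flow_P \<mu>)"
    by (intro bilinear_of_linear linearI;
        simp add: flow_D_def flow_P_def s algebra_simps sum.distrib sum_distrib_left)+
  show M: "bilinear (moment \<mu>)"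
    by (intro bilinear_of_linear linearI)
      (auto simp: moment_def bilinear_simps[OF D] bilinear_simps[OF P] field_simps)
  show "bilinear (moment11 \<mu>)"
    by (intro bilinear_of_linear linearI)
      (auto simp: moment11_def bilinear_simps[OF M] J_simps field_simps)
qed

lemma moment11_J: "bilinear \<mu> \<Longrightarrow> moment11 \<mu> (J x) (J y) = moment11 \<mu> x y"
  by (simp add: moment11_def bilinear_simps[OF bilinear_flow(3)])

lemma flow_sym: "flow_D \<mu> x y = flow_D \<mu> y x" "flow_P \<mu> x y = flow_P \<mu> y x"
  "moment11 \<mu> x y = moment11 \<mu> y x"
proof -
  show D: "flow_D \<mu> x y = flow_D \<mu> y x" and P: "flow_P \<mu> x y = flow_P \<mu> y x" for x y
    by (simp_all add: flow_D_def flow_P_def g_sym[of "\<mu> x _"] mult.commute)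
  show "moment11 \<mu> x y = moment11 \<mu> y x"
    by (simp add: moment11_def moment_def D[of x y] P[of x y] D[of "J x"] P[of "J x"])
qed

text \<open>Taking the \<open>J\<close>-invariant part is an orthogonal projection.\<close>
lemma pairing_moment11:
  assumes "bilinear \<mu>"
  shows "pairing (moment11 \<mu>) (moment \<mu>) = pairing (moment11 \<mu>) (moment11 \<mu>)"
proof -
  note b = bilinear_flow[OF assms]
  have "pairing (moment11 \<mu>) (\<lambda>x y. moment \<mu> (J x) (J y)) = pairing (moment11 \<mu>) (moment \<mu>)"
    using pairing_J[OF b(4) b(3)] by (simp add: moment11_J[OF assms])
  then show ?thesis
    using pairing_add[of "moment11 \<mu>" "moment \<mu>" "\<lambda>x y. moment \<mu> (J x) (J y)"]
    by (simp add: moment11_def[abs_def])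
qed

lemma psd_form_bound:
  fixes B :: "'a \<Rightarrow> 'a \<Rightarrow> real"
  assumes "bilinear B" "\<And>x y. B x y = B y x" "\<And>x. B x x \<ge> 0"
  shows "\<bar>B x y\<bar> \<le> (B x x + B y y) / 2"
  using assms(3)[of "x + y"] assms(3)[of "x - y"] assms(2)[of y x]
  by (simp add: bilinear_simps[OF assms(1)] abs_le_iff)

lemma flow_traces:
  "(\<Sum>c\<in>Basis. flow_D \<mu> (e c) (e c)) = bracket_norm2 \<mu>"
  "(\<Sum>c\<in>Basis. flow_P \<mu> (e c) (e c)) = bracket_norm2 \<mu>"
proof -
  show "(\<Sum>c\<in>Basis. flow_D \<mu> (e c) (e c)) = bracket_norm2 \<mu>"
    by (simp add: flow_D_def bracket_norm2_def)
  have "(\<Sum>c\<in>Basis. flow_P \<mu> (e c) (e c)) = (\<Sum>a\<in>Basis. \<Sum>b\<in>Basis. \<Sum>c\<in>Basis.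
      g (\<mu> (e a) (e b)) (e c) * g (\<mu> (e a) (e b)) (e c))"
    unfolding flow_P_def by (subst sum.swap, rule sum.cong[OF refl], rule sum.swap)
  then show "(\<Sum>c\<in>Basis. flow_P \<mu> (e c) (e c)) = bracket_norm2 \<mu>"
    by (simp add: parseval bracket_norm2_def)
qed

text \<open>Both \<open>flow_D\<close> and \<open>flow_P\<close> are positive semidefinite with trace \<open>bracket_norm2\<close>.\<close>
lemma moment11_bound:
  assumes "bilinear \<mu>" "b \<in> Basis" "c \<in> Basis"
  shows "\<bar>moment11 \<mu> (e c) (e b)\<bar> \<le> bracket_norm2 \<mu>"
proof -
  have form: "\<bar>B (e c) (e b)\<bar> \<le> bracket_norm2 \<mu>" "\<bar>B (J (e c)) (J (e b))\<bar> \<le> bracket_norm2 \<mu>"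
    if B: "bilinear B" "\<And>x y. B x y = B y x" "\<And>x. B x x \<ge> 0"
      and tr: "(\<Sum>c\<in>Basis. B (e c) (e c)) = bracket_norm2 \<mu>" for B :: "'a \<Rightarrow> 'a \<Rightarrow> real"
  proof -
    have "B (e d) (e d) \<le> bracket_norm2 \<mu>" if "d \<in> Basis" for d
      unfolding tr[symmetric] using that B(3) by (intro member_le_sum) auto
    note diag = this
    have "B (J (e d)) (J (e d)) \<le> bracket_norm2 \<mu>" if "d \<in> Basis" for d
      unfolding tr[symmetric] frame_sum_J[OF B(1), symmetric]
      using that B(3) by (intro member_le_sum[of d Basis "\<lambda>d. B (J (e d)) (J (e d))"]) auto
    note diag_J = this
    show "\<bar>B (e c) (e b)\<bar> \<le> bracket_norm2 \<mu>"
      by (rule order_trans[OF psd_form_bound[OF B]])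
        (use diag[OF assms(2)] diag[OF assms(3)] in \<open>simp add: field_simps\<close>)
    show "\<bar>B (J (e c)) (J (e b))\<bar> \<le> bracket_norm2 \<mu>"
      by (rule order_trans[OF psd_form_bound[OF B]])
        (use diag_J[OF assms(2)] diag_J[OF assms(3)] in \<open>simp add: field_simps\<close>)
  qed
  note bl = bilinear_flow[OF assms(1)]
  have "flow_D \<mu> x x \<ge> 0" "flow_P \<mu> x x \<ge> 0" for x
    by (auto simp: flow_D_def flow_P_def intro!: sum_nonneg g_nonneg)
  then have "\<bar>flow_D \<mu> (e c) (e b)\<bar> \<le> bracket_norm2 \<mu>" "\<bar>flow_D \<mu> (J (e c)) (J (e b))\<bar> \<le> bracket_norm2 \<mu>"
    "\<bar>flow_P \<mu> (e c) (e b)\<bar> \<le> bracket_norm2 \<mu>" "\<bar>flow_P \<mu> (J (e c)) (J (e b))\<bar> \<le> bracket_norm2 \<mu>"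
    using form[OF bl(1) flow_sym(1) _ flow_traces(1)] form[OF bl(2) flow_sym(2) _ flow_traces(2)]
    by auto
  then show ?thesis unfolding moment11_def moment_def by (auto simp: abs_le_iff field_simps)
qed

text \<open>The vector inside \<open>g\<close> is the derivative of \<open>\<mu>\<close> under the infinitesimal change of frame \<open>- R / 2\<close>.
  Its first term pairs \<open>R\<close> with \<open>flow_P\<close> and each of the others pairs \<open>R\<close> with \<open>flow_D\<close>, so that
  together they give the pairing of \<open>R\<close> with \<open>moment\<close>.\<close>
lemma bracket_norm2_variation:
  assumes bil: "bilinear \<mu>" and anti: "\<And>x y. \<mu> x y = - \<mu> y x"
    and R: "\<And>x y. g (R x) y = moment11 \<mu> x y"
  shows "(\<Sum>a\<in>Basis. \<Sum>b\<in>Basis. 2 * g (- (1/2) *\<^sub>R R (\<mu> (e a) (e b)) + (1/2) *\<^sub>R \<mu> (R (e a)) (e b)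
      + (1/2) *\<^sub>R \<mu> (e a) (R (e b))) (\<mu> (e a) (e b)))
    = - 4 * pairing (moment11 \<mu>) (moment11 \<mu>)"
proof -
  let ?M = "moment11 \<mu>"
  note s = bilinear_simps[OF bil]
  note bl = bilinear_flow[OF bil]
  have "(\<Sum>a\<in>Basis. \<Sum>b\<in>Basis. g (R (\<mu> (e a) (e b))) (\<mu> (e a) (e b)))
      = (\<Sum>a\<in>Basis. \<Sum>b\<in>Basis. \<Sum>c\<in>Basis. \<Sum>d\<in>Basis. ?M (e c) (e d) *
          (g (\<mu> (e a) (e b)) (e c) * g (\<mu> (e a) (e b)) (e d)))"
    by (simp add: R bilinear_expansion[OF bl(4)])
  also have "\<dots> = (\<Sum>a\<in>Basis. \<Sum>c\<in>Basis. \<Sum>d\<in>Basis. \<Sum>b\<in>Basis. ?M (e c) (e d) *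
          (g (\<mu> (e a) (e b)) (e c) * g (\<mu> (e a) (e b)) (e d)))"
    by (rule sum.cong[OF refl], subst sum.swap, rule sum.cong[OF refl], rule sum.swap)
  also have "\<dots> = (\<Sum>c\<in>Basis. \<Sum>d\<in>Basis. \<Sum>a\<in>Basis. \<Sum>b\<in>Basis. ?M (e c) (e d) *
          (g (\<mu> (e a) (e b)) (e c) * g (\<mu> (e a) (e b)) (e d)))"
    by (subst sum.swap, rule sum.cong[OF refl], rule sum.swap)
  also have "\<dots> = pairing ?M (flow_P \<mu>)"
    by (simp add: pairing_def flow_P_def sum_distrib_left)
  finally have 1: "(\<Sum>a\<in>Basis. \<Sum>b\<in>Basis. g (R (\<mu> (e a) (e b))) (\<mu> (e a) (e b))) = pairing ?M (flow_P \<mu>)" .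
  have Re: "R x = (\<Sum>c\<in>Basis. ?M x (e c) *\<^sub>R e c)" for x
    using frame_expansion[of "R x"] by (simp add: R)
  have "(\<Sum>b\<in>Basis. g (\<mu> (R (e a)) (e b)) (\<mu> (e a) (e b)))
      = (\<Sum>c\<in>Basis. ?M (e a) (e c) * flow_D \<mu> (e a) (e c))" for a
    unfolding flow_D_def sum_distrib_left
    by (subst sum.swap) (simp add: Re s g_simps g_sym[of "\<mu> (e a) _"])
  then have 2: "(\<Sum>a\<in>Basis. \<Sum>b\<in>Basis. g (\<mu> (R (e a)) (e b)) (\<mu> (e a) (e b))) = pairing ?M (flow_D \<mu>)"
    by (simp add: pairing_def)
  have "g (\<mu> (e a) (R (e b))) (\<mu> (e a) (e b)) = g (\<mu> (R (e b)) (e a)) (\<mu> (e b) (e a))" for a b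
    using anti[of "e a"] by (simp add: g_simps)
  then have "(\<Sum>a\<in>Basis. \<Sum>b\<in>Basis. g (\<mu> (e a) (R (e b))) (\<mu> (e a) (e b)))
      = (\<Sum>a\<in>Basis. \<Sum>b\<in>Basis. g (\<mu> (R (e b)) (e a)) (\<mu> (e b) (e a)))" by simp
  also have "\<dots> = pairing ?M (flow_D \<mu>)" unfolding 2[symmetric] by (rule sum.swap)
  finally have 3: "(\<Sum>a\<in>Basis. \<Sum>b\<in>Basis. g (\<mu> (e a) (R (e b))) (\<mu> (e a) (e b))) = pairing ?M (flow_D \<mu>)" .
  have "(\<Sum>a\<in>Basis. \<Sum>b\<in>Basis. 2 * g (- (1/2) *\<^sub>R R (\<mu> (e a) (e b)) + (1/2) *\<^sub>R \<mu> (R (e a)) (e b)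
      + (1/2) *\<^sub>R \<mu> (e a) (R (e b))) (\<mu> (e a) (e b)))
    = - (\<Sum>a\<in>Basis. \<Sum>b\<in>Basis. g (R (\<mu> (e a) (e b))) (\<mu> (e a) (e b)))
      + (\<Sum>a\<in>Basis. \<Sum>b\<in>Basis. g (\<mu> (R (e a)) (e b)) (\<mu> (e a) (e b)))
      + (\<Sum>a\<in>Basis. \<Sum>b\<in>Basis. g (\<mu> (e a) (R (e b))) (\<mu> (e a) (e b)))"
    by (simp add: g_simps sum.distrib sum_subtractf distrib_left sum_negf)
  also have "\<dots> = - pairing ?M (flow_P \<mu>) + pairing ?M (flow_D \<mu>) + pairing ?M (flow_D \<mu>)"
    unfolding 1 2 3 ..
  also have "\<dots> = - 4 * pairing ?M (moment \<mu>)"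
    by (simp add: pairing_def moment_def sum.distrib sum_subtractf algebra_simps sum_distrib_left
        sum_negf diff_divide_distrib sum_divide_distrib)
  finally show ?thesis by (simp add: pairing_moment11[OF bil])
qed

text \<open>Matrix units of the frame, needed to form operators from their coefficients.\<close>
definition rank_one :: "'a \<Rightarrow> 'a \<Rightarrow> 'a \<Rightarrow>\<^sub>L 'a" where
  "rank_one b c = Blinfun (\<lambda>u. g u (e c) *\<^sub>R e b)"

lemma rank_one_apply: "blinfun_apply (rank_one b c) u = g u (e c) *\<^sub>R e b"
proof -
  have "bounded_linear (\<lambda>u. g u (e c) *\<^sub>R e b)"
    by (rule linear_conv_bounded_linear[THEN iffD1]) (intro linearI; simp add: g_simps algebra_simps)
  then show ?thesis by (simp add: rank_one_def bounded_linear_Blinfun_apply)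
qed

text \<open>The state is a pair \<open>(h, k)\<close>, where \<open>k\<close> is the inverse of \<open>h\<close> along the flow. Treating \<open>k\<close> as a
  separate unknown keeps the equation polynomial, and defined everywhere.\<close>
definition moved_bracket :: "('a \<Rightarrow>\<^sub>L 'a) \<times> ('a \<Rightarrow>\<^sub>L 'a) \<Rightarrow> 'a \<Rightarrow> 'a \<Rightarrow> 'a" where
  "moved_bracket x u v = fst x (br (snd x u) (snd x v))"

definition ricci_operator :: "('a \<Rightarrow>\<^sub>L 'a) \<times> ('a \<Rightarrow>\<^sub>L 'a) \<Rightarrow> 'a \<Rightarrow>\<^sub>L 'a" where
  "ricci_operator x = (\<Sum>c\<in>Basis. \<Sum>b\<in>Basis.
     moment11 (moved_bracket x) (e c) (e b) *\<^sub>R rank_one b c)"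

definition frame_field :: "('a \<Rightarrow>\<^sub>L 'a) \<times> ('a \<Rightarrow>\<^sub>L 'a) \<Rightarrow> ('a \<Rightarrow>\<^sub>L 'a) \<times> ('a \<Rightarrow>\<^sub>L 'a)" where
  "frame_field x = (- (1/2) *\<^sub>R (ricci_operator x o\<^sub>L fst x), (1/2) *\<^sub>R (snd x o\<^sub>L ricci_operator x))"

lemma bilinear_moved_bracket: "bilinear (moved_bracket x)"
  by (intro bilinear_of_linear linearI)
    (auto simp: moved_bracket_def blinfun.bilinear_simps br_simps)

lemma moved_bracket_antisym: "moved_bracket x u v = - moved_bracket x v u"
  using br_antisym[of "snd x u" "snd x v"] by (simp add: moved_bracket_def blinfun.bilinear_simps)

lemma g_ricci_operator: "g (ricci_operator x u) v = moment11 (moved_bracket x) u v"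
proof -
  note bl = bilinear_flow(4)[OF bilinear_moved_bracket[of x]]
  have "g (ricci_operator x u) v = (\<Sum>c\<in>Basis. \<Sum>b\<in>Basis.
      moment11 (moved_bracket x) (e c) (e b) * (g u (e c) * g v (e b)))"
    by (simp add: ricci_operator_def blinfun.sum_left blinfun.scaleR_left rank_one_apply g_simps
        g_sym[of v] mult.assoc)
  then show ?thesis by (simp add: bilinear_expansion[OF bl])
qed

lemma ricci_operator_J: "ricci_operator x (J u) = J (ricci_operator x u)"
proof (rule g_eqI)
  fix v
  note bil = bilinear_moved_bracket[of x]
  have "moment11 (moved_bracket x) (J u) v = - moment11 (moved_bracket x) u (J v)"
    using moment11_J[OF bil, of u "J v"] by (simp add: bilinear_simps[OF bilinear_flow(4)[OF bil]])
  then show "g (ricci_operator x (J u)) v = g (J (ricci_operator x u)) v"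
    using g_J[of "ricci_operator x u" v] by (simp add: g_ricci_operator)
qed

definition growth_rate :: "('a \<Rightarrow>\<^sub>L 'a) \<times> ('a \<Rightarrow>\<^sub>L 'a) \<Rightarrow> real" where
  "growth_rate x = bracket_norm2 (moved_bracket x) * (\<Sum>c\<in>Basis. \<Sum>b\<in>Basis. norm (rank_one b c))"

lemma growth_rate_nonneg: "growth_rate x \<ge> 0"
  unfolding growth_rate_def bracket_norm2_def
  by (intro mult_nonneg_nonneg sum_nonneg g_nonneg norm_ge_zero)

lemma ricci_operator_bound:
  "norm (ricci_operator x) \<le> growth_rate x"
proof -
  have "norm (ricci_operator x) \<le> (\<Sum>c\<in>Basis. \<Sum>b\<in>Basis.
      norm (moment11 (moved_bracket x) (e c) (e b) *\<^sub>R rank_one b c))"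
    unfolding ricci_operator_def by (intro order_trans[OF norm_sum] sum_mono order_refl)
  also have "\<dots> \<le> (\<Sum>c\<in>Basis. \<Sum>b\<in>Basis. bracket_norm2 (moved_bracket x) * norm (rank_one b c))"
    by (intro sum_mono) (simp add: moment11_bound[OF bilinear_moved_bracket] mult_right_mono)
  finally show ?thesis by (simp add: growth_rate_def sum_distrib_left)
qed

lemma bounded_bilinear_g: "bounded_bilinear g"
  using bilinear_g bilinear_conv_bounded_bilinear by blast

lemma lipschitz_frame_field: "lipschitz_on_balls frame_field"
proof -
  note bil = lipschitz_on_balls_bilinear
  have fst: "lipschitz_on_balls (fst :: ('a \<Rightarrow>\<^sub>L 'a) \<times> ('a \<Rightarrow>\<^sub>L 'a) \<Rightarrow> _)"
    and snd: "lipschitz_on_balls (snd :: ('a \<Rightarrow>\<^sub>L 'a) \<times> ('a \<Rightarrow>\<^sub>L 'a) \<Rightarrow> _)"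
    by (auto intro!: bounded_linear_fst bounded_linear_snd)
  have snd': "lipschitz_on_balls (\<lambda>x :: ('a \<Rightarrow>\<^sub>L 'a) \<times> ('a \<Rightarrow>\<^sub>L 'a).
      blinfun_apply (snd x) u)" for u
    by (intro bil[OF bounded_bilinear_blinfun_apply snd]) auto
  have brk: "lipschitz_on_balls (\<lambda>x. moved_bracket x u v)" for u v
    unfolding moved_bracket_def
    by (intro bil[OF bounded_bilinear_blinfun_apply fst]
        bil[OF bilinear_conv_bounded_bilinear[THEN iffD1, OF bilinear_br]] snd')
  have D: "lipschitz_on_balls (\<lambda>x. flow_D (moved_bracket x) u v)" for u v
    unfolding flow_D_def
    by (intro lipschitz_on_balls_sum bil[OF bounded_bilinear_g] brk)
  have P: "lipschitz_on_balls (\<lambda>x. flow_P (moved_bracket x) u v)" for u v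
    unfolding flow_P_def
    by (intro lipschitz_on_balls_sum bil[OF bounded_bilinear_mult] bil[OF bounded_bilinear_g] brk
        lipschitz_on_balls_const)
  have M: "lipschitz_on_balls (\<lambda>x. moment (moved_bracket x) u v)" for u v
  proof -
    have "lipschitz_on_balls (\<lambda>x. (1/4) * flow_P (moved_bracket x) u v + (-1/2) * flow_D (moved_bracket x) u v)"
      by (intro lipschitz_on_balls_add bil[OF bounded_bilinear_mult] lipschitz_on_balls_const D P)
    then show ?thesis by (simp add: moment_def)
  qed
  have M11: "lipschitz_on_balls (\<lambda>x. moment11 (moved_bracket x) u v)" for u v
  proof -
    have "lipschitz_on_balls (\<lambda>x. (1/2) * (moment (moved_bracket x) u v + moment (moved_bracket x) (J u) (J v)))"
      by (intro lipschitz_on_balls_add bil[OF bounded_bilinear_mult] lipschitz_on_balls_const M)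
    then show ?thesis by (simp add: moment11_def)
  qed
  have R: "lipschitz_on_balls ricci_operator"
    unfolding ricci_operator_def
    by (intro lipschitz_on_balls_sum bil[OF bounded_bilinear_scaleR] M11 lipschitz_on_balls_const)
  show ?thesis
    unfolding frame_field_def
    by (intro lipschitz_on_balls_Pair bil[OF bounded_bilinear_scaleR] lipschitz_on_balls_const
        bil[OF bounded_bilinear_blinfun_compose] R fst snd)
qed

text \<open>By \<open>bracket_norm2_variation\<close> the derivative is minus a sum of squares.\<close>
lemma bracket_norm2_nonincreasing:
  assumes x: "\<And>t. t \<in> {0..S} \<Longrightarrow> (x has_vector_derivative frame_field (x t)) (at t within {0..S})"
    and t: "t \<in> {0..S}"
  shows "bracket_norm2 (moved_bracket (x t)) \<le> bracket_norm2 (moved_bracket (x 0))"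
proof -
  let ?N = "\<lambda>t. bracket_norm2 (moved_bracket (x t))"
  have dN: "(?N has_vector_derivative
      - 4 * pairing (moment11 (moved_bracket (x s))) (moment11 (moved_bracket (x s)))) (at s within {0..S})"
    if s: "s \<in> {0..S}" for s
  proof -
    let ?R = "ricci_operator (x s)" and ?\<mu> = "\<lambda>t. moved_bracket (x t)"
    have dx: "(x has_vector_derivative frame_field (x s)) (at s within {0..S})" by (rule x[OF s])
    have dh: "((\<lambda>t. fst (x t)) has_vector_derivative fst (frame_field (x s))) (at s within {0..S})"
      by (rule bounded_linear.has_vector_derivative[OF bounded_linear_fst dx])
    have dk: "((\<lambda>t. snd (x t)) has_vector_derivative snd (frame_field (x s))) (at s within {0..S})"
      by (rule bounded_linear.has_vector_derivative[OF bounded_linear_snd dx])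
    have dku: "((\<lambda>t. snd (x t) u) has_vector_derivative snd (frame_field (x s)) u) (at s within {0..S})" for u
      by (rule bounded_linear.has_vector_derivative[OF blinfun.bounded_linear_left dk])
    have d\<mu>: "((\<lambda>t. ?\<mu> t u v) has_vector_derivative
        - (1/2) *\<^sub>R ?R (?\<mu> s u v) + (1/2) *\<^sub>R ?\<mu> s (?R u) v + (1/2) *\<^sub>R ?\<mu> s u (?R v)) (at s within {0..S})" for u v
    proof -
      have "((\<lambda>t. br (snd (x t) u) (snd (x t) v)) has_vector_derivative
          br (snd (x s) u) (snd (frame_field (x s)) v) + br (snd (frame_field (x s)) u) (snd (x s) v))
          (at s within {0..S})"
        by (rule bounded_bilinear.has_vector_derivative
            [OF bilinear_conv_bounded_bilinear[THEN iffD1, OF bilinear_br] dku dku])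
      from bounded_bilinear.has_vector_derivative[OF bounded_bilinear_blinfun_apply dh this]
      show ?thesis
        unfolding moved_bracket_def
        by (rule has_vector_derivative_eq_rhs)
          (simp add: frame_field_def blinfun.bilinear_simps br_simps)
    qed
    have dg: "((\<lambda>t. g (?\<mu> t u v) (?\<mu> t u v)) has_vector_derivative
        2 * g (- (1/2) *\<^sub>R ?R (?\<mu> s u v) + (1/2) *\<^sub>R ?\<mu> s (?R u) v + (1/2) *\<^sub>R ?\<mu> s u (?R v)) (?\<mu> s u v))
        (at s within {0..S})" for u v
      using bounded_bilinear.has_vector_derivative[OF bounded_bilinear_g d\<mu> d\<mu>]
      by (rule has_vector_derivative_eq_rhs) (simp add: g_sym[of "?\<mu> s u v"])
    have "(?N has_vector_derivative (\<Sum>a\<in>Basis. \<Sum>b\<in>Basis. 2 * g (- (1/2) *\<^sub>R ?R (?\<mu> s (e a) (e b))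
        + (1/2) *\<^sub>R ?\<mu> s (?R (e a)) (e b) + (1/2) *\<^sub>R ?\<mu> s (e a) (?R (e b))) (?\<mu> s (e a) (e b))))
        (at s within {0..S})"
      unfolding bracket_norm2_def by (intro has_vector_derivative_sum dg)
    then show ?thesis
      by (simp only: bracket_norm2_variation[OF bilinear_moved_bracket moved_bracket_antisym g_ricci_operator])
  qed
  show ?thesis
  proof (cases "t = 0")
    case False
    then have t0: "0 < t" using t by auto
    have "\<exists>\<xi>\<in>{0<..<t}. ?N t - ?N 0
        = (t - 0) *\<^sub>R (- 4 * pairing (moment11 (moved_bracket (x \<xi>))) (moment11 (moved_bracket (x \<xi>))))"
    proof (rule mvt_simple[OF t0])
      fix \<xi> assume "0 \<le> \<xi>" "\<xi> \<le> t"
      then have "(?N has_vector_derivative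
          - 4 * pairing (moment11 (moved_bracket (x \<xi>))) (moment11 (moved_bracket (x \<xi>)))) (at \<xi> within {0..t})"
        using t by (intro has_vector_derivative_within_subset[OF dN[of \<xi>]]) auto
      then show "(?N has_derivative (\<lambda>h. h *\<^sub>R (- 4 * pairing (moment11 (moved_bracket (x \<xi>)))
          (moment11 (moved_bracket (x \<xi>)))))) (at \<xi> within {0..t})"
        by (simp add: has_vector_derivative_def)
    qed
    then obtain \<xi> where \<xi>: "?N t - ?N 0
        = (t - 0) *\<^sub>R (- 4 * pairing (moment11 (moved_bracket (x \<xi>))) (moment11 (moved_bracket (x \<xi>))))"
      by blast
    have "pairing X X \<ge> 0" for X
      unfolding pairing_def by (intro sum_nonneg) auto
    then have "t * pairing (moment11 (moved_bracket (x \<xi>))) (moment11 (moved_bracket (x \<xi>))) \<ge> 0"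
      using t0 by simp
    then show ?thesis using \<xi> by simp
  qed simp
qed

lemma ricci_operator_bounded_along_flow:
  assumes x: "\<And>t. t \<in> {0..S} \<Longrightarrow> (x has_vector_derivative frame_field (x t)) (at t within {0..S})"
    and t: "t \<in> {0..S}"
  shows "norm (ricci_operator (x t)) \<le> growth_rate (x 0)"
proof -
  have "growth_rate (x t) \<le> growth_rate (x 0)"
    unfolding growth_rate_def using bracket_norm2_nonincreasing[OF x t]
    by (intro mult_right_mono sum_nonneg norm_ge_zero)
  then show ?thesis using ricci_operator_bound[of "x t"] by simp
qed

lemma frame_flow_exists:
  "\<exists>x. x 0 = (id_blinfun, id_blinfun) \<and>
    (\<forall>t\<ge>0. (x has_vector_derivative frame_field (x t)) (at t within {0..}))"
proof (rule ode_global_existence[OF lipschitz_frame_field])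
  fix T :: real assume "T \<ge> 0"
  let ?x0 = "(id_blinfun, id_blinfun) :: ('a \<Rightarrow>\<^sub>L 'a) \<times> ('a \<Rightarrow>\<^sub>L 'a)"
  let ?C = "growth_rate ?x0"
  have "norm (x t) \<le> 2 * norm ?x0 * exp (2 * ?C * T)"
    if S: "S \<le> T" and x0: "x 0 = ?x0" and t: "t \<in> {0..S}"
      and x: "\<And>t. t \<in> {0..S} \<Longrightarrow> (x has_vector_derivative frame_field (x t)) (at t within {0..S})" for S x t
  proof -
    have "norm (x t) \<le> 2 * norm (x 0) * exp (2 * ?C * t)"
    proof (rule gronwall_norm[OF x _ growth_rate_nonneg t])
      fix s assume s: "s \<in> {0..S}"
      have R: "norm (ricci_operator (x s)) \<le> ?C"
        using ricci_operator_bounded_along_flow[OF x s] by (simp only: x0)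
      have "norm (frame_field (x s))
          \<le> norm (ricci_operator (x s) o\<^sub>L fst (x s)) / 2 + norm (snd (x s) o\<^sub>L ricci_operator (x s)) / 2"
        unfolding frame_field_def by (rule order_trans[OF norm_Pair_le]) simp
      also have "\<dots> \<le> (?C * norm (x s)) / 2 + (norm (x s) * ?C) / 2"
      proof (intro add_mono divide_right_mono)
        show "norm (ricci_operator (x s) o\<^sub>L fst (x s)) \<le> ?C * norm (x s)"
          by (rule order_trans[OF norm_blinfun_compose], rule mult_mono[OF R _ growth_rate_nonneg])
            (use norm_fst_le[of "fst (x s)" "snd (x s)"] in auto)
        show "norm (snd (x s) o\<^sub>L ricci_operator (x s)) \<le> norm (x s) * ?C"
          by (rule order_trans[OF norm_blinfun_compose], rule mult_mono[OF _ R])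
            (use norm_snd_le[of "snd (x s)" "fst (x s)"] in auto)
      qed auto
      finally show "norm (frame_field (x s)) \<le> ?C * norm (x s)" by (simp add: mult.commute)
    qed
    also have "\<dots> \<le> 2 * norm (x 0) * exp (2 * ?C * T)"
      using growth_rate_nonneg S t by (intro mult_left_mono) (auto intro!: mult_left_mono)
    finally show ?thesis by (simp only: x0)
  qed
  then show "\<exists>R. \<forall>S x. 0 \<le> S \<and> S \<le> T \<and> x 0 = ?x0 \<and>
      (\<forall>t\<in>{0..S}. (x has_vector_derivative frame_field (x t)) (at t within {0..S})) \<longrightarrow>
      (\<forall>t\<in>{0..S}. norm (x t) \<le> R)"
    by (intro exI[of _ "2 * norm ?x0 * exp (2 * ?C * T)"]) blast
qed

text \<open>The metric \<open>g(h \<cdot>, h \<cdot>)\<close> has the orthonormal frame \<open>k (e b)\<close>, to which the formula for the Ricci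
  tensor applies; its Killing part has no \<open>(1,1)\<close>-part.\<close>
lemma moved_metric_Ric11:
  assumes h: "linear h" and k: "linear k" and kh: "\<And>v. k (h v) = v" and hk: "\<And>v. h (k v) = v"
    and hJ: "\<And>v. h (J v) = J (h v)"
  shows "Ric11 br J (\<lambda>x y. g (h x) (h y)) x y = moment11 (\<lambda>u v. h (br (k u) (k v))) (h x) (h y)"
proof -
  note hs = linear_map_simps[OF h]
  interpret G: abelian_hermitian "\<lambda>x y. g (h x) (h y)" "\<lambda>b. k (e b)" br J
  proof (unfold_locales)
    show "bilinear (\<lambda>x y. g (h x) (h y))"
      by (intro bilinear_of_linear linearI) (auto simp: hs g_simps)
  qed (auto simp: hk hJ orthonormal lie_bracket unimodular J_simps intro: g_sym)
  have D: "G.ric_D x y = flow_D (\<lambda>u v. h (br (k u) (k v))) (h x) (h y)" for x y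
    by (simp add: G.ric_D_def flow_D_def kh)
  have P: "G.ric_P x y = flow_P (\<lambda>u v. h (br (k u) (k v))) (h x) (h y)" for x y
    by (simp add: G.ric_P_def flow_P_def)
  show ?thesis
    using G.killing_11[of y x]
    by (simp add: Ric11_def G.Ric_formula moment11_def moment_def D P hJ field_simps)
qed

text \<open>Differentiating \<open>g(h x, h y)\<close> along \<open>h' = - R h / 2\<close> gives \<open>- g(R h x, h y)\<close>, because \<open>R\<close> is
  symmetric. Positivity of the metric is inherited from \<open>g\<close> by the injectivity of \<open>h\<close>.\<close>
theorem ricci11_flow_exists:
  "\<exists>G. G 0 = g \<and> (\<forall>t\<ge>0. hermitian_metric J (G t)) \<and>
    (\<forall>t\<ge>0. \<forall>x y. ((\<lambda>s. G s x y) has_real_derivative - Ric11 br J (G t) x y) (at t within {0..}))"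
proof -
  obtain x where x0: "x 0 = (id_blinfun, id_blinfun)"
    and x: "\<And>t. t \<ge> 0 \<Longrightarrow> (x has_vector_derivative frame_field (x t)) (at t within {0..})"
    using frame_flow_exists by blast
  define h where "h t = fst (x t)" for t
  define k where "k t = snd (x t)" for t
  define R where "R t = ricci_operator (x t)" for t
  have dh: "(h has_vector_derivative - (1/2) *\<^sub>R (R t o\<^sub>L h t)) (at t within {0..})" if "t \<ge> 0" for t
    using bounded_linear.has_vector_derivative[OF bounded_linear_fst x[OF that]]
    by (simp add: h_def[abs_def] R_def frame_field_def)
  have dk: "(k has_vector_derivative (1/2) *\<^sub>R (k t o\<^sub>L R t)) (at t within {0..})" if "t \<ge> 0" for t
    using bounded_linear.has_vector_derivative[OF bounded_linear_snd x[OF that]]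
    by (simp add: k_def[abs_def] R_def frame_field_def)
  \<comment> \<open>The derivative of \<open>k h\<close> vanishes identically, whereas that of \<open>h k\<close> would only do so after
    knowing \<open>h k = 1\<close>; so \<open>h k = 1\<close> follows from finite dimension.\<close>
  have kh: "k t (h t v) = v" if t: "t \<ge> 0" for t v
  proof -
    have "((\<lambda>t. k t o\<^sub>L h t) has_vector_derivative 0) (at t within {0..})" if "t \<in> {0..}" for t
      by (rule has_vector_derivative_eq_rhs
            [OF bounded_bilinear.has_vector_derivative[OF bounded_bilinear_blinfun_compose dk dh]])
        (use that in \<open>auto intro!: blinfun_eqI simp: blinfun.bilinear_simps\<close>)
    then obtain c where c: "\<And>t. t \<in> {0..} \<Longrightarrow> k t o\<^sub>L h t = c"
      using has_vector_derivative_zero_constant[of "{0..}" "\<lambda>t. k t o\<^sub>L h t"] by auto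
    have "k t o\<^sub>L h t = k 0 o\<^sub>L h 0" using c[of t] c[of 0] t by simp
    then have "blinfun_apply (k t o\<^sub>L h t) v = blinfun_apply (k 0 o\<^sub>L h 0) v" by simp
    then show ?thesis by (simp add: h_def k_def x0)
  qed
  have lin: "linear (h t)" "linear (k t)" for t
    by (auto intro: bounded_linear.linear blinfun.bounded_linear_right)
  have hk: "h t (k t v) = v" if t: "t \<ge> 0" for t v
  proof -
    have "k t \<circ> h t = id" using kh[OF t] by (auto simp: fun_eq_iff)
    then have "h t \<circ> k t = id" using linear_inverse_left[OF lin(2)[of t] lin(1)[of t]] by simp
    then show ?thesis by (metis comp_apply id_apply)
  qed
  have hJ: "h t (J v) = J (h t v)" if t: "t \<ge> 0" for t v
  proof -
    have "bounded_linear J" using linear_J by (simp add: linear_conv_bounded_linear)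
    then have J: "blinfun_apply (Blinfun J) = J" by (rule bounded_linear_Blinfun_apply)
    \<comment> \<open>As \<open>R\<close> commutes with \<open>J\<close>, the commutator of \<open>h\<close> and \<open>J\<close> solves a linear equation, with initial
      value zero.\<close>
    let ?f = "\<lambda>s. (h s o\<^sub>L Blinfun J) - (Blinfun J o\<^sub>L h s)"
    have RJ: "blinfun_apply (R s) (J u) = J (R s u)" for s u by (simp add: R_def ricci_operator_J)
    have df: "(?f has_vector_derivative - (1/2) *\<^sub>R (R s o\<^sub>L ?f s)) (at s within {0..t})"
      if s: "s \<in> {0..t}" for s
    proof -
      have dhs: "(h has_vector_derivative - (1/2) *\<^sub>R (R s o\<^sub>L h s)) (at s within {0..t})"
        using s by (intro has_vector_derivative_within_subset[OF dh[of s]]) auto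
      have "(?f has_vector_derivative (- (1/2) *\<^sub>R (R s o\<^sub>L h s) o\<^sub>L Blinfun J)
          - (Blinfun J o\<^sub>L - (1/2) *\<^sub>R (R s o\<^sub>L h s))) (at s within {0..t})"
        by (intro has_vector_derivative_diff
            bounded_linear.has_vector_derivative[OF bounded_bilinear.bounded_linear_left[OF bounded_bilinear_blinfun_compose] dhs]
            bounded_linear.has_vector_derivative[OF bounded_bilinear.bounded_linear_right[OF bounded_bilinear_blinfun_compose] dhs])
      then show ?thesis
        by (rule has_vector_derivative_eq_rhs)
          (auto intro!: blinfun_eqI simp: blinfun.bilinear_simps J RJ J_simps scaleR_diff_right)
    qed
    have xS: "(x has_vector_derivative frame_field (x s)) (at s within {0..t})" if "s \<in> {0..t}" for s
      using that by (intro has_vector_derivative_within_subset[OF x[of s]]) auto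
    let ?C = "growth_rate (x 0)"
    have "norm (?f t) \<le> 2 * norm (?f 0) * exp (2 * ?C * t)"
    proof (rule gronwall_norm[OF df _ growth_rate_nonneg])
      fix s assume s: "s \<in> {0..t}"
      have "norm (R s) \<le> ?C"
        using ricci_operator_bounded_along_flow[OF xS s] by (simp only: R_def)
      then have "norm (R s) * norm (?f s) \<le> ?C * norm (?f s)" by (intro mult_right_mono) auto
      then have "norm (R s o\<^sub>L ?f s) \<le> ?C * norm (?f s)"
        using norm_blinfun_compose[of "R s" "?f s"] by (rule order_trans[rotated])
      moreover have "norm (- (1/2) *\<^sub>R (R s o\<^sub>L ?f s)) \<le> norm (R s o\<^sub>L ?f s)"
        by simp
      ultimately show "norm (- (1/2) *\<^sub>R (R s o\<^sub>L ?f s)) \<le> ?C * norm (?f s)"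
        by (rule order_trans[rotated])
    qed (use t in auto)
    also have "?f 0 = 0" by (auto intro!: blinfun_eqI simp: h_def x0 J blinfun.bilinear_simps)
    finally have "blinfun_apply (?f t) v = 0" by simp
    then show ?thesis by (simp add: J blinfun.bilinear_simps)
  qed
  define G where "G t u v = g (h t u) (h t v)" for t u v
  have "G 0 = g" by (auto simp: G_def h_def x0 fun_eq_iff)
  moreover have "hermitian_metric J (G t)" if t: "t \<ge> 0" for t
  proof -
    note hs = linear_map_simps[OF lin(1)[of t]]
    have "bilinear (G t)" unfolding G_def
      by (intro bilinear_of_linear linearI) (auto simp: hs g_simps)
    moreover have "h t u \<noteq> 0" if "u \<noteq> 0" for u
      using kh[OF t, of u] that by (metis blinfun.zero_right)
    ultimately show ?thesis
      unfolding hermitian_metric_def by (auto simp: G_def g_sym g_pos hJ[OF t])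
  qed
  moreover have "((\<lambda>s. G s u v) has_real_derivative - Ric11 br J (G t) u v) (at t within {0..})"
    if t: "t \<ge> 0" for t u v
  proof -
    have d: "((\<lambda>s. h s u) has_vector_derivative (- (1/2) *\<^sub>R (R t o\<^sub>L h t)) u) (at t within {0..})" for u
      by (rule bounded_linear.has_vector_derivative[OF blinfun.bounded_linear_left dh[OF t]])
    have gR: "g (R t u) v = moment11 (moved_bracket (x t)) u v" for u v
      by (simp add: R_def g_ricci_operator)
    have gR': "g u (R t v) = moment11 (moved_bracket (x t)) u v" for u v
      using g_sym[of u "R t v"] by (simp add: gR flow_sym(3)[of _ v])
    have "((\<lambda>s. G s u v) has_vector_derivative - moment11 (moved_bracket (x t)) (h t u) (h t v))
        (at t within {0..})"
      unfolding G_def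
      by (rule has_vector_derivative_eq_rhs[OF bounded_bilinear.has_vector_derivative[OF bounded_bilinear_g d d]])
        (simp add: blinfun.bilinear_simps g_simps gR gR')
    moreover have "moment11 (moved_bracket (x t)) (h t u) (h t v) = Ric11 br J (G t) u v"
      using moved_metric_Ric11[OF lin kh[OF t] hk[OF t] hJ[OF t]]
      by (simp add: G_def[abs_def] moved_bracket_def[abs_def] h_def k_def)
    ultimately show ?thesis by (simp add: has_real_derivative_iff_has_vector_derivative)
  qed
  ultimately show ?thesis by blast
qed

end

section \<open>Balanced metrics, the tensor \<open>K\<close> and long-time existence\<close>

lemma abelian_structure_bracket:
  assumes "bilinear br" "linear J" "\<And>x. J (J x) = - x" "abelian_structure br J"
  shows "br (J x) (J y) = br x y"
proof -
  note J = linear_map_simps[OF assms(2)]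
  have "(u, - J u) \<in> g10 J" for u
    by (simp add: g10_def ext_lin_def cpx_scale_def J assms(3))
  then have "ext_bil br (x, - J x) (y, - J y) = 0"
    using assms(4) unfolding abelian_structure_def by blast
  then show ?thesis by (simp add: ext_bil_def zero_prod_def bilinear_simps[OF assms(1)])
qed

lemma abelian_hermitian_exists:
  assumes "lie_bracket br" "unimodular br" "complex_structure br J" "abelian_structure br J"
    and "hermitian_metric J g"
  shows "\<exists>e. abelian_hermitian g e br J"
proof -
  obtain e where "orthonormal_frame g e"
    using orthonormal_frame_exists[of g] assms(5) unfolding hermitian_metric_def by blast
  then interpret orthonormal_frame g e .
  have J: "linear J" "J (J x) = - x" for x using assms(3) by (simp_all add: complex_structure_def)
  have br: "br (J x) (J y) = br x y" for x y
    using assms(1) J by (intro abelian_structure_bracket[OF _ _ _ assms(4)]) (simp_all add: lie_bracket_def)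
  have g: "g (J x) (J y) = g x y" for x y using assms(5) by (simp add: hermitian_metric_def)
  have "abelian_hermitian g e br J"
    by unfold_locales (simp_all add: assms(1,2) linear_map_simps[OF J(1)] J(2) br g)
  then show ?thesis by blast
qed

theorem theorem6p2:
  fixes br :: "'a::euclidean_space \<Rightarrow> 'a \<Rightarrow> 'a" and J :: "'a \<Rightarrow> 'a"
  assumes "lie_bracket br"
    and "unimodular br"
    and "complex_structure br J"
    and "abelian_structure br J"
  shows "(\<forall>(g :: 'a \<Rightarrow> 'a \<Rightarrow> real) (Z :: 'n::finite \<Rightarrow> 'a cpx).
            hermitian_metric J g \<and> frame10 J Z \<longrightarrow>
              (balanced br J g \<longleftrightarrow>
                 tr_herm g Z (K_tensor br J g Z) = tr_herm g Z (hcomp (Ric br g) Z)) \<and>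
              (balanced br J g \<longrightarrow>
                 (\<forall>i j. K_tensor br J g Z i j = hcomp (Ric11 br J g) Z i j))) \<and>
         (\<forall>g0 :: 'a \<Rightarrow> 'a \<Rightarrow> real. hermitian_metric J g0 \<longrightarrow>
            (\<exists>g :: real \<Rightarrow> 'a \<Rightarrow> 'a \<Rightarrow> real.
               g 0 = g0 \<and>
               (\<forall>t\<ge>0. hermitian_metric J (g t)) \<and>
               (\<forall>t\<ge>0. \<forall>x y.
                  ((\<lambda>s. g s x y) has_real_derivative - Ric11 br J (g t) x y) (at t within {0..}))))"
proof (intro conjI allI impI)
  fix g :: "'a \<Rightarrow> 'a \<Rightarrow> real" and Z :: "'n \<Rightarrow> 'a cpx"
  assume gZ: "hermitian_metric J g \<and> frame10 J Z"
  then obtain e where "abelian_hermitian g e br J"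
    using abelian_hermitian_exists[OF assms] by blast
  then interpret abelian_hermitian_frame g e br J Z
    using gZ by (simp add: abelian_hermitian_frame_def abelian_hermitian_frame_axioms_def)
  show "balanced br J g \<longleftrightarrow> tr_herm g Z (K_tensor br J g Z) = tr_herm g Z (hcomp (Ric br g) Z)"
    by (rule balanced_iff_trace)
  fix i j assume "balanced br J g"
  then show "K_tensor br J g Z i j = hcomp (Ric11 br J g) Z i j" by (rule balanced_K_tensor_eq_Ric11)
next
  fix g0 :: "'a \<Rightarrow> 'a \<Rightarrow> real"
  assume "hermitian_metric J g0"
  then obtain e where "abelian_hermitian g0 e br J"
    using abelian_hermitian_exists[OF assms] by blast
  then interpret abelian_hermitian g0 e br J .
  show "\<exists>g :: real \<Rightarrow> 'a \<Rightarrow> 'a \<Rightarrow> real. g 0 = g0 \<and> (\<forall>t\<ge>0. hermitian_metric J (g t)) \<and>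
      (\<forall>t\<ge>0. \<forall>x y. ((\<lambda>s. g s x y) has_real_derivative - Ric11 br J (g t) x y) (at t within {0..}))"
    by (rule ricci11_flow_exists)
qed

end
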